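(* Let $k\ge 1$ be an integer, $\beta>0$, $\sigma\ge k+1$, and let $b,f$ be sufficiently smooth functions on $[0,1]$ with $b(x)\ge\beta^2$. Let $C_0,C_1>0$ be constants. Then there is a constant $C>0$, independent of $\varepsilon$ and $N$, such that the following holds for every $0<\varepsilon<1$ and every integer $N\ge 4$ divisible by $4$ with $\varepsilon\le C_0N^{-1}$ and $\tau=\sigma\sqrt{\varepsilon}\,\ln N/\beta\le \tfrac14$. Let $u$ be the solution of $-\varepsilon u''+b(x)u=f(x)$ on $(0,1)$, $u(0)=u(1)=0$, and put $q=\varepsilon u'$, $w=(q,u)$. Assume that $u=\bar u+u_{\varepsilon,1}+u_{\varepsilon,2}$ on $[0,1]$ where, for $j=0,1,\dots,k+2$ and $x\in[0,1]$, $$\Big|\frac{d^j\bar u}{dx^j}(x)\Big|\le C_1,\qquad \Big|\frac{d^ju_{\varepsilon,1}}{dx^j}(x)\Big|\le C_1\varepsilon^{-j/2}e^{-\beta x/\sqrt\varepsilon},\qquad \Big|\frac{d^ju_{\varepsilon,2}}{dx^j}(x)\Big|\le C_1\varepsilon^{-j/2}e^{-\beta(1-x)/\sqrt\varepsilon}.$$ Let $W=(Q,U)\in V_N\times V_N$ be the numerical solution of the LDG scheme (defined in the context) on the Shishkin mesh with parameters $\sigma,\beta,\varepsilon,N$, and let $e=w-W=(q-Q,u-U)$. Then $$|||e|||_E\le C\left(\varepsilon^{1/4}(N^{-1}\ln N)^{k+1}+\varepsilon^{1/2}N^{-k}+N^{-(k+1)}\right),$$ $$|||e|||_B\le C\left(\varepsilon^{1/2}(N^{-1}\ln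 N)^{k+1}+\varepsilon^{1/4}N^{-k}+(N^{-1}\ln N)^{k+1}\right).$$
   Context: **Shishkin mesh.** With $\tau=\sigma\sqrt\varepsilon\ln N/\beta\le 1/4$, the points $0=x_0<x_1<\dots<x_N=1$ divide $[0,\tau]$ into $N/4$ equal subintervals, $[\tau,1-\tau]$ into $N/2$ equal subintervals, and $[1-\tau,1]$ into $N/4$ equal subintervals (so $x_{N/4}=\tau$, $x_{3N/4}=1-\tau$). Put $I_j=(x_{j-1},x_j)$ for $j=1,\dots,N$. **Finite element space.** $V_N=\{v\in L^2(0,1): v|_{I_j}\in\mathbb P_k(I_j),\ 1\le j\le N\}$, where $\mathbb P_k(I_j)$ is the space of polynomials of degree at most $k$ on $I_j$. **Traces and jumps.** For a piecewise smooth (with respect to the mesh) function $v$, $v_j^{\pm}=\lim_{x\to x_j^{\pm}}v(x)$. The jumps are $[[v]]_j=v_j^+-v_j^-$ for $1\le j\le N-1$, $[[v]]_0=v_0^+$, $[[v]]_N=-v_N^-$. **Inner products.** $\langle\cdot,\cdot\rangle_{I_j}$ is the $L^2(I_j)$ inner product; $\|\cdot\|$ is the $L^2(0,1)$ norm. **LDG scheme.** Find $W=(Q,U)\in V_N\times V_N$ such that for every $j=1,\dots,N$ and all $(r,v)\in V_N\times V_N$, $$\varepsilon^{-1}\langle Q,r\rangle_{I_j}+\langle U,r'\rangle_{I_j}-\hat U_jr_j^-+\hat U_{j-1}r_{j-1}^+=0,$$ $$\langle Q,v'\rangle_{I_j}+\langle bU,v\rangle_{I_j}-\hat Q_jv_j^-+\hat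 Q_{j-1}v_{j-1}^+=\langle f,v\rangle_{I_j},$$ with numerical fluxes $$\hat Q_0=Q_0^++\lambda_0U_0^+,\qquad \hat Q_j=Q_j^+\ (1\le j\le N-1),\qquad \hat Q_N=Q_N^--\lambda_NU_N^-,$$ $$\hat U_0=\hat U_N=0,\qquad \hat U_{3N/4}=U_{3N/4}^-+\lambda_q[[Q]]_{3N/4},\qquad \hat U_j=U_j^-\ (1\le j\le N-1,\ j\ne 3N/4),$$ where $\lambda_0=\lambda_N=\sqrt\varepsilon$ and $\lambda_q=1/\sqrt\varepsilon$. **Norms.** For a pair $w=(q,u)$ of functions that are piecewise smooth with respect to the mesh, $$|||w|||_E^2=\varepsilon^{-1}\|q\|^2+\|b^{1/2}u\|^2+\sum_{j\in\{0,N\}}\lambda_j[[u]]_j^2+\lambda_q[[q]]_{3N/4}^2,$$ $$|||w|||_B^2=\varepsilon^{-3/2}\|q\|^2+\|b^{1/2}u\|^2+\sum_{j\in\{0,N\}}[[u]]_j^2+[[q]]_{3N/4}^2.$$ **Constants.** $C$ may depend on $k,\sigma,\beta,b,f,C_0,C_1$ but not on $\varepsilon$ or $N$. *)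

theory Defs
  imports
    "HOL-Analysis.Analysis"
    "HOL-Computational_Algebra.Polynomial"
begin

(* Derivatives are taken within S, so that they are one-sided at the end points of S = [0,1]. *)

primrec nderiv_on :: "real set \<Rightarrow> nat \<Rightarrow> (real \<Rightarrow> real) \<Rightarrow> real \<Rightarrow> real" where
  "nderiv_on S 0 g = g"
| "nderiv_on S (Suc j) g = (\<lambda>x. vector_derivative (nderiv_on S j g) (at x within S))"

definition times_differentiable_on :: "real set \<Rightarrow> nat \<Rightarrow> (real \<Rightarrow> real) \<Rightarrow> bool" where
  "times_differentiable_on S m g \<longleftrightarrow>
     (\<forall>j<m. \<forall>x\<in>S. nderiv_on S j g differentiable (at x within S))"

definition C_class_on :: "real set \<Rightarrow> nat \<Rightarrow> (real \<Rightarrow> real) \<Rightarrow> bool" where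
  "C_class_on S m g \<longleftrightarrow> times_differentiable_on S m g \<and> continuous_on S (nderiv_on S m g)"

definition is_bvp_solution ::
    "real \<Rightarrow> (real \<Rightarrow> real) \<Rightarrow> (real \<Rightarrow> real) \<Rightarrow> (real \<Rightarrow> real) \<Rightarrow> bool" where
  "is_bvp_solution \<epsilon> b f u \<longleftrightarrow>
     continuous_on {0..1} u \<and>
     (\<forall>x\<in>{0<..<1}. u differentiable (at x) \<and> deriv u differentiable (at x) \<and>
        - \<epsilon> * deriv (deriv u) x + b x * u x = f x) \<and>
     u 0 = 0 \<and> u 1 = 0"

definition transition :: "real \<Rightarrow> real \<Rightarrow> real \<Rightarrow> nat \<Rightarrow> real" where
  "transition \<sigma> \<beta> \<epsilon> N = \<sigma> * sqrt \<epsilon> * ln (real N) / \<beta>"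

definition shishkin :: "real \<Rightarrow> real \<Rightarrow> real \<Rightarrow> nat \<Rightarrow> nat \<Rightarrow> real" where
  "shishkin \<sigma> \<beta> \<epsilon> N j =
     (let \<tau> = transition \<sigma> \<beta> \<epsilon> N; n = real N in
      if j \<le> N div 4 then real j * (\<tau> / (n / 4))
      else if j \<le> 3 * (N div 4) then \<tau> + (real j - n / 4) * ((1 - 2 * \<tau>) / (n / 2))
      else (1 - \<tau>) + (real j - 3 * n / 4) * (\<tau> / (n / 4)))"

(* In all of the following, x is the sequence of mesh points and the cell j, for 1 <= j <= N,
   is the open interval between x (j - 1) and x j. *)

definition cell :: "(nat \<Rightarrow> real) \<Rightarrow> nat \<Rightarrow> real set" where
  "cell x j = {x (j - 1)<..<x j}"

(* Elements of the space are represented by functions; their values at the mesh points and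
   outside [0,1] are unconstrained, and no notion below depends on them.  Square
   integrability on (0,1) is automatic. *)

definition fe_space :: "nat \<Rightarrow> (nat \<Rightarrow> real) \<Rightarrow> nat \<Rightarrow> (real \<Rightarrow> real) set" where
  "fe_space k x N =
     {v. \<forall>j\<in>{1..N}. \<exists>p :: real poly. degree p \<le> k \<and> (\<forall>y\<in>cell x j. v y = poly p y)}"

definition trace_plus :: "(nat \<Rightarrow> real) \<Rightarrow> (real \<Rightarrow> real) \<Rightarrow> nat \<Rightarrow> real" where
  "trace_plus x v j = Lim (at_right (x j)) v"

definition trace_minus :: "(nat \<Rightarrow> real) \<Rightarrow> (real \<Rightarrow> real) \<Rightarrow> nat \<Rightarrow> real" where
  "trace_minus x v j = Lim (at_left (x j)) v"

definition jump :: "(nat \<Rightarrow> real) \<Rightarrow> nat \<Rightarrow> (real \<Rightarrow> real) \<Rightarrow> nat \<Rightarrow> real" where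
  "jump x N v j =
     (if j = 0 then trace_plus x v 0
      else if j = N then - trace_minus x v N
      else trace_plus x v j - trace_minus x v j)"

definition inner_on :: "real set \<Rightarrow> (real \<Rightarrow> real) \<Rightarrow> (real \<Rightarrow> real) \<Rightarrow> real" where
  "inner_on A g h = (LINT y:A|lborel. g y * h y)"

definition L2_norm01 :: "(real \<Rightarrow> real) \<Rightarrow> real" where
  "L2_norm01 g = sqrt (inner_on {0<..<1} g g)"

definition lam_bd :: "real \<Rightarrow> real" where
  "lam_bd \<epsilon> = sqrt \<epsilon>"

definition lam_q :: "real \<Rightarrow> real" where
  "lam_q \<epsilon> = 1 / sqrt \<epsilon>"

definition flux_Q ::
    "real \<Rightarrow> (nat \<Rightarrow> real) \<Rightarrow> nat \<Rightarrow> (real \<Rightarrow> real) \<Rightarrow> (real \<Rightarrow> real) \<Rightarrow> nat \<Rightarrow> real" where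
  "flux_Q \<epsilon> x N Q U j =
     (if j = 0 then trace_plus x Q 0 + lam_bd \<epsilon> * trace_plus x U 0
      else if j = N then trace_minus x Q N - lam_bd \<epsilon> * trace_minus x U N
      else trace_plus x Q j)"

definition flux_U ::
    "real \<Rightarrow> (nat \<Rightarrow> real) \<Rightarrow> nat \<Rightarrow> (real \<Rightarrow> real) \<Rightarrow> (real \<Rightarrow> real) \<Rightarrow> nat \<Rightarrow> real" where
  "flux_U \<epsilon> x N Q U j =
     (if j = 0 \<or> j = N then 0
      else if j = 3 * (N div 4) then trace_minus x U j + lam_q \<epsilon> * jump x N Q j
      else trace_minus x U j)"

definition is_LDG_solution ::
    "nat \<Rightarrow> real \<Rightarrow> (real \<Rightarrow> real) \<Rightarrow> (real \<Rightarrow> real) \<Rightarrow> (nat \<Rightarrow> real) \<Rightarrow> nat \<Rightarrow>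
     (real \<Rightarrow> real) \<Rightarrow> (real \<Rightarrow> real) \<Rightarrow> bool" where
  "is_LDG_solution k \<epsilon> b f x N Q U \<longleftrightarrow>
     Q \<in> fe_space k x N \<and> U \<in> fe_space k x N \<and>
     (\<forall>j\<in>{1..N}. \<forall>r\<in>fe_space k x N. \<forall>v\<in>fe_space k x N.
        inverse \<epsilon> * inner_on (cell x j) Q r + inner_on (cell x j) U (deriv r)
          - flux_U \<epsilon> x N Q U j * trace_minus x r j
          + flux_U \<epsilon> x N Q U (j - 1) * trace_plus x r (j - 1) = 0 \<and>
        inner_on (cell x j) Q (deriv v) + inner_on (cell x j) (\<lambda>y. b y * U y) v
          - flux_Q \<epsilon> x N Q U j * trace_minus x v j
          + flux_Q \<epsilon> x N Q U (j - 1) * trace_plus x v (j - 1) = inner_on (cell x j) f v)"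

definition energy_norm ::
    "real \<Rightarrow> (real \<Rightarrow> real) \<Rightarrow> (nat \<Rightarrow> real) \<Rightarrow> nat \<Rightarrow> (real \<Rightarrow> real) \<times> (real \<Rightarrow> real) \<Rightarrow> real" where
  "energy_norm \<epsilon> b x N w = (case w of (q, u) \<Rightarrow>
     sqrt (inverse \<epsilon> * (L2_norm01 q)\<^sup>2 + (L2_norm01 (\<lambda>y. sqrt (b y) * u y))\<^sup>2
       + (\<Sum>j\<in>{0, N}. lam_bd \<epsilon> * (jump x N u j)\<^sup>2)
       + lam_q \<epsilon> * (jump x N q (3 * (N div 4)))\<^sup>2))"

definition balanced_norm ::
    "real \<Rightarrow> (real \<Rightarrow> real) \<Rightarrow> (nat \<Rightarrow> real) \<Rightarrow> nat \<Rightarrow> (real \<Rightarrow> real) \<times> (real \<Rightarrow> real) \<Rightarrow> real" where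
  "balanced_norm \<epsilon> b x N w = (case w of (q, u) \<Rightarrow>
     sqrt (\<epsilon> powr (- 3 / 2) * (L2_norm01 q)\<^sup>2 + (L2_norm01 (\<lambda>y. sqrt (b y) * u y))\<^sup>2
       + (\<Sum>j\<in>{0, N}. (jump x N u j)\<^sup>2)
       + (jump x N q (3 * (N div 4)))\<^sup>2))"

end

theory Submission
  imports Defs
begin

text \<open>
  The error is split into a projection error and a discrete error. On the fine cells, \<open>u\<close> and \<open>q\<close> are
  projected by Gauss-Radau projections that match the right, respectively left, end point; on the coarse
  cells, \<open>u\<close> by the \<open>b\<close>-weighted and \<open>q\<close> by the plain \<open>L\<^sup>2\<close> projection. So all coarse zero-order terms of the
  consistency error vanish; there only traces and the term with \<open>r'\<close> remain, and an inverse inequality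
  bounds them by \<open>\<epsilon>\<^sup>1\<^sup>/\<^sup>2 N\<^sup>-\<^sup>k\<close> times the energy norm. The jump of \<open>q\<close> penalised at \<open>x\<^sub>3\<^sub>N\<^sub>/\<^sub>4\<close> absorbs the trace of
  the projection error of \<open>u\<close> there.
  The trace of the projection error of \<open>q\<close> at \<open>x\<^sub>N\<^sub>/\<^sub>4\<close> cannot be paid for by an inverse inequality on the fine
  side. It is removed by subtracting that very number from the projection of \<open>q\<close> on all left fine cells:
  constants pass through the flux of \<open>q\<close>, so the shift costs only its small \<open>L\<^sup>2\<close> norm.

  The discrete error is then bounded in the energy norm by a multiple of
  \<open>\<epsilon>\<^sup>1\<^sup>/\<^sup>4 (N\<^sup>-\<^sup>1 ln N)\<^sup>k\<^sup>+\<^sup>1 + \<epsilon>\<^sup>1\<^sup>/\<^sup>2 N\<^sup>-\<^sup>k\<close>, and the spare factor \<open>\<epsilon>\<^sup>1\<^sup>/\<^sup>4\<close> pays for the passage to the balanced norm.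
\<close>

subsection \<open>Polynomials on an interval\<close>

text \<open>Traces of the discrete error can be afforded on coarse cells only. There the width is at
  least \<open>1 / N\<close>, and an inverse inequality turns nodal defects of order
  \<open>S = (1 / N) ^ (k + 1)\<close> for \<open>u\<close> and \<open>s * S\<close> for
  \<open>q\<close>, where \<open>s = sqrt \<epsilon>\<close>, into a contribution of order
  \<open>s * N * S\<close> to the energy norm. On a fine cell the width is of order
  \<open>s * ln N / N\<close>, and the same step would lose powers of \<open>s\<close>. Hence on
  fine cells every nodal defect has to vanish, to cancel, or to meet one of the boundary or jump
  squares of the energy; this dictates the end point at which each Gauss-Radau projection is exact.

  In the balanced norm the squared \<open>L^2\<close> error of \<open>q\<close> has to be of order
  \<open>s ^ 3\<close>, whereas uniform bounds on the coarse cells give only \<open>s ^ 2\<close>.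
  The missing factor comes from integrating the squared layer functions beyond the transition
  points, so best approximation in \<open>L^2\<close> is needed along with uniform bounds.

  All constants have to be uniform in the cell. They come from the equivalence of norms on
  polynomials over \<open>[0, 1]\<close> and from scaling.\<close>

lemma continuous_on_poly_real: "continuous_on A (poly (p :: real poly))"
  by (intro continuous_intros)

text \<open>A zero integral makes \<open>p\<close> vanish wherever the weight is positive, hence at
  infinitely many points. The weight may vanish at the end points, which admits
  \<open>\<bar>x - e\<bar>\<close>.\<close>

lemma poly_weight_integral_pos:
  fixes w :: "real \<Rightarrow> real" and p :: "real poly"
  assumes "a < c" "continuous_on {a..c} w" "\<And>x. x \<in> {a..c} \<Longrightarrow> w x \<ge> 0"
    "\<And>x. x \<in> {a<..<c} \<Longrightarrow> w x > 0" "p \<noteq> 0"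
  shows "integral {a..c} (\<lambda>x. w x * (poly p x)\<^sup>2) > 0"
proof -
  have co: "continuous_on {a..c} (\<lambda>x. w x * (poly p x)\<^sup>2)"
    by (intro continuous_intros assms)
  have "integral {a..c} (\<lambda>x. w x * (poly p x)\<^sup>2) \<ge> 0"
    by (intro integral_nonneg integrable_continuous_real co) (auto simp: assms)
  moreover have "integral {a..c} (\<lambda>x. w x * (poly p x)\<^sup>2) \<noteq> 0"
  proof
    assume "integral {a..c} (\<lambda>x. w x * (poly p x)\<^sup>2) = 0"
    then have z: "\<forall>x\<in>{a..c}. w x * (poly p x)\<^sup>2 = 0"
      using integral_eq_0_iff[OF co \<open>a < c\<close>] assms(3) by simp
    have "{a<..<c} \<subseteq> {x. poly p x = 0}"
      using z assms(4) by force
    then have "finite {a<..<c}"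
      using poly_roots_finite[OF \<open>p \<noteq> 0\<close>] finite_subset by blast
    then show False
      using \<open>a < c\<close> infinite_Ioo by blast
  qed
  ultimately show ?thesis by linarith
qed

text \<open>Four summands suffice for the expansions below; shorter combinations are padded with
  \<open>0 * 0\<close>, so that one rewrite rule serves them.\<close>

lemma integral_lincomb4:
  fixes f1 f2 f3 f4 :: "real \<Rightarrow> real"
  assumes "continuous_on {a..c} f1" "continuous_on {a..c} f2" "continuous_on {a..c} f3"
    "continuous_on {a..c} f4"
  shows "integral {a..c} (\<lambda>x. d1 * f1 x + d2 * f2 x + d3 * f3 x + d4 * f4 x) =
    d1 * integral {a..c} f1 + d2 * integral {a..c} f2 + d3 * integral {a..c} f3 + d4 * integral {a..c} f4"
  by (rule integral_unique)
     (intro has_integral_add has_integral_mult_right integrable_integral integrable_continuous_real assms)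

section \<open>Orthogonal polynomials and the Riesz representation for a weight\<close>

lemma poly_degree_Suc_decomp:
  fixes p L :: "real poly"
  assumes "degree p \<le> Suc m" "degree L = Suc m"
  obtains p' d where "degree p' \<le> m" "p = p' + smult d L"
proof -
  define d where "d = coeff p (Suc m) / coeff L (Suc m)"
  have nz: "coeff L (Suc m) \<noteq> 0"
    using assms(2) by (metis leading_coeff_0_iff degree_0 nat.distinct(1))
  have "degree (p - smult d L) \<le> m"
  proof (rule degree_le, intro allI impI)
    fix i assume "m < i"
    show "coeff (p - smult d L) i = 0"
    proof (cases "i = Suc m")
      case True
      then show ?thesis using nz by (simp add: d_def)
    next
      case False
      then have "degree p < i" "degree L < i" using \<open>m < i\<close> assms by auto
      then show ?thesis by (simp add: coeff_eq_0)
    qed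
  qed
  then show ?thesis
    using that[of "p - smult d L" d] by simp
qed

text \<open>\<open>L\<close> is the monomial of degree \<open>Suc m\<close> minus its weighted
  projection onto lower degrees. The existence of that projection is an assumption, so that the
  lemma can be applied inside the induction which proves it, with the induction hypothesis in this
  place.\<close>

lemma orthogonal_polynomial:
  fixes w :: "real \<Rightarrow> real"
  assumes ac: "a < c" and w: "continuous_on {a..c} w" "\<And>x. x \<in> {a..c} \<Longrightarrow> w x \<ge> 0"
    "\<And>x. x \<in> {a<..<c} \<Longrightarrow> w x > 0"
    and ex: "\<exists>p0. degree p0 \<le> m \<and> (\<forall>v. degree v \<le> m \<longrightarrow>
       integral {a..c} (\<lambda>x. w x * poly p0 x * poly v x) = integral {a..c} (\<lambda>x. w x * x ^ Suc m * poly v x))"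
  obtains L where "degree L = Suc m" "\<forall>v. degree v \<le> m \<longrightarrow> integral {a..c} (\<lambda>x. w x * poly L x * poly v x) = 0"
    "integral {a..c} (\<lambda>x. w x * (poly L x)\<^sup>2) > 0"
proof -
  from ex obtain p0 where p0: "degree p0 \<le> m"
    "\<And>v. degree v \<le> m \<Longrightarrow> integral {a..c} (\<lambda>x. w x * poly p0 x * poly v x)
       = integral {a..c} (\<lambda>x. w x * x ^ Suc m * poly v x)"
    by blast
  define L where "L = monom 1 (Suc m) - p0"
  have degL: "degree L = Suc m"
  proof (rule antisym)
    show "degree L \<le> Suc m" unfolding L_def
      using p0(1) by (intro degree_diff_le) (auto intro: degree_monom_le)
    show "Suc m \<le> degree L"
      by (rule le_degree) (use p0(1) in \<open>simp add: L_def coeff_eq_0\<close>)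
  qed
  then have "L \<noteq> 0" by auto
  have orth: "integral {a..c} (\<lambda>x. w x * poly L x * poly v x) = 0" if "degree v \<le> m" for v
  proof -
    have "integral {a..c} (\<lambda>x. w x * poly L x * poly v x)
        = integral {a..c} (\<lambda>x. 1 * (w x * x ^ Suc m * poly v x) + (-1) * (w x * poly p0 x * poly v x)
            + 0 * 0 + 0 * 0)"
      by (rule arg_cong[where f = "integral {a..c}"], rule ext)
         (simp only: L_def poly_diff poly_monom, simp add: algebra_simps)
    also have "\<dots> = 0"
      by (subst integral_lincomb4) ((intro continuous_intros w)+, simp add: p0(2)[OF that])
    finally show ?thesis .
  qed
  show ?thesis
    using that[OF degL] orth poly_weight_integral_pos[OF ac w \<open>L \<noteq> 0\<close>] by blast
qed

text \<open>Gram-Schmidt by induction on the degree: the solution for degree \<open>m\<close> is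
  corrected by a multiple of the next orthogonal polynomial, which does not disturb the equations
  already solved. The right-hand side carries \<open>g\<close> without the weight, because the Radau
  projection pairs the weight \<open>\<bar>x - e\<bar>\<close> with an unweighted
  functional.\<close>

lemma weighted_riesz:
  fixes w g :: "real \<Rightarrow> real"
  assumes ac: "a < c" and w: "continuous_on {a..c} w" "\<And>x. x \<in> {a..c} \<Longrightarrow> w x \<ge> 0"
    "\<And>x. x \<in> {a<..<c} \<Longrightarrow> w x > 0" and g: "continuous_on {a..c} g"
  shows "\<exists>p. degree p \<le> m \<and>
    (\<forall>v. degree v \<le> m \<longrightarrow> integral {a..c} (\<lambda>x. w x * poly p x * poly v x)
       = integral {a..c} (\<lambda>x. g x * poly v x))"
  using g
proof (induction m arbitrary: g)
  case 0
  define I where "I = integral {a..c} w"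
  have I: "I > 0"
    using poly_weight_integral_pos[OF ac w, of 1] by (simp add: I_def)
  show ?case
  proof (intro exI[of _ "[:integral {a..c} g / I:]"] conjI allI impI)
    fix v :: "real poly" assume "degree v \<le> 0"
    then obtain d where "v = [:d:]" by (metis degree_0_id le_zero_eq)
    then show "integral {a..c} (\<lambda>x. w x * poly [:integral {a..c} g / I:] x * poly v x)
       = integral {a..c} (\<lambda>x. g x * poly v x)"
      using I by (simp add: I_def)
  qed simp
next
  case (Suc m)
  have cw: "continuous_on {a..c} (\<lambda>x. w x * x ^ Suc m)"
    by (intro continuous_intros w)
  obtain L where degL: "degree L = Suc m"
    and orth': "\<forall>v. degree v \<le> m \<longrightarrow> integral {a..c} (\<lambda>x. w x * poly L x * poly v x) = 0"
    and L: "integral {a..c} (\<lambda>x. w x * (poly L x)\<^sup>2) > 0"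
    by (rule orthogonal_polynomial[OF ac w Suc.IH[OF cw]])
  note orth = orth'[rule_format]
  define n where "n = integral {a..c} (\<lambda>x. w x * (poly L x)\<^sup>2)"
  have n: "n > 0" unfolding n_def by (rule L)
  from Suc.IH[OF Suc.prems] obtain p where p: "degree p \<le> m"
    "\<And>v. degree v \<le> m \<Longrightarrow> integral {a..c} (\<lambda>x. w x * poly p x * poly v x)
       = integral {a..c} (\<lambda>x. g x * poly v x)"
    by blast
  \<comment> \<open>The coefficient that makes the equation hold for the test polynomial
    \<open>L\<close>.\<close>
  define e where "e = integral {a..c} (\<lambda>x. g x * poly L x) / n"
  show ?case
  proof (intro exI[of _ "p + smult e L"] conjI allI impI)
    show "degree (p + smult e L) \<le> Suc m"
      using p(1) degL by (intro degree_add_le) (auto intro: order_trans[OF degree_smult_le])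
    fix v :: "real poly" assume "degree v \<le> Suc m"
    then obtain v' d where v: "degree v' \<le> m" "v = v' + smult d L"
      using poly_degree_Suc_decomp[OF _ degL] by blast
    have "integral {a..c} (\<lambda>x. w x * poly (p + smult e L) x * poly v x)
      = integral {a..c} (\<lambda>x. 1 * (w x * poly p x * poly v' x) + d * (w x * poly L x * poly p x)
           + e * (w x * poly L x * poly v' x) + (e * d) * (w x * (poly L x)\<^sup>2))"
      by (rule arg_cong[where f = "integral {a..c}"], rule ext) (simp add: v algebra_simps power2_eq_square)
    also have "\<dots> = integral {a..c} (\<lambda>x. g x * poly v' x) + e * d * n"
      by (subst integral_lincomb4)
         ((intro continuous_intros w)+, simp add: p(2)[OF v(1)] orth[OF v(1)] orth[OF p(1)] n_def)
    also have "\<dots> = integral {a..c} (\<lambda>x. g x * poly v' x) + d * integral {a..c} (\<lambda>x. g x * poly L x)"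
      using n by (simp add: e_def)
    also have "\<dots> = integral {a..c} (\<lambda>x. 1 * (g x * poly v' x) + d * (g x * poly L x) + 0 * 0 + 0 * 0)"
      by (subst integral_lincomb4) ((intro continuous_intros Suc.prems)+, simp)
    also have "\<dots> = integral {a..c} (\<lambda>x. g x * poly v x)"
      by (rule arg_cong[where f = "integral {a..c}"], rule ext) (simp add: v algebra_simps)
    finally show "integral {a..c} (\<lambda>x. w x * poly (p + smult e L) x * poly v x)
       = integral {a..c} (\<lambda>x. g x * poly v x)" .
  qed
qed

text \<open>Equivalence of norms in finite dimension: a pointwise bounded family of linear
  functionals is uniformly bounded in the weighted \<open>L^2\<close> norm. It is stated for a
  family so that one constant covers the evaluations at all points of an interval. Orthogonality of
  \<open>L\<close> splits the norm exactly, which drives the induction.\<close>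

lemma linear_functionals_bounded:
  fixes w :: "real \<Rightarrow> real" and F :: "(real poly \<Rightarrow> real) set"
  assumes ac: "a < c" and w: "continuous_on {a..c} w" "\<And>x. x \<in> {a..c} \<Longrightarrow> w x \<ge> 0"
    "\<And>x. x \<in> {a<..<c} \<Longrightarrow> w x > 0"
    and lin: "\<And>l p q d. l \<in> F \<Longrightarrow> l (p + smult d q) = l p + d * l q"
    and bd: "\<And>p. \<exists>B. \<forall>l\<in>F. \<bar>l p\<bar> \<le> B"
  shows "\<exists>K>0. \<forall>p. degree p \<le> m \<longrightarrow> (\<forall>l\<in>F. (l p)\<^sup>2 \<le> K * integral {a..c} (\<lambda>x. w x * (poly p x)\<^sup>2))"
proof (induction m)
  case 0
  define I where "I = integral {a..c} w"
  have I: "I > 0"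
    using poly_weight_integral_pos[OF ac w, of 1] by (simp add: I_def)
  obtain B where B: "\<forall>l\<in>F. \<bar>l 1\<bar> \<le> B" using bd by blast
  show ?case
  proof (intro exI[of _ "(B\<^sup>2 + 1) / I"] conjI allI impI ballI)
    show "0 < (B\<^sup>2 + 1) / I" using I by (intro divide_pos_pos add_nonneg_pos) auto
    fix p :: "real poly" and l assume "degree p \<le> 0" and l: "l \<in> F"
    then obtain d where d: "p = [:d:]" by (metis degree_0_id le_zero_eq)
    have "l 0 = 0" using lin[OF l, of 0 1 0] by simp
    then have "l p = d * l 1" using lin[OF l, of 0 d 1] by (simp add: d one_pCons)
    then have "(l p)\<^sup>2 = d\<^sup>2 * (l 1)\<^sup>2" by (simp add: power_mult_distrib)
    moreover have "(l 1)\<^sup>2 \<le> B\<^sup>2 + 1"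
      using power_mono[of "\<bar>l 1\<bar>" B 2] B l by auto
    moreover have "integral {a..c} (\<lambda>x. w x * (poly p x)\<^sup>2) = I * d\<^sup>2" by (simp add: d I_def)
    ultimately show "(l p)\<^sup>2 \<le> (B\<^sup>2 + 1) / I * integral {a..c} (\<lambda>x. w x * (poly p x)\<^sup>2)"
      using I mult_left_mono[of "(l 1)\<^sup>2" "B\<^sup>2 + 1" "d\<^sup>2"] by (simp add: mult.commute)
  qed
next
  case (Suc m)
  have cw: "continuous_on {a..c} (\<lambda>x. w x * x ^ Suc m)"
    by (intro continuous_intros w)
  obtain L where degL: "degree L = Suc m"
    and orth': "\<forall>v. degree v \<le> m \<longrightarrow> integral {a..c} (\<lambda>x. w x * poly L x * poly v x) = 0"
    and L: "integral {a..c} (\<lambda>x. w x * (poly L x)\<^sup>2) > 0"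
    by (rule orthogonal_polynomial[OF ac w weighted_riesz[OF ac w cw]])
  note orth = orth'[rule_format]
  define n where "n = integral {a..c} (\<lambda>x. w x * (poly L x)\<^sup>2)"
  have n: "n > 0" unfolding n_def by (rule L)
  obtain B where B: "\<forall>l\<in>F. \<bar>l L\<bar> \<le> B" using bd by blast
  from Suc.IH obtain K where K: "K > 0"
    "\<And>p l. degree p \<le> m \<Longrightarrow> l \<in> F \<Longrightarrow> (l p)\<^sup>2 \<le> K * integral {a..c} (\<lambda>x. w x * (poly p x)\<^sup>2)"
    by blast
  show ?case
  \<comment> \<open>From \<open>(a + b)^2 \<le> 2 * a^2 + 2 * b^2\<close>: the first summand pays
    for the part of lower degree, the second for the component along \<open>L\<close>, whose squared
    norm is \<open>n\<close>.\<close>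
  proof (intro exI[of _ "2 * K + 2 * B\<^sup>2 / n"] conjI allI impI ballI)
    show "0 < 2 * K + 2 * B\<^sup>2 / n" using K n by (intro add_pos_nonneg) auto
    fix p :: "real poly" and l assume "degree p \<le> Suc m" and l: "l \<in> F"
    then obtain v' d where v: "degree v' \<le> m" "p = v' + smult d L"
      using poly_degree_Suc_decomp[OF _ degL] by blast
    define J where "J = integral {a..c} (\<lambda>x. w x * (poly v' x)\<^sup>2)"
    have J: "J \<ge> 0" unfolding J_def
      by (intro integral_nonneg integrable_continuous_real continuous_intros w) (auto simp: w)
    have "integral {a..c} (\<lambda>x. w x * (poly p x)\<^sup>2)
      = integral {a..c} (\<lambda>x. 1 * (w x * (poly v' x)\<^sup>2) + (2 * d) * (w x * poly L x * poly v' x)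
           + d\<^sup>2 * (w x * (poly L x)\<^sup>2) + 0 * 0)"
      by (rule arg_cong[where f = "integral {a..c}"], rule ext) (simp add: v algebra_simps power2_eq_square)
    also have "\<dots> = J + d\<^sup>2 * n"
      by (subst integral_lincomb4)
         ((intro continuous_intros w)+, simp add: orth[OF v(1)] n_def J_def)
    finally have I: "integral {a..c} (\<lambda>x. w x * (poly p x)\<^sup>2) = J + d\<^sup>2 * n" .
    have "(l p)\<^sup>2 = (l v' + d * l L)\<^sup>2" using lin[OF l] v by simp
    also have "\<dots> \<le> 2 * (l v')\<^sup>2 + 2 * (d * l L)\<^sup>2"
      using sum_squares_bound[of "l v'" "d * l L"] by (simp add: power2_sum)
    also have "\<dots> \<le> 2 * (K * J) + 2 * (d\<^sup>2 * B\<^sup>2)"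
    proof -
      have "(l L)\<^sup>2 \<le> B\<^sup>2" using power_mono[of "\<bar>l L\<bar>" B 2] B l by auto
      then have "(d * l L)\<^sup>2 \<le> d\<^sup>2 * B\<^sup>2" by (simp only: power_mult_distrib mult_left_mono zero_le_power2)
      then show ?thesis using K(2)[OF v(1) l] by (simp add: J_def)
    qed
    also have "\<dots> \<le> (2 * K + 2 * B\<^sup>2 / n) * (J + d\<^sup>2 * n)"
    proof -
      have "(2 * K + 2 * B\<^sup>2 / n) * (J + d\<^sup>2 * n)
          = 2 * (K * J) + 2 * (d\<^sup>2 * B\<^sup>2) + 2 * K * d\<^sup>2 * n + 2 * B\<^sup>2 / n * J"
        using n by (simp add: field_simps)
      then show ?thesis using K n J by simp
    qed
    finally show "(l p)\<^sup>2 \<le> (2 * K + 2 * B\<^sup>2 / n) * integral {a..c} (\<lambda>x. w x * (poly p x)\<^sup>2)"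
      by (simp add: I)
  qed
qed

section \<open>Scaling and inverse inequalities\<close>

lemma integral_affine:
  fixes g :: "real \<Rightarrow> real"
  assumes "H > 0" "continuous_on {a..a+H} g"
  shows "integral {a..a+H} g = H * integral {0..1} (\<lambda>t. g (a + H * t))"
proof -
  have gi: "(g has_integral integral {a..a+H} g) (cbox a (a+H))"
    using integrable_continuous_real[OF assms(2)] by (simp add: integrable_integral)
  have "((\<lambda>t. g (H *\<^sub>R t + a)) has_integral (1 / (\<bar>H\<bar> ^ DIM(real))) *\<^sub>R integral {a..a+H} g)
     ((\<lambda>x. (1 / H) *\<^sub>R x + - ((1 / H) *\<^sub>R a)) ` cbox a (a+H))"
    by (rule has_integral_affinity[OF gi]) (use assms in auto)
  moreover have "(\<lambda>x. (1 / H) *\<^sub>R x + - ((1 / H) *\<^sub>R a)) ` cbox a (a+H) = {0..1}"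
    using assms(1) image_affinity_atLeastAtMost[of "1/H" "- (a/H)" a "a+H"]
    by (simp add: field_simps)
  ultimately show ?thesis
    using assms(1) by (auto dest!: integral_unique simp: algebra_simps)
qed

lemma poly_bounded_unit: "\<exists>B. \<forall>t\<in>{0..1}. \<bar>poly (p :: real poly) t\<bar> \<le> B"
proof -
  have "compact (poly p ` {0..1})"
    by (intro compact_continuous_image continuous_intros) auto
  then have "bounded (poly p ` {0..1})" by (rule compact_imp_bounded)
  then show ?thesis by (auto simp: bounded_iff)
qed

text \<open>The functionals are the evaluations of \<open>p\<close> and of its derivative at all
  points of \<open>[0, 1]\<close>; every polynomial is bounded there, so the family is pointwise
  bounded.\<close>

lemma weighted_inverse_unit:
  fixes w :: "real \<Rightarrow> real"
  assumes w: "continuous_on {0..1} w" "\<And>x. x \<in> {0..1} \<Longrightarrow> w x \<ge> 0"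
    "\<And>x. x \<in> {0<..<1} \<Longrightarrow> w x > 0"
  shows "\<exists>K>0. \<forall>(p :: real poly) t. degree p \<le> m \<longrightarrow> t \<in> {0..1} \<longrightarrow>
    (poly p t)\<^sup>2 \<le> K * integral {0..1} (\<lambda>x. w x * (poly p x)\<^sup>2) \<and>
    (poly (pderiv p) t)\<^sup>2 \<le> K * integral {0..1} (\<lambda>x. w x * (poly p x)\<^sup>2)"
proof -
  define F :: "(real poly \<Rightarrow> real) set" where
    "F = (\<lambda>t p. poly p t) ` {0..1} \<union> (\<lambda>t p. poly (pderiv p) t) ` {0..1}"
  have "\<exists>K>0. \<forall>p. degree p \<le> m \<longrightarrow> (\<forall>l\<in>F. (l p)\<^sup>2 \<le> K * integral {0..1} (\<lambda>x. w x * (poly p x)\<^sup>2))"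
  proof (rule linear_functionals_bounded[OF zero_less_one w])
    show "l (p + smult d q) = l p + d * l q" if "l \<in> F" for l p q d
      using that by (auto simp: F_def pderiv_add pderiv_smult)
    show "\<exists>B. \<forall>l\<in>F. \<bar>l p\<bar> \<le> B" for p
    proof -
      obtain B1 B2 where "\<forall>t\<in>{0..1}. \<bar>poly p t\<bar> \<le> B1" "\<forall>t\<in>{0..1}. \<bar>poly (pderiv p) t\<bar> \<le> B2"
        using poly_bounded_unit by meson
      then show ?thesis by (intro exI[of _ "max B1 B2"]) (auto simp: F_def le_max_iff_disj)
    qed
  qed
  then show ?thesis by (auto simp: F_def ball_Un)
qed

lemma affine_pcompose:
  fixes p :: "real poly"
  assumes "H > 0"
  shows "degree (pcompose p [:a, H:]) = degree p" "poly (pcompose p [:a, H:]) t = poly p (a + H * t)"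
    "poly (pderiv (pcompose p [:a, H:])) t = H * poly (pderiv p) (a + H * t)"
  using assms by (simp_all add: degree_pcompose poly_pcompose pderiv_pcompose pderiv_pCons algebra_simps)

text \<open>Transport to \<open>[0, 1]\<close> by an affine map. The integral scales with the length
  and a derivative costs its inverse, squared here: hence the exponents 1 and 3, while
  \<open>K\<close> depends on the degree only.\<close>

lemma inverse_inequality:
  obtains K where "K > 0"
    "\<And>(p :: real poly) a c x. degree p \<le> m \<Longrightarrow> a < c \<Longrightarrow> x \<in> {a..c} \<Longrightarrow>
       (poly p x)\<^sup>2 \<le> K / (c - a) * integral {a..c} (\<lambda>x. (poly p x)\<^sup>2)"
    "\<And>(p :: real poly) a c x. degree p \<le> m \<Longrightarrow> a < c \<Longrightarrow> x \<in> {a..c} \<Longrightarrow>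
       (poly (pderiv p) x)\<^sup>2 \<le> K / (c - a) ^ 3 * integral {a..c} (\<lambda>x. (poly p x)\<^sup>2)"
proof -
  have "\<exists>K>0. \<forall>(p :: real poly) t. degree p \<le> m \<longrightarrow> t \<in> {0..1} \<longrightarrow>
      (poly p t)\<^sup>2 \<le> K * integral {0..1} (\<lambda>x. (poly p x)\<^sup>2) \<and>
      (poly (pderiv p) t)\<^sup>2 \<le> K * integral {0..1} (\<lambda>x. (poly p x)\<^sup>2)"
    using weighted_inverse_unit[of "\<lambda>_. 1" m] by simp
  then obtain K where K0: "K > 0" and K: "\<forall>(p :: real poly) t. degree p \<le> m \<longrightarrow> t \<in> {0..1} \<longrightarrow>
      (poly p t)\<^sup>2 \<le> K * integral {0..1} (\<lambda>x. (poly p x)\<^sup>2) \<and>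
      (poly (pderiv p) t)\<^sup>2 \<le> K * integral {0..1} (\<lambda>x. (poly p x)\<^sup>2)"
    by (elim exE conjE)
  have main: "(poly p x)\<^sup>2 \<le> K / (c - a) * integral {a..c} (\<lambda>x. (poly p x)\<^sup>2) \<and>
     (poly (pderiv p) x)\<^sup>2 \<le> K / (c - a) ^ 3 * integral {a..c} (\<lambda>x. (poly p x)\<^sup>2)"
    if p: "degree p \<le> m" and ac: "a < c" and x: "x \<in> {a..c}" for p :: "real poly" and a c x
  proof -
    define H where "H = c - a"
    have H: "H > 0" and c: "c = a + H" using ac by (simp_all add: H_def)
    define t where "t = (x - a) / H"
    have t: "t \<in> {0..1}" and xt: "x = a + H * t" using x H by (auto simp: t_def c field_simps)
    have I: "integral {a..c} (\<lambda>x. (poly p x)\<^sup>2) = H * integral {0..1} (\<lambda>x. (poly p (a + H * x))\<^sup>2)"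
      unfolding c by (rule integral_affine[OF H]) (intro continuous_intros)
    note P = K[rule_format, of "pcompose p [:a, H:]" t, unfolded affine_pcompose[OF H], OF p t, folded xt]
    have 2: "(poly (pderiv p) x)\<^sup>2 \<le> K * integral {0..1} (\<lambda>x. (poly p (a + H * x))\<^sup>2) / H\<^sup>2"
      using P H by (simp add: power_mult_distrib field_simps)
    show ?thesis using P 2 H
      unfolding I by (simp add: H_def[symmetric] power2_eq_square power3_eq_cube)
  qed
  show ?thesis using that[OF K0] main by blast
qed

text \<open>The weight \<^term>\<open>\<bar>x - e\<bar>\<close> comes from writing a polynomial with prescribed value at the end point
  \<^term>\<open>e\<close> as this value plus \<^term>\<open>x - e\<close> times a polynomial of lower degree.\<close>

lemma weighted_inverse_inequality:
  obtains K where "K > 0"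
    "\<And>(p :: real poly) a c e x. degree p \<le> m \<Longrightarrow> a < c \<Longrightarrow> x \<in> {a..c} \<Longrightarrow> e = a \<or> e = c \<Longrightarrow>
       (poly p x)\<^sup>2 \<le> K / (c - a)\<^sup>2 * integral {a..c} (\<lambda>x. \<bar>x - e\<bar> * (poly p x)\<^sup>2)"
proof -
  have cw: "continuous_on {0..1} (\<lambda>x. \<bar>x - d\<bar>)" for d :: real
    by (intro continuous_intros)
  obtain K0 where K0: "K0 > 0"
    "\<forall>(p :: real poly) t. degree p \<le> m \<longrightarrow> t \<in> {0..1} \<longrightarrow> (poly p t)\<^sup>2 \<le> K0 * integral {0..1} (\<lambda>x. \<bar>x - 0\<bar> * (poly p x)\<^sup>2)"
    using weighted_inverse_unit[of "\<lambda>x. \<bar>x - 0\<bar>" m, OF cw] by auto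
  obtain K1 where K1: "K1 > 0"
    "\<forall>(p :: real poly) t. degree p \<le> m \<longrightarrow> t \<in> {0..1} \<longrightarrow> (poly p t)\<^sup>2 \<le> K1 * integral {0..1} (\<lambda>x. \<bar>x - 1\<bar> * (poly p x)\<^sup>2)"
    using weighted_inverse_unit[of "\<lambda>x. \<bar>x - 1\<bar>" m, OF cw] by auto
  \<comment> \<open>Adding the constants of both end points makes \<open>K\<close> independent of
    which of them is \<open>e\<close>.\<close>
  define K where "K = K0 + K1"
  have main: "(poly p x)\<^sup>2 \<le> K / (c - a)\<^sup>2 * integral {a..c} (\<lambda>x. \<bar>x - e\<bar> * (poly p x)\<^sup>2)"
    if p: "degree p \<le> m" and ac: "a < c" and x: "x \<in> {a..c}" and e: "e = a \<or> e = c" for p :: "real poly" and a c e x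
  proof -
    define H where "H = c - a"
    have H: "H > 0" and c: "c = a + H" using ac by (simp_all add: H_def)
    define t where "t = (x - a) / H"
    have t: "t \<in> {0..1}" and xt: "x = a + H * t" using x H by (auto simp: t_def c field_simps)
    define d where "d = (e - a) / H"
    have d: "d = 0 \<or> d = 1" and ed: "e = a + H * d" using e H by (auto simp: d_def c)
    define J where "J = integral {0..1} (\<lambda>x. \<bar>x - d\<bar> * (poly p (a + H * x))\<^sup>2)"
    have "J \<ge> 0" unfolding J_def
      by (intro integral_nonneg integrable_continuous_real continuous_intros) auto
    have "integral {a..c} (\<lambda>x. \<bar>x - e\<bar> * (poly p x)\<^sup>2)
        = H * integral {0..1} (\<lambda>x. \<bar>(a + H * x) - e\<bar> * (poly p (a + H * x))\<^sup>2)"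
      unfolding c by (rule integral_affine[OF H]) (intro continuous_intros)
    also have "(\<lambda>x. \<bar>(a + H * x) - e\<bar> * (poly p (a + H * x))\<^sup>2)
         = (\<lambda>x. H * (\<bar>x - d\<bar> * (poly p (a + H * x))\<^sup>2))"
    proof
      fix x
      have "\<bar>(a + H * x) - e\<bar> = \<bar>H * (x - d)\<bar>" by (simp add: ed algebra_simps)
      then show "\<bar>(a + H * x) - e\<bar> * (poly p (a + H * x))\<^sup>2 = H * (\<bar>x - d\<bar> * (poly p (a + H * x))\<^sup>2)"
        using H by (simp add: abs_mult)
    qed
    finally have I: "integral {a..c} (\<lambda>x. \<bar>x - e\<bar> * (poly p x)\<^sup>2) = H\<^sup>2 * J"
      by (simp add: J_def power2_eq_square)
    have "(poly p x)\<^sup>2 \<le> K0 * J \<or> (poly p x)\<^sup>2 \<le> K1 * J"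
      using K0(2)[rule_format, of "pcompose p [:a, H:]" t, unfolded affine_pcompose[OF H], OF p t, folded xt]
        K1(2)[rule_format, of "pcompose p [:a, H:]" t, unfolded affine_pcompose[OF H], OF p t, folded xt] d
      by (auto simp: J_def)
    then have "(poly p x)\<^sup>2 \<le> K * J"
      using K0(1) K1(1) \<open>J \<ge> 0\<close> by (auto simp: K_def distrib_right intro: add_increasing add_increasing2)
    then show ?thesis using H unfolding I by (simp add: H_def[symmetric])
  qed
  show ?thesis using that[of K] main K0(1) K1(1) by (auto simp: K_def)
qed

subsection \<open>Projections onto polynomials\<close>

text \<open>The last property is Pythagoras: it yields best approximation in the weighted norm, and
  it bounds \<open>p - p0\<close> by the error of the competitor \<open>p0\<close>.\<close>

lemma weighted_projection:
  fixes w g :: "real \<Rightarrow> real"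
  assumes ac: "a < c" and w: "continuous_on {a..c} w" "\<forall>x\<in>{a..c}. w x > 0"
    and g: "continuous_on {a..c} g"
  obtains p where "degree p \<le> k"
    "\<And>v. degree v \<le> k \<Longrightarrow> integral {a..c} (\<lambda>x. w x * (g x - poly p x) * poly v x) = 0"
    "\<And>p0. degree p0 \<le> k \<Longrightarrow> integral {a..c} (\<lambda>x. w x * (g x - poly p0 x)\<^sup>2)
       = integral {a..c} (\<lambda>x. w x * (g x - poly p x)\<^sup>2) + integral {a..c} (\<lambda>x. w x * (poly p x - poly p0 x)\<^sup>2)"
proof -
  have cwg: "continuous_on {a..c} (\<lambda>x. w x * g x)" by (intro continuous_intros w g)
  obtain p where p: "degree p \<le> k" "\<And>v. degree v \<le> k \<Longrightarrow>
     integral {a..c} (\<lambda>x. w x * poly p x * poly v x) = integral {a..c} (\<lambda>x. w x * g x * poly v x)"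
    using weighted_riesz[OF ac w(1) _ _ cwg, of k] w(2) by (force simp: less_imp_le)
  have orth: "integral {a..c} (\<lambda>x. w x * (g x - poly p x) * poly v x) = 0" if "degree v \<le> k" for v
  proof -
    have "integral {a..c} (\<lambda>x. w x * (g x - poly p x) * poly v x) =
       integral {a..c} (\<lambda>x. 1 * (w x * g x * poly v x) + (-1) * (w x * poly p x * poly v x) + 0 * 0 + 0 * 0)"
      by (rule arg_cong[where f = "integral {a..c}"], rule ext) (simp add: algebra_simps)
    also have "\<dots> = 0"
      by (subst integral_lincomb4) ((intro continuous_intros w g)+, simp add: p(2)[OF that])
    finally show ?thesis .
  qed
  show ?thesis
  proof (rule that[OF p(1) orth])
    fix p0 :: "real poly" assume "degree p0 \<le> k"
    then have "degree (p - p0) \<le> k" using p(1) by (intro degree_diff_le)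
    note o = orth[OF this]
    have "integral {a..c} (\<lambda>x. w x * (g x - poly p0 x)\<^sup>2) =
       integral {a..c} (\<lambda>x. 1 * (w x * (g x - poly p x)\<^sup>2) + 2 * (w x * (g x - poly p x) * poly (p - p0) x)
          + 1 * (w x * (poly p x - poly p0 x)\<^sup>2) + 0 * 0)"
      by (rule arg_cong[where f = "integral {a..c}"], rule ext) (simp add: algebra_simps power2_eq_square)
    also have "\<dots> = integral {a..c} (\<lambda>x. w x * (g x - poly p x)\<^sup>2)
         + integral {a..c} (\<lambda>x. w x * (poly p x - poly p0 x)\<^sup>2)"
      by (subst integral_lincomb4) ((intro continuous_intros w g)+, simp add: o del: poly_diff)
    finally show "integral {a..c} (\<lambda>x. w x * (g x - poly p0 x)\<^sup>2)
       = integral {a..c} (\<lambda>x. w x * (g x - poly p x)\<^sup>2) + integral {a..c} (\<lambda>x. w x * (poly p x - poly p0 x)\<^sup>2)" .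
  qed
qed

lemma integral_le_const_mult:
  fixes f :: "real \<Rightarrow> real"
  assumes "a \<le> c" "continuous_on {a..c} f" "\<And>x. x \<in> {a..c} \<Longrightarrow> f x \<le> B"
  shows "integral {a..c} f \<le> B * (c - a)"
proof -
  have "integral {a..c} f \<le> integral {a..c} (\<lambda>_. B)"
    by (intro integral_le integrable_continuous_real assms continuous_intros) auto
  then show ?thesis using assms(1) by (simp add: mult.commute)
qed

text \<open>The error is within a factor \<open>K\<close> of the best uniform approximation. The
  competitor enters with any bound \<open>M\<close> for its error, so that no supremum has to be
  formed.\<close>

definition quasi_optimal :: "real \<Rightarrow> real \<Rightarrow> nat \<Rightarrow> real \<Rightarrow> (real \<Rightarrow> real) \<Rightarrow> real poly \<Rightarrow> bool" where
  "quasi_optimal a c k K g p \<longleftrightarrow> (\<forall>p0 M. degree p0 \<le> k \<longrightarrow> (\<forall>y\<in>{a..c}. \<bar>g y - poly p0 y\<bar> \<le> M) \<longrightarrow>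
     (\<forall>y\<in>{a..c}. \<bar>g y - poly p y\<bar> \<le> K * M))"

text \<open>Best approximation in \<open>L^2\<close> is recorded besides the uniform bound: on
  coarse cells the layer still decays, and only its integrated square shows the additional factor
  \<open>sqrt \<epsilon>\<close> on which the balanced norm relies.\<close>

definition is_L2_projection ::
    "(real \<Rightarrow> real) \<Rightarrow> real \<Rightarrow> real \<Rightarrow> nat \<Rightarrow> real \<Rightarrow> (real \<Rightarrow> real) \<Rightarrow> real poly \<Rightarrow> bool" where
  "is_L2_projection w a c k K g p \<longleftrightarrow> degree p \<le> k \<and>
     (\<forall>v. degree v \<le> k \<longrightarrow> integral {a..c} (\<lambda>x. w x * (g x - poly p x) * poly v x) = 0) \<and>
     (\<forall>p0. degree p0 \<le> k \<longrightarrow> integral {a..c} (\<lambda>x. w x * (g x - poly p x)\<^sup>2)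
        \<le> integral {a..c} (\<lambda>x. w x * (g x - poly p0 x)\<^sup>2)) \<and>
     quasi_optimal a c k K g p"

definition is_radau_projection ::
    "real \<Rightarrow> real \<Rightarrow> real \<Rightarrow> nat \<Rightarrow> real \<Rightarrow> (real \<Rightarrow> real) \<Rightarrow> real poly \<Rightarrow> bool" where
  "is_radau_projection e a c k K g p \<longleftrightarrow> degree p \<le> k \<and> poly p e = g e \<and>
     (\<forall>v. degree v \<le> k - 1 \<longrightarrow> integral {a..c} (\<lambda>x. (g x - poly p x) * poly v x) = 0) \<and>
     quasi_optimal a c k K g p"

text \<open>The difference \<open>p - p0\<close> is the projection of \<open>g - p0\<close>, so its
  squared \<open>L^2\<close> norm is at most \<open>M^2 * wmax / wmin\<close> times the length. The
  inverse inequality turns this into a uniform bound in which the length cancels; the weight enters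
  through its two bounds only.\<close>

lemma L2_projection:
  assumes wb: "0 < wmin" "wmin \<le> wmax"
  obtains K where "K \<ge> 1"
    "\<And>(a::real) c w g. a < c \<Longrightarrow> continuous_on {a..c} w \<Longrightarrow> (\<And>x. x \<in> {a..c} \<Longrightarrow> wmin \<le> w x \<and> w x \<le> wmax) \<Longrightarrow>
      continuous_on {a..c} g \<Longrightarrow>
      \<exists>p. is_L2_projection w a c k K g p"
proof -
  obtain K0 where K0: "K0 > 0"
    "\<And>(p::real poly) a c x. degree p \<le> k \<Longrightarrow> a < c \<Longrightarrow> x \<in> {a..c} \<Longrightarrow>
       (poly p x)\<^sup>2 \<le> K0 / (c - a) * integral {a..c} (\<lambda>x. (poly p x)\<^sup>2)"
    "\<And>(p::real poly) a c x. degree p \<le> k \<Longrightarrow> a < c \<Longrightarrow> x \<in> {a..c} \<Longrightarrow>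
       (poly (pderiv p) x)\<^sup>2 \<le> K0 / (c - a) ^ 3 * integral {a..c} (\<lambda>x. (poly p x)\<^sup>2)"
    by (fact inverse_inequality[of k])
  define L where "L = K0 * wmax / wmin"
  have L: "L > 0" using K0(1) wb by (simp add: L_def)
  show ?thesis
  proof (rule that[of "1 + sqrt L"])
    show "1 + sqrt L \<ge> 1" using L by simp
    fix a c :: real and w g :: "real \<Rightarrow> real"
    assume ac: "a < c" and w: "continuous_on {a..c} w" and
      wm: "\<And>x. x \<in> {a..c} \<Longrightarrow> wmin \<le> w x \<and> w x \<le> wmax" and g: "continuous_on {a..c} g"
    have wpos: "\<forall>x\<in>{a..c}. w x > 0" using wm wb by (meson less_le_trans)
    obtain p where p: "degree p \<le> k"
      "\<And>v. degree v \<le> k \<Longrightarrow> integral {a..c} (\<lambda>x. w x * (g x - poly p x) * poly v x) = 0"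
      "\<And>p0. degree p0 \<le> k \<Longrightarrow> integral {a..c} (\<lambda>x. w x * (g x - poly p0 x)\<^sup>2)
         = integral {a..c} (\<lambda>x. w x * (g x - poly p x)\<^sup>2) + integral {a..c} (\<lambda>x. w x * (poly p x - poly p0 x)\<^sup>2)"
      by (fact weighted_projection[OF ac w wpos g, of k])
    have nn: "integral {a..c} (\<lambda>x. w x * (g x - poly q x)\<^sup>2) \<ge> 0"
      "integral {a..c} (\<lambda>x. w x * (poly p x - poly q x)\<^sup>2) \<ge> 0" for q
      by (intro integral_nonneg integrable_continuous_real continuous_intros w g;
          use wpos in \<open>auto simp: less_imp_le\<close>)+
    show "\<exists>p. is_L2_projection w a c k (1 + sqrt L) g p"
      unfolding is_L2_projection_def quasi_optimal_def
    proof (intro exI[of _ p] conjI p(1) allI impI ballI)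
      fix p0 :: "real poly" assume "degree p0 \<le> k"
      then show "integral {a..c} (\<lambda>x. w x * (g x - poly p x)\<^sup>2) \<le> integral {a..c} (\<lambda>x. w x * (g x - poly p0 x)\<^sup>2)"
        using p(3)[of p0] nn(2)[of p0] by linarith
    next
      fix p0 M x assume p0: "degree p0 \<le> k" and M: "\<forall>x\<in>{a..c}. \<bar>g x - poly p0 x\<bar> \<le> M"
        and x: "x \<in> {a..c}"
      have M0: "M \<ge> 0" using M x abs_ge_zero order_trans by blast
      have d: "degree (p - p0) \<le> k" using p(1) p0 by (intro degree_diff_le)
      have "(poly (p - p0) x)\<^sup>2 \<le> K0 / (c - a) * integral {a..c} (\<lambda>x. (poly (p - p0) x)\<^sup>2)"
        by (rule K0(2)[OF d ac x])
      also have "\<dots> \<le> K0 / (c - a) * (wmax / wmin * (M\<^sup>2 * (c - a)))"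
      proof (rule mult_left_mono)
        have "wmin * integral {a..c} (\<lambda>x. (poly (p - p0) x)\<^sup>2)
            = integral {a..c} (\<lambda>x. wmin * (poly (p - p0) x)\<^sup>2)" by simp
        also have "\<dots> \<le> integral {a..c} (\<lambda>x. w x * (poly p x - poly p0 x)\<^sup>2)"
          by (intro integral_le integrable_continuous_real continuous_intros w)
            (use wm in \<open>auto intro!: mult_right_mono\<close>)
        also have "\<dots> \<le> integral {a..c} (\<lambda>x. w x * (g x - poly p0 x)\<^sup>2)"
          using p(3)[OF p0] nn(1)[of p] by linarith
        also have "\<dots> \<le> (wmax * M\<^sup>2) * (c - a)"
        proof (rule integral_le_const_mult)
          fix y assume y: "y \<in> {a..c}"
          have "(g y - poly p0 y)\<^sup>2 \<le> M\<^sup>2"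
            using power_mono[of "\<bar>g y - poly p0 y\<bar>" M 2] M y by auto
          then show "w y * (g y - poly p0 y)\<^sup>2 \<le> wmax * M\<^sup>2"
            using wm[OF y] wb by (intro mult_mono) auto
        qed (use ac in \<open>auto intro!: continuous_intros w g\<close>)
        finally show "integral {a..c} (\<lambda>x. (poly (p - p0) x)\<^sup>2) \<le> wmax / wmin * (M\<^sup>2 * (c - a))"
          using wb by (simp add: field_simps)
        show "0 \<le> K0 / (c - a)" using K0(1) ac by simp
      qed
      also have "\<dots> = L * M\<^sup>2" using ac by (simp add: L_def)
      finally have "\<bar>poly (p - p0) x\<bar> \<le> sqrt L * M"
        using M0 L real_sqrt_le_mono by (fastforce simp: real_sqrt_mult)
      moreover have "\<bar>g x - poly p0 x\<bar> \<le> M" using M x by blast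
      ultimately show "\<bar>g x - poly p x\<bar> \<le> (1 + sqrt L) * M"
        by (simp add: distrib_right)
    qed (rule p(2))
  qed
qed

text \<open>Subtracting the prescribed value leaves a factor \<open>x - e\<close>, and orthogonality
  to degree \<open>k\<close> becomes a Riesz problem for the weight
  \<open>\<bar>x - e\<bar>\<close>. For stability, \<open>p - p0\<close> is its value at
  \<open>e\<close> plus \<open>x - e\<close> times a polynomial \<open>r\<close>, and testing with
  \<open>r\<close> bounds it through the weighted inverse inequality. The degree is
  \<open>Suc k\<close> to avoid truncated subtraction.\<close>

lemma gauss_radau:
  fixes k :: nat
  obtains K where "K \<ge> 1"
    "\<And>(a::real) c e g. a < c \<Longrightarrow> e = a \<or> e = c \<Longrightarrow> continuous_on {a..c} g \<Longrightarrow>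
      \<exists>p. is_radau_projection e a c (Suc k) K g p"
proof -
  obtain K0 where K0: "K0 > 0"
    "\<And>(p::real poly) a c e x. degree p \<le> k \<Longrightarrow> a < c \<Longrightarrow> x \<in> {a..c} \<Longrightarrow> e = a \<or> e = c \<Longrightarrow>
       (poly p x)\<^sup>2 \<le> K0 / (c - a)\<^sup>2 * integral {a..c} (\<lambda>x. \<bar>x - e\<bar> * (poly p x)\<^sup>2)"
    by (fact weighted_inverse_inequality[of k])
  show ?thesis
  proof (rule that[of "2 + 2 * K0"])
    show "2 + 2 * K0 \<ge> 1" using K0(1) by simp
    fix a c e :: real and g :: "real \<Rightarrow> real"
    assume ac: "a < c" and e: "e = a \<or> e = c" and g: "continuous_on {a..c} g"
    \<comment> \<open>The sign of \<open>x - e\<close> on the interval; it makes the weight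
      nonnegative.\<close>
    define sg :: real where "sg = (if e = a then 1 else -1)"
    have sg: "\<bar>x - e\<bar> = sg * (x - e)" if "x \<in> {a..c}" for x
      using that e ac by (auto simp: sg_def)
    have sg2: "sg * sg = 1" by (simp add: sg_def)
    have "\<exists>s. degree s \<le> k \<and> (\<forall>v. degree v \<le> k \<longrightarrow>
       integral {a..c} (\<lambda>x. \<bar>x - e\<bar> * poly s x * poly v x) = integral {a..c} (\<lambda>x. sg * (g x - g e) * poly v x))"
      by (rule weighted_riesz[OF ac]) (use e in \<open>auto intro!: continuous_intros g\<close>)
    then obtain s where s: "degree s \<le> k" "\<And>v. degree v \<le> k \<Longrightarrow>
       integral {a..c} (\<lambda>x. \<bar>x - e\<bar> * poly s x * poly v x) = integral {a..c} (\<lambda>x. sg * (g x - g e) * poly v x)"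
      by blast
    define p where "p = [:g e:] + [:- e, 1:] * s"
    have pe: "poly p e = g e" by (simp add: p_def)
    have dp: "degree p \<le> Suc k"
      unfolding p_def using s(1) degree_mult_le[of "[:- e, 1:]" s]
      by (intro degree_add_le) auto
    have orth: "integral {a..c} (\<lambda>x. (g x - poly p x) * poly v x) = 0" if v: "degree v \<le> k" for v
    proof -
      have "integral {a..c} (\<lambda>x. (g x - poly p x) * poly v x) =
        integral {a..c} (\<lambda>x. sg * (sg * (g x - g e) * poly v x) + (- sg) * (\<bar>x - e\<bar> * poly s x * poly v x)
            + 0 * 0 + 0 * 0)"
      proof (rule integral_cong)
        fix x assume x: "x \<in> {a..c}"
        have "sg * (sg * (g x - g e) * poly v x) = (g x - g e) * poly v x"
          by (metis mult.assoc mult_1 sg2)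
        moreover have "sg * (\<bar>x - e\<bar> * poly s x * poly v x) = (x - e) * poly s x * poly v x"
          unfolding sg[OF x] by (metis mult.assoc mult_1 sg2)
        ultimately show "(g x - poly p x) * poly v x = sg * (sg * (g x - g e) * poly v x)
            + (- sg) * (\<bar>x - e\<bar> * poly s x * poly v x) + 0 * 0 + 0 * 0"
          by (simp add: p_def algebra_simps)
      qed
      also have "\<dots> = 0"
        by (subst integral_lincomb4) ((intro continuous_intros g)+, simp add: s(2)[OF v])
      finally show ?thesis .
    qed
    show "\<exists>p. is_radau_projection e a c (Suc k) (2 + 2 * K0) g p"
      unfolding is_radau_projection_def quasi_optimal_def diff_Suc_1
    proof (intro exI[of _ p] conjI dp pe allI impI ballI)
      fix p0 M x0 assume p0: "degree p0 \<le> Suc k" and M: "\<forall>x\<in>{a..c}. \<bar>g x - poly p0 x\<bar> \<le> M"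
        and x0: "x0 \<in> {a..c}"
      have M0: "M \<ge> 0" using M x0 abs_ge_zero order_trans by blast
      have ein: "e \<in> {a..c}" using e ac by auto
      define H where "H = c - a"
      have H: "H > 0" using ac by (simp add: H_def)
      define t where "t = p - p0"
      have dt: "degree t \<le> Suc k" unfolding t_def using p0 dp by (intro degree_diff_le)
      \<comment> \<open>The quotient of \<open>t - poly t e\<close> by \<open>x - e\<close>.\<close>
      define r where "r = synthetic_div t e"
      have tr: "t = [:poly t e:] + [:- e, 1:] * r"
        unfolding r_def using synthetic_div_correct'[of e t] by (simp add: add.commute)
      have dr: "degree r \<le> k" using dt by (simp add: r_def degree_synthetic_div)
      have te: "poly t e = g e - poly p0 e" by (simp add: t_def pe)
      have polyt: "poly t x = poly t e + (x - e) * poly r x" for x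
        by (subst tr) (simp add: algebra_simps)
      have "\<exists>y\<in>{a..c}. \<forall>x\<in>{a..c}. \<bar>poly r x\<bar> \<le> \<bar>poly r y\<bar>"
        by (rule continuous_attains_sup) (use ac in \<open>auto intro!: continuous_intros\<close>)
      then obtain y where y: "y \<in> {a..c}" "\<And>x. x \<in> {a..c} \<Longrightarrow> \<bar>poly r x\<bar> \<le> \<bar>poly r y\<bar>"
        by blast
      define m where "m = \<bar>poly r y\<bar>"
      \<comment> \<open>Orthogonality is tested with \<open>r\<close>, whose degree is at most
        \<open>k\<close>; this removes \<open>p\<close> and leaves only the error of
        \<open>p0\<close>.\<close>
      have "integral {a..c} (\<lambda>x. \<bar>x - e\<bar> * (poly r x)\<^sup>2)
         = integral {a..c} (\<lambda>x. sg * (((g x - poly p0 x) - poly t e) * poly r x)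
             + (- sg) * ((g x - poly p x) * poly r x) + 0 * 0 + 0 * 0)"
      proof (rule integral_cong)
        fix x assume x: "x \<in> {a..c}"
        have P: "poly p x = poly p0 x + (poly t e + (x - e) * poly r x)"
          using polyt[of x] by (simp add: t_def)
        show "\<bar>x - e\<bar> * (poly r x)\<^sup>2 = sg * (((g x - poly p0 x) - poly t e) * poly r x)
             + (- sg) * ((g x - poly p x) * poly r x) + 0 * 0 + 0 * 0"
          unfolding sg[OF x] P by (simp add: algebra_simps power2_eq_square)
      qed
      also have "\<dots> = integral {a..c} (\<lambda>x. sg * (((g x - poly p0 x) - poly t e) * poly r x))"
        by (subst integral_lincomb4) ((intro continuous_intros g)+, simp add: orth[OF dr])
      also have "\<dots> \<le> (2 * M * m) * (c - a)"
      proof (rule integral_le_const_mult)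
        fix x assume x: "x \<in> {a..c}"
        have "sg * (((g x - poly p0 x) - poly t e) * poly r x) \<le> \<bar>((g x - poly p0 x) - poly t e) * poly r x\<bar>"
          using abs_ge_self[of "((g x - poly p0 x) - poly t e) * poly r x"]
            abs_ge_minus_self[of "((g x - poly p0 x) - poly t e) * poly r x"] by (cases "e = a") (simp_all add: sg_def)
        also have "\<dots> = \<bar>(g x - poly p0 x) - poly t e\<bar> * \<bar>poly r x\<bar>" by (simp add: abs_mult)
        also have "\<dots> \<le> (2 * M) * m"
          using M[rule_format, OF x] M[rule_format, OF ein] y(2)[OF x] unfolding te m_def
          by (intro mult_mono) linarith+
        finally show "sg * (((g x - poly p0 x) - poly t e) * poly r x) \<le> 2 * M * m" .
      qed (use ac in \<open>auto intro!: continuous_intros g\<close>)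
      finally have I: "integral {a..c} (\<lambda>x. \<bar>x - e\<bar> * (poly r x)\<^sup>2) \<le> 2 * M * m * H"
        by (simp add: H_def)
      have "m\<^sup>2 \<le> K0 / H\<^sup>2 * integral {a..c} (\<lambda>x. \<bar>x - e\<bar> * (poly r x)\<^sup>2)"
        using K0(2)[OF dr ac y(1) e] by (simp add: m_def H_def)
      also have "\<dots> \<le> K0 / H\<^sup>2 * (2 * M * m * H)"
        using I K0(1) by (intro mult_left_mono) auto
      also have "\<dots> = (2 * K0 * M / H) * m" using H by (simp add: power2_eq_square)
      \<comment> \<open>One factor \<open>m\<close>, the maximum of
        \<open>\<bar>poly r\<bar>\<close>, can be cancelled: this is the gain from testing with
        \<open>r\<close> itself.\<close>
      finally have mm: "m * m \<le> (2 * K0 * M / H) * m" by (simp add: power2_eq_square)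
      have m: "m \<le> 2 * K0 * M / H"
      proof (cases "m = 0")
        case True
        then show ?thesis using K0(1) M0 H by simp
      next
        case False
        then have "m > 0" by (simp add: m_def)
        then show ?thesis using mm by (meson mult_le_cancel_right_pos)
      qed
      have "\<bar>poly t x0\<bar> \<le> \<bar>poly t e\<bar> + \<bar>x0 - e\<bar> * \<bar>poly r x0\<bar>"
        unfolding polyt[of x0] by (metis abs_mult abs_triangle_ineq)
      also have "\<dots> \<le> M + H * (2 * K0 * M / H)"
      proof (intro add_mono mult_mono)
        show "\<bar>poly t e\<bar> \<le> M" unfolding te using M ein by blast
        show "\<bar>x0 - e\<bar> \<le> H" using x0 e by (auto simp: H_def)
        show "\<bar>poly r x0\<bar> \<le> 2 * K0 * M / H" using y(2)[OF x0] m by (simp add: m_def)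
      qed (use H in auto)
      also have "\<dots> = M + 2 * K0 * M" using H by simp
      finally have "\<bar>poly t x0\<bar> \<le> M + 2 * K0 * M" .
      moreover have "\<bar>g x0 - poly p0 x0\<bar> \<le> M" using M x0 by blast
      ultimately show "\<bar>g x0 - poly p x0\<bar> \<le> (2 + 2 * K0) * M"
        by (simp add: t_def distrib_right abs_if split: if_splits)
    qed (rule orth)
  qed
qed

section \<open>Taylor approximation\<close>

lemma taylor_polynomial_bound:
  fixes f :: "nat \<Rightarrow> real \<Rightarrow> real"
  assumes "a \<le> c" "{a..c} \<subseteq> S"
    and der: "\<And>i x. x \<in> S \<Longrightarrow> i \<le> k \<Longrightarrow> (f i has_field_derivative f (Suc i) x) (at x within S)"
    and B: "\<And>x. x \<in> {a..c} \<Longrightarrow> \<bar>f (Suc k) x\<bar> \<le> B"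
  obtains p where "degree p \<le> k" "\<And>x. x \<in> {a..c} \<Longrightarrow> \<bar>f 0 x - poly p x\<bar> \<le> B * (c - a) ^ Suc k"
proof -
  define p where "p = (\<Sum>i\<le>k. smult (f i a / fact i) ([:- a, 1:] ^ i))"
  show ?thesis
  proof (rule that[of p])
    show "degree p \<le> k" unfolding p_def
    proof (rule degree_sum_le)
      fix i assume "i \<in> {..k}"
      then show "degree (smult (f i a / fact i) ([:- a, 1:] ^ i)) \<le> k"
        by (simp add: degree_linear_power)
    qed simp
    fix x assume x: "x \<in> {a..c}"
    have B0: "B \<ge> 0" using B[OF x] by linarith
    have "norm (f 0 x - (\<Sum>i\<le>k. f i a * (x - a) ^ i / fact i)) \<le> B * norm (x - a) ^ Suc k / fact k"
    proof (rule field_Taylor[of "{a..c}" k f B a x])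
      fix i y assume "y \<in> {a..c}" "i \<le> k"
      then show "(f i has_field_derivative f (Suc i) y) (at y within {a..c})"
        using der[of y i] assms(2) by (blast intro: DERIV_subset)
    qed (use B assms(1) x in auto)
    also have "\<dots> \<le> B * norm (x - a) ^ Suc k"
    proof -
      have "B * norm (x - a) ^ Suc k \<ge> 0" using B0 by simp
      moreover have "(fact k :: real) \<ge> 1" by (rule fact_ge_1)
      ultimately show ?thesis by (metis div_by_1 divide_left_mono mult_1 order_less_le_trans zero_less_one mult_pos_pos)
    qed
    also have "\<dots> \<le> B * (c - a) ^ Suc k"
      using x B0 by (intro mult_left_mono power_mono) auto
    finally show "\<bar>f 0 x - poly p x\<bar> \<le> B * (c - a) ^ Suc k"
      by (simp add: p_def poly_sum)
  qed
qed

lemma times_differentiable_on_has_derivative: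
  assumes "times_differentiable_on S m g" "j < m" "x \<in> S"
  shows "(nderiv_on S j g has_field_derivative nderiv_on S (Suc j) g x) (at x within S)"
  using assms by (auto simp: times_differentiable_on_def vector_derivative_works
      has_real_derivative_iff_has_vector_derivative)

subsection \<open>The discrete error equation\<close>

text \<open>Here \<open>s\<close> stands for \<open>sqrt \<epsilon>\<close> and \<open>M\<close> for \<open>N / 4\<close>; a discrete function is given by its polynomials on the
  cells \<open>1, \<dots>, 4 * M\<close>.\<close>

definition polyflux_U ::
    "real \<Rightarrow> nat \<Rightarrow> (nat \<Rightarrow> real) \<Rightarrow> (nat \<Rightarrow> real poly) \<Rightarrow> (nat \<Rightarrow> real poly) \<Rightarrow> nat \<Rightarrow> real" where
  "polyflux_U s M x Pq Pu j =
     (if j = 0 \<or> j = 4 * M then 0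
      else if j = 3 * M then poly (Pu j) (x j) + (1 / s) * (poly (Pq (Suc j)) (x j) - poly (Pq j) (x j))
      else poly (Pu j) (x j))"

definition polyflux_Q ::
    "real \<Rightarrow> nat \<Rightarrow> (nat \<Rightarrow> real) \<Rightarrow> (nat \<Rightarrow> real poly) \<Rightarrow> (nat \<Rightarrow> real poly) \<Rightarrow> nat \<Rightarrow> real" where
  "polyflux_Q s M x Pq Pu j =
     (if j = 0 then poly (Pq 1) (x 0) + s * poly (Pu 1) (x 0)
      else if j = 4 * M then poly (Pq j) (x j) - s * poly (Pu j) (x j)
      else poly (Pq (Suc j)) (x j))"

lemma polyflux_diff:
  "polyflux_U s M x (\<lambda>j. A j - A' j) (\<lambda>j. B j - B' j) j = polyflux_U s M x A B j - polyflux_U s M x A' B' j"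
  "polyflux_Q s M x (\<lambda>j. A j - A' j) (\<lambda>j. B j - B' j) j = polyflux_Q s M x A B j - polyflux_Q s M x A' B' j"
  by (simp_all add: polyflux_U_def polyflux_Q_def algebra_simps add_divide_distrib diff_divide_distrib)

text \<open>Regrouping from cells to nodes, for contributions \<open>F j\<close> of the cell ending
  at node \<open>j\<close> and \<open>G j\<close> of the cell beginning there.\<close>

lemma sum_diff_shift:
  fixes F G :: "nat \<Rightarrow> real"
  shows "(\<Sum>j=1..Suc n. F j - G (j - 1)) = F (Suc n) - G 0 + (\<Sum>j=1..n. F j - G j)"
  by (induction n) simp_all

text \<open>With the flux of \<open>V\<close> taken from the left and that of \<open>R\<close> from
  the right, the contributions at an interior node cancel. Only the jump in the flux at
  \<open>3 * M\<close> and the boundary penalties survive, each as a square: these are the point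
  terms of the energy norm.\<close>

lemma flux_telescope:
  fixes x :: "nat \<Rightarrow> real"
  assumes "M \<ge> 1"
  shows "(\<Sum>j=1..4*M.
      (poly (R j) (x j) * poly (V j) (x j) - polyflux_U s M x R V j * poly (R j) (x j)
          - polyflux_Q s M x R V j * poly (V j) (x j))
      - (poly (R j) (x (j-1)) * poly (V j) (x (j-1)) - polyflux_U s M x R V (j-1) * poly (R j) (x (j-1))
          - polyflux_Q s M x R V (j-1) * poly (V j) (x (j-1))))
    = s * (poly (V 1) (x 0))\<^sup>2 + s * (poly (V (4*M)) (x (4*M)))\<^sup>2
      + (1 / s) * (poly (R (Suc (3*M))) (x (3*M)) - poly (R (3*M)) (x (3*M)))\<^sup>2"
proof -
  \<comment> \<open>The contribution to node \<open>j\<close> from the cell on its left;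
    \<open>G\<close> is the one from the cell on its right, whose polynomials have index
    \<open>Suc j\<close>.\<close>
  define F where "F j = poly (R j) (x j) * poly (V j) (x j) - polyflux_U s M x R V j * poly (R j) (x j)
          - polyflux_Q s M x R V j * poly (V j) (x j)" for j
  define G where "G j = poly (R (Suc j)) (x j) * poly (V (Suc j)) (x j) - polyflux_U s M x R V j * poly (R (Suc j)) (x j)
          - polyflux_Q s M x R V j * poly (V (Suc j)) (x j)" for j
  obtain n where n: "4 * M = Suc n" using assms by (cases "4 * M") auto
  have mid: "F j - G j = (if j = 3 * M then (1 / s) * (poly (R (Suc (3*M))) (x (3*M)) - poly (R (3*M)) (x (3*M)))\<^sup>2 else 0)"
    if "j \<in> {1..n}" for j
  proof -
    have "j \<noteq> 0" "j \<noteq> 4 * M" using that n by auto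
    then show ?thesis
      unfolding F_def G_def polyflux_U_def polyflux_Q_def
      by (auto simp: algebra_simps power2_eq_square)
  qed
  have "(\<Sum>j=1..4*M.
      (poly (R j) (x j) * poly (V j) (x j) - polyflux_U s M x R V j * poly (R j) (x j)
          - polyflux_Q s M x R V j * poly (V j) (x j))
      - (poly (R j) (x (j-1)) * poly (V j) (x (j-1)) - polyflux_U s M x R V (j-1) * poly (R j) (x (j-1))
          - polyflux_Q s M x R V (j-1) * poly (V j) (x (j-1))))
      = (\<Sum>j=1..4*M. F j - G (j - 1))"
    by (rule sum.cong) (auto simp: F_def G_def)
  also have "\<dots> = F (4*M) - G 0 + (\<Sum>j=1..n. F j - G j)"
    unfolding n by (rule sum_diff_shift)
  also have "(\<Sum>j=1..n. F j - G j) = (1 / s) * (poly (R (Suc (3*M))) (x (3*M)) - poly (R (3*M)) (x (3*M)))\<^sup>2"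
    using n assms by (simp add: mid sum.delta)
  also have "F (4*M) = s * (poly (V (4*M)) (x (4*M)))\<^sup>2"
    using assms by (simp add: F_def polyflux_U_def polyflux_Q_def algebra_simps power2_eq_square)
  also have "G 0 = - s * (poly (V 1) (x 0))\<^sup>2"
    by (simp add: G_def polyflux_U_def polyflux_Q_def algebra_simps power2_eq_square)
  finally show ?thesis by simp
qed

lemma poly_mult_deriv_integral:
  fixes p r :: "real poly"
  assumes "a \<le> c"
  shows "integral {a..c} (\<lambda>x. poly p x * poly (pderiv r) x) + integral {a..c} (\<lambda>x. poly r x * poly (pderiv p) x)
    = poly r c * poly p c - poly r a * poly p a"
proof -
  have "((\<lambda>x. poly (pderiv (r * p)) x) has_integral poly (r * p) c - poly (r * p) a) {a..c}"
    by (rule fundamental_theorem_of_calculus[OF assms])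
      (use poly_DERIV DERIV_subset has_real_derivative_iff_has_vector_derivative in blast)
  then have "integral {a..c} (\<lambda>x. poly (pderiv (r * p)) x) = poly (r * p) c - poly (r * p) a"
    by (rule integral_unique)
  moreover have "integral {a..c} (\<lambda>x. poly (pderiv (r * p)) x) =
     integral {a..c} (\<lambda>x. 1 * (poly p x * poly (pderiv r) x) + 1 * (poly r x * poly (pderiv p) x) + 0 * 0 + 0 * 0)"
    by (rule arg_cong[where f = "integral {a..c}"], rule ext) (simp add: pderiv_mult algebra_simps)
  moreover have "\<dots> = integral {a..c} (\<lambda>x. poly p x * poly (pderiv r) x) + integral {a..c} (\<lambda>x. poly r x * poly (pderiv p) x)"
    by (subst integral_lincomb4) ((intro continuous_intros)+, simp)
  ultimately show ?thesis by simp
qed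

lemma integral_error_split:
  fixes w g h :: "real \<Rightarrow> real" and P P' :: "real poly"
  assumes "continuous_on {a..c} w" "continuous_on {a..c} g" "continuous_on {a..c} h"
  shows "integral {a..c} (\<lambda>x. w x * (g x - poly P' x) * h x)
    = integral {a..c} (\<lambda>x. w x * (g x - poly P x) * h x) + integral {a..c} (\<lambda>x. w x * poly (P - P') x * h x)"
proof -
  have "integral {a..c} (\<lambda>x. w x * (g x - poly P' x) * h x)
     = integral {a..c} (\<lambda>x. 1 * (w x * (g x - poly P x) * h x) + 1 * (w x * poly (P - P') x * h x) + 0 * 0 + 0 * 0)"
    by (rule arg_cong[where f = "integral {a..c}"], rule ext) (simp add: algebra_simps)
  also have "\<dots> = integral {a..c} (\<lambda>x. w x * (g x - poly P x) * h x) + integral {a..c} (\<lambda>x. w x * poly (P - P') x * h x)"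
    by (subst integral_lincomb4) ((intro continuous_intros assms)+, simp)
  finally show ?thesis .
qed

text \<open>The factors 1 and 1/4 are chosen so that only a quarter of the discrete energy is
  spent.\<close>

lemma integral_young:
  fixes w g h :: "real \<Rightarrow> real"
  assumes "continuous_on {a..c} w" "continuous_on {a..c} g" "continuous_on {a..c} h"
    "\<forall>x\<in>{a..c}. w x \<ge> 0"
  shows "- integral {a..c} (\<lambda>x. w x * g x * h x)
    \<le> integral {a..c} (\<lambda>x. w x * (g x)\<^sup>2) + integral {a..c} (\<lambda>x. w x * (h x)\<^sup>2) / 4"
proof -
  have "0 \<le> integral {a..c} (\<lambda>x. w x * (g x + h x / 2)\<^sup>2)"
    by (intro integral_nonneg integrable_continuous_real continuous_intros assms) (use assms(4) in auto)
  also have "\<dots> = integral {a..c} (\<lambda>x. 1 * (w x * (g x)\<^sup>2) + 1 * (w x * g x * h x) + (1/4) * (w x * (h x)\<^sup>2) + 0 * 0)"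
    by (rule arg_cong[where f = "integral {a..c}"], rule ext) (simp add: field_simps power2_eq_square)
  also have "\<dots> = integral {a..c} (\<lambda>x. w x * (g x)\<^sup>2) + integral {a..c} (\<lambda>x. w x * g x * h x)
      + integral {a..c} (\<lambda>x. w x * (h x)\<^sup>2) / 4"
    by (subst integral_lincomb4) ((intro continuous_intros assms)+, simp)
  finally show ?thesis by linarith
qed

text \<open>\<open>QP\<close> and \<open>UP\<close> are the pieces of the numerical solution;
  \<open>PQ\<close> and \<open>PU\<close> may be any piecewise polynomials at this stage. The
  assumptions \<open>error_q\<close> and \<open>error_u\<close> are the Galerkin orthogonality: the
  exact solution satisfies the scheme with its nodal values as fluxes.\<close>

locale ldg_error =
  fixes k M :: nat and x :: "nat \<Rightarrow> real" and s :: real and b u q :: "real \<Rightarrow> real"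
    and QP UP PQ PU :: "nat \<Rightarrow> real poly"
  assumes M: "M \<ge> 1" and s: "s > 0"
    and mesh: "\<And>j. j \<in> {1..4*M} \<Longrightarrow> x (j - 1) < x j" "\<And>j. j \<in> {1..4*M} \<Longrightarrow> {x (j - 1)..x j} \<subseteq> {0..1}"
    and cont: "continuous_on {0..1} b" "continuous_on {0..1} u" "continuous_on {0..1} q"
    and deg: "\<And>j. degree (QP j) \<le> k" "\<And>j. degree (UP j) \<le> k" "\<And>j. degree (PQ j) \<le> k" "\<And>j. degree (PU j) \<le> k"
    and error_q: "\<And>j r. j \<in> {1..4*M} \<Longrightarrow> degree r \<le> k \<Longrightarrow>
       inverse (s\<^sup>2) * integral {x (j-1)..x j} (\<lambda>y. (q y - poly (QP j) y) * poly r y)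
       + integral {x (j-1)..x j} (\<lambda>y. (u y - poly (UP j) y) * poly (pderiv r) y)
       - (u (x j) - polyflux_U s M x QP UP j) * poly r (x j)
       + (u (x (j-1)) - polyflux_U s M x QP UP (j-1)) * poly r (x (j-1)) = 0"
    and error_u: "\<And>j v. j \<in> {1..4*M} \<Longrightarrow> degree v \<le> k \<Longrightarrow>
       integral {x (j-1)..x j} (\<lambda>y. (q y - poly (QP j) y) * poly (pderiv v) y)
       + integral {x (j-1)..x j} (\<lambda>y. b y * (u y - poly (UP j) y) * poly v y)
       - (q (x j) - polyflux_Q s M x QP UP j) * poly v (x j)
       + (q (x (j-1)) - polyflux_Q s M x QP UP (j-1)) * poly v (x (j-1)) = 0"
begin

definition "R j = PQ j - QP j"
definition "V j = PU j - UP j"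

text \<open>The defects of the numerical fluxes when the projections are inserted. The choice of
  projections is about where these vanish.\<close>

definition "au j = u (x j) - polyflux_U s M x PQ PU j"
definition "aq j = q (x j) - polyflux_Q s M x PQ PU j"

text \<open>Minus the bilinear form of the scheme, applied to the projection error and tested with
  the discrete error.\<close>

definition "consistency j =
   - (inverse (s\<^sup>2) * integral {x (j-1)..x j} (\<lambda>y. (q y - poly (PQ j) y) * poly (R j) y)
      + integral {x (j-1)..x j} (\<lambda>y. (u y - poly (PU j) y) * poly (pderiv (R j)) y)
      + integral {x (j-1)..x j} (\<lambda>y. (q y - poly (PQ j) y) * poly (pderiv (V j)) y)
      + integral {x (j-1)..x j} (\<lambda>y. b y * (u y - poly (PU j) y) * poly (V j) y))
   + au j * poly (R j) (x j) - au (j-1) * poly (R j) (x (j-1))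
   + aq j * poly (V j) (x j) - aq (j-1) * poly (V j) (x (j-1))"

definition "local_energy j = inverse (s\<^sup>2) * integral {x (j-1)..x j} (\<lambda>y. (poly (R j) y)\<^sup>2)
   + integral {x (j-1)..x j} (\<lambda>y. b y * (poly (V j) y)\<^sup>2)"

definition "q_jump = poly (R (Suc (3*M))) (x (3*M)) - poly (R (3*M)) (x (3*M))"

text \<open>The square of the energy norm of the discrete error.\<close>

definition "energy = (\<Sum>j=1..4*M. local_energy j) + s * (poly (V 1) (x 0))\<^sup>2
   + s * (poly (V (4*M)) (x (4*M)))\<^sup>2 + (1 / s) * q_jump\<^sup>2"

lemma deg_RV: "degree (R j) \<le> k" "degree (V j) \<le> k"
  by (auto simp: R_def V_def intro!: degree_diff_le deg)

lemma cell_cont: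
  assumes "j \<in> {1..4*M}"
  shows "continuous_on {x (j-1)..x j} b" "continuous_on {x (j-1)..x j} u" "continuous_on {x (j-1)..x j} q"
  using cont mesh(2)[OF assms] continuous_on_subset by blast+

text \<open>The error equations are tested with the discrete error itself. In the sum of both, the
  mixed integrals combine to the derivative of the product of \<open>R j\<close> and
  \<open>V j\<close> and become traces.\<close>

lemma local_identity:
  assumes j: "j \<in> {1..4*M}"
  shows "local_energy j + 
     ((poly (R j) (x j) * poly (V j) (x j) - polyflux_U s M x R V j * poly (R j) (x j)
          - polyflux_Q s M x R V j * poly (V j) (x j))
      - (poly (R j) (x (j-1)) * poly (V j) (x (j-1)) - polyflux_U s M x R V (j-1) * poly (R j) (x (j-1))
          - polyflux_Q s M x R V (j-1) * poly (V j) (x (j-1)))) = consistency j"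
proof -
  note c = cell_cont[OF j]
  have RV: "R = (\<lambda>j. PQ j - QP j)" "V = (\<lambda>j. PU j - UP j)" by (auto simp: R_def V_def)
  have 1: "integral {x (j-1)..x j} (\<lambda>y. (q y - poly (QP j) y) * poly (R j) y)
     = integral {x (j-1)..x j} (\<lambda>y. (q y - poly (PQ j) y) * poly (R j) y) + integral {x (j-1)..x j} (\<lambda>y. (poly (R j) y)\<^sup>2)"
    using integral_error_split[OF continuous_on_const[of _ 1] c(3) continuous_on_poly_real[of _ "R j"], of "QP j" "PQ j"]
    by (simp add: R_def[symmetric] power2_eq_square del: poly_diff)
  have 2: "integral {x (j-1)..x j} (\<lambda>y. (u y - poly (UP j) y) * poly (pderiv (R j)) y)
     = integral {x (j-1)..x j} (\<lambda>y. (u y - poly (PU j) y) * poly (pderiv (R j)) y)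
      + integral {x (j-1)..x j} (\<lambda>y. poly (V j) y * poly (pderiv (R j)) y)"
    using integral_error_split[OF continuous_on_const[of _ 1] c(2) continuous_on_poly_real[of _ "pderiv (R j)"], of "UP j" "PU j"]
    by (simp add: V_def[symmetric] del: poly_diff)
  have 3: "integral {x (j-1)..x j} (\<lambda>y. (q y - poly (QP j) y) * poly (pderiv (V j)) y)
     = integral {x (j-1)..x j} (\<lambda>y. (q y - poly (PQ j) y) * poly (pderiv (V j)) y)
      + integral {x (j-1)..x j} (\<lambda>y. poly (R j) y * poly (pderiv (V j)) y)"
    using integral_error_split[OF continuous_on_const[of _ 1] c(3) continuous_on_poly_real[of _ "pderiv (V j)"], of "QP j" "PQ j"]
    by (simp add: R_def[symmetric] del: poly_diff)
  have 4: "integral {x (j-1)..x j} (\<lambda>y. b y * (u y - poly (UP j) y) * poly (V j) y)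
     = integral {x (j-1)..x j} (\<lambda>y. b y * (u y - poly (PU j) y) * poly (V j) y)
       + integral {x (j-1)..x j} (\<lambda>y. b y * (poly (V j) y)\<^sup>2)"
    using integral_error_split[OF c(1) c(2) continuous_on_poly_real[of _ "V j"], of "UP j" "PU j"]
    by (simp add: V_def[symmetric] power2_eq_square mult.assoc del: poly_diff)
  have 5: "integral {x (j-1)..x j} (\<lambda>y. poly (V j) y * poly (pderiv (R j)) y)
     + integral {x (j-1)..x j} (\<lambda>y. poly (R j) y * poly (pderiv (V j)) y)
     = poly (R j) (x j) * poly (V j) (x j) - poly (R j) (x (j-1)) * poly (V j) (x (j-1))"
    by (rule poly_mult_deriv_integral) (use mesh(1)[OF j] in simp)
  have 6: "polyflux_U s M x R V i = (u (x i) - polyflux_U s M x QP UP i) - au i"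
    "polyflux_Q s M x R V i = (q (x i) - polyflux_Q s M x QP UP i) - aq i" for i
    unfolding RV polyflux_diff by (simp_all add: au_def aq_def)
  show ?thesis
    using error_q[OF j deg_RV(1)[of j]] error_u[OF j deg_RV(2)[of j]] 5
    unfolding 1 2 3 4 6 consistency_def local_energy_def by (simp add: algebra_simps)
qed

lemma energy_identity: "energy = (\<Sum>j=1..4*M. consistency j)"
proof -
  have "(\<Sum>j=1..4*M. consistency j) = (\<Sum>j=1..4*M. local_energy j + 
     ((poly (R j) (x j) * poly (V j) (x j) - polyflux_U s M x R V j * poly (R j) (x j)
          - polyflux_Q s M x R V j * poly (V j) (x j))
      - (poly (R j) (x (j-1)) * poly (V j) (x (j-1)) - polyflux_U s M x R V (j-1) * poly (R j) (x (j-1))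
          - polyflux_Q s M x R V (j-1) * poly (V j) (x (j-1)))))"
    by (rule sum.cong[OF refl]) (rule local_identity[symmetric])
  also have "\<dots> = energy"
    unfolding sum.distrib flux_telescope[OF M] by (simp add: energy_def q_jump_def)
  finally show ?thesis by simp
qed

end

section \<open>Absorbing the consistency error into the energy\<close>

lemma young_quarter: "(a::real) * v \<le> a\<^sup>2 + v\<^sup>2 / 4"
proof -
  have "0 \<le> (a - v / 2)\<^sup>2" by simp
  then show ?thesis by (simp add: power2_eq_square algebra_simps)
qed

lemma young_scaled:
  fixes a v t :: real
  assumes "t > 0"
  shows "a * v \<le> t * a\<^sup>2 + v\<^sup>2 / (4 * t)"
proof -
  have "0 \<le> t * (a - v / (2 * t))\<^sup>2" using assms by simp
  also have "\<dots> = t * a\<^sup>2 + v\<^sup>2 / (4 * t) - a * v"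
    using assms by (simp add: power2_eq_square field_simps)
  finally show ?thesis by simp
qed

lemma degree_pderiv_le:
  assumes "degree (r :: real poly) \<le> k"
  shows "degree (pderiv r) \<le> k - 1"
  using assms by (simp add: degree_pderiv)

lemma integral_pderiv:
  fixes r :: "real poly"
  assumes "a \<le> c"
  shows "integral {a..c} (poly (pderiv r)) = poly r c - poly r a"
  using poly_mult_deriv_integral[OF assms, of 1 r] by simp

text \<open>Also applied to node indices, in the sense of the cell that ends at the node; node 0
  then counts as fine.\<close>

definition fine_cell :: "nat \<Rightarrow> nat \<Rightarrow> bool" where
  "fine_cell M j \<longleftrightarrow> j \<le> M \<or> 3 * M < j"

text \<open>\<open>S\<close> and \<open>hh\<close> measure the approximation on coarse cells and at
  the ends of the domain, \<open>K\<close> is their common factor. On the left fine cells the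
  projection of \<open>q\<close> is a Gauss-Radau projection minus the constant
  \<open>\<delta>\<close>, so that its error is orthogonal to lower degrees up to that constant;
  \<open>shift\<close> identifies \<open>\<delta>\<close> with the trace error of the coarse
  projection at \<open>x M\<close>.\<close>

locale ldg_projection = ldg_error +
  fixes K S hh \<kappa> bmin \<delta> :: real
  assumes nonneg: "K \<ge> 0" "S \<ge> 0" "hh \<ge> 0" "\<kappa> > 0" "bmin > 0"
    and b_lower: "\<And>y. y \<in> {0..1} \<Longrightarrow> b y \<ge> bmin"
    and inv: "\<And>(p::real poly) a c y. degree p \<le> k \<Longrightarrow> a < c \<Longrightarrow> y \<in> {a..c} \<Longrightarrow>
       (poly p y)\<^sup>2 \<le> \<kappa> / (c - a) * integral {a..c} (\<lambda>y. (poly p y)\<^sup>2)"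
    and inv': "\<And>(p::real poly) a c y. degree p \<le> k \<Longrightarrow> a < c \<Longrightarrow> y \<in> {a..c} \<Longrightarrow>
       (poly (pderiv p) y)\<^sup>2 \<le> \<kappa> / (c - a) ^ 3 * integral {a..c} (\<lambda>y. (poly p y)\<^sup>2)"
    and coarse_width: "\<And>j. j \<in> {1..4*M} \<Longrightarrow> \<not> fine_cell M j \<Longrightarrow> x j - x (j-1) \<ge> 1 / real (4*M)"
    and fine_u: "\<And>j v. j \<in> {1..4*M} \<Longrightarrow> fine_cell M j \<Longrightarrow> degree v \<le> k - 1 \<Longrightarrow>
       integral {x (j-1)..x j} (\<lambda>y. (u y - poly (PU j) y) * poly v y) = 0"
    and fine_u_end: "\<And>j. j \<in> {1..4*M} \<Longrightarrow> fine_cell M j \<Longrightarrow> poly (PU j) (x j) = u (x j)"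
    and fine_q: "\<And>j v. j \<in> {1..4*M} \<Longrightarrow> fine_cell M j \<Longrightarrow> degree v \<le> k - 1 \<Longrightarrow>
       integral {x (j-1)..x j} (\<lambda>y. (q y - poly (PQ j) y) * poly v y)
         = (if j \<le> M then \<delta> else 0) * integral {x (j-1)..x j} (poly v)"
    and fine_q_end: "\<And>j. j \<in> {1..4*M} \<Longrightarrow> fine_cell M j \<Longrightarrow>
       poly (PQ j) (x (j-1)) = q (x (j-1)) - (if j \<le> M then \<delta> else 0)"
    and shift: "q (x M) - poly (PQ (Suc M)) (x M) = \<delta>"
    and coarse_u: "\<And>j v. j \<in> {1..4*M} \<Longrightarrow> \<not> fine_cell M j \<Longrightarrow> degree v \<le> k \<Longrightarrow>
       integral {x (j-1)..x j} (\<lambda>y. b y * (u y - poly (PU j) y) * poly v y) = 0"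
    and coarse_q: "\<And>j v. j \<in> {1..4*M} \<Longrightarrow> \<not> fine_cell M j \<Longrightarrow> degree v \<le> k \<Longrightarrow>
       integral {x (j-1)..x j} (\<lambda>y. (q y - poly (PQ j) y) * poly v y) = 0"
    and coarse_bound: "\<And>j y. j \<in> {1..4*M} \<Longrightarrow> \<not> fine_cell M j \<Longrightarrow> y \<in> {x (j-1)..x j} \<Longrightarrow> \<bar>u y - poly (PU j) y\<bar> \<le> K * S"
      "\<And>j y. j \<in> {1..4*M} \<Longrightarrow> \<not> fine_cell M j \<Longrightarrow> y \<in> {x (j-1)..x j} \<Longrightarrow> \<bar>q y - poly (PQ j) y\<bar> \<le> K * S * s"
    and end_bound: "\<bar>u (x 0) - poly (PU 1) (x 0)\<bar> \<le> K * hh" "\<bar>q (x (4*M)) - poly (PQ (4*M)) (x (4*M))\<bar> \<le> K * hh * s"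
    and u_bd: "u (x 0) = 0" "u (x (4*M)) = 0"
begin

text \<open>The flux of \<open>u\<close> takes left traces, and on fine cells \<open>PU\<close> is
  exact at the right end. Hence \<open>x M\<close> belongs here, whereas \<open>x (3 * M)\<close>,
  the right end of a coarse cell, does not. At both ends of the domain the flux is the exact
  boundary value 0.\<close>

lemma au_fine: "j \<le> 4 * M \<Longrightarrow> fine_cell M j \<Longrightarrow> au j = 0"
  using M u_bd fine_u_end[of j] by (auto simp: au_def polyflux_U_def fine_cell_def)

text \<open>The penalty in the flux at \<open>3 * M\<close> adds \<open>1 / s\<close> times the jump
  of \<open>PQ\<close>. The trace from the right is exact there, so the jump is the coarse error, of
  size \<open>K * S * s\<close>; this accounts for the factor 2.\<close>

lemma au_bound:
  assumes "j \<in> {M..3*M}"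
  shows "\<bar>au j\<bar> \<le> 2 * K * S"
proof (cases "j = M")
  case True
  then show ?thesis using au_fine[of j] nonneg M by (simp add: fine_cell_def)
next
  case False
  have j: "j \<in> {1..4*M}" "\<not> fine_cell M j" using assms False by (auto simp: fine_cell_def)
  have xj: "x j \<in> {x (j-1)..x j}" using mesh(1)[OF j(1)] by simp
  have KS: "K * S \<ge> 0" using nonneg by simp
  note bu = coarse_bound(1)[OF j xj] and bq = coarse_bound(2)[OF j xj]
  show ?thesis
  proof (cases "j = 3 * M")
    case True
    have n: "Suc j \<in> {1..4*M}" "fine_cell M (Suc j)" "\<not> Suc j \<le> M" using True M by (auto simp: fine_cell_def)
    have "au j = (u (x j) - poly (PU j) (x j)) - (1/s) * (q (x j) - poly (PQ j) (x j))"
      using fine_q_end[OF n(1,2)] n(3) True M by (simp add: au_def polyflux_U_def)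
    moreover have "\<bar>(1/s) * (q (x j) - poly (PQ j) (x j))\<bar> \<le> K * S"
      using bq s by (simp add: abs_mult field_simps)
    ultimately show ?thesis using bu by linarith
  next
    case False
    then have "au j = u (x j) - poly (PU j) (x j)" using assms M by (auto simp: au_def polyflux_U_def)
    then show ?thesis using bu KS by linarith
  qed
qed

text \<open>The flux of \<open>q\<close> is a right trace and all left fine cells carry the same
  shift. Together with \<open>aq_M\<close>, the defect is thus the one number
  \<open>\<delta>\<close> at every node up to \<open>M\<close>, except that the boundary penalty is
  added at node 0.\<close>

lemma aq_left: "j < M \<Longrightarrow> aq j = \<delta> - (if j = 0 then s * poly (PU 1) (x 0) else 0)"
  using fine_q_end[of "Suc j"] by (auto simp: aq_def polyflux_Q_def fine_cell_def)

lemma aq_M: "aq M = \<delta>"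
  using shift M by (simp add: aq_def polyflux_Q_def)

lemma aq_right: "3 * M \<le> j \<Longrightarrow> j < 4 * M \<Longrightarrow> aq j = 0"
  using fine_q_end[of "Suc j"] M by (auto simp: aq_def polyflux_Q_def fine_cell_def)

lemma aq_last: "aq (4 * M) = q (x (4*M)) - poly (PQ (4*M)) (x (4*M))"
  using fine_u_end[of "4*M"] u_bd M by (simp add: aq_def polyflux_Q_def fine_cell_def)

lemma aq_bound:
  assumes "j \<in> {M..3*M}"
  shows "\<bar>aq j\<bar> \<le> K * S * s"
proof (cases "j = 3 * M")
  case True
  then show ?thesis using aq_right[of j] M nonneg s by simp
next
  case False
  then have j: "Suc j \<in> {1..4*M}" "\<not> fine_cell M (Suc j)" using assms by (auto simp: fine_cell_def)
  have "x j \<in> {x (Suc j - 1)..x (Suc j)}" using mesh(1)[OF j(1)] by simp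
  from coarse_bound(2)[OF j this] show ?thesis
    using assms False M by (simp add: aq_def polyflux_Q_def)
qed

definition "proj_error j = inverse (s\<^sup>2) * integral {x (j-1)..x j} (\<lambda>y. (q y - poly (PQ j) y)\<^sup>2)
   + integral {x (j-1)..x j} (\<lambda>y. b y * (u y - poly (PU j) y)\<^sup>2)"

text \<open>Gauss-Radau projections are orthogonal to degree \<open>k - 1\<close> only, so the
  zero-order terms survive on fine cells. They are paid for by a quarter of the local energy and by
  the projection error.\<close>

lemma fine_young:
  assumes j: "j \<in> {1..4*M}"
  shows "- (inverse (s\<^sup>2) * integral {x (j-1)..x j} (\<lambda>y. (q y - poly (PQ j) y) * poly (R j) y)
      + integral {x (j-1)..x j} (\<lambda>y. b y * (u y - poly (PU j) y) * poly (V j) y))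
     \<le> proj_error j + local_energy j / 4"
proof -
  note c = cell_cont[OF j]
  have "- integral {x (j-1)..x j} (\<lambda>y. 1 * (q y - poly (PQ j) y) * poly (R j) y)
    \<le> integral {x (j-1)..x j} (\<lambda>y. 1 * (q y - poly (PQ j) y)\<^sup>2) + integral {x (j-1)..x j} (\<lambda>y. 1 * (poly (R j) y)\<^sup>2) / 4"
    by (rule integral_young[OF continuous_on_const _ continuous_on_poly_real]) (intro continuous_intros c, rule ballI, simp)
  from mult_left_mono[OF this, of "inverse (s\<^sup>2)"]
  have 1: "- (inverse (s\<^sup>2) * integral {x (j-1)..x j} (\<lambda>y. (q y - poly (PQ j) y) * poly (R j) y))
    \<le> inverse (s\<^sup>2) * integral {x (j-1)..x j} (\<lambda>y. (q y - poly (PQ j) y)\<^sup>2)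
      + inverse (s\<^sup>2) * integral {x (j-1)..x j} (\<lambda>y. (poly (R j) y)\<^sup>2) / 4"
    by (simp add: distrib_left)
  have bn: "\<forall>y\<in>{x (j-1)..x j}. b y \<ge> 0"
    using b_lower mesh(2)[OF j] nonneg(5) by (meson less_imp_le order_trans subsetD)
  have 2: "- integral {x (j-1)..x j} (\<lambda>y. b y * (u y - poly (PU j) y) * poly (V j) y)
    \<le> integral {x (j-1)..x j} (\<lambda>y. b y * (u y - poly (PU j) y)\<^sup>2) + integral {x (j-1)..x j} (\<lambda>y. b y * (poly (V j) y)\<^sup>2) / 4"
    by (rule integral_young[OF c(1) _ continuous_on_poly_real bn]) (intro continuous_intros c)
  have lin: "- (a1 + a2) \<le> p1 + p2 + (r1 + r2) / 4"
    if "- a1 \<le> p1 + r1 / 4" "- a2 \<le> p2 + r2 / 4" for a1 a2 p1 p2 r1 r2 :: real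
    using that by (simp add: field_simps)
  show ?thesis unfolding proj_error_def local_energy_def by (rule lin[OF 1 2])
qed

text \<open>Equal defects \<open>\<delta>\<close> at both ends of a cell are balanced by
  \<open>\<delta>\<close> times the integral of the derivative of \<open>V j\<close>. What remains
  is the boundary term of cell 1, absorbed by the square of \<open>V 1\<close> at \<open>x 0\<close>
  in the energy.\<close>

lemma fine_consistency_left:
  assumes j: "j \<in> {1..M}"
  shows "consistency j \<le> proj_error j + local_energy j / 4
     + (if j = 1 then s * (K * hh)\<^sup>2 + s * (poly (V 1) (x 0))\<^sup>2 / 4 else 0)"
proof -
  have j4: "j \<in> {1..4*M}" and f: "fine_cell M j" using j by (auto simp: fine_cell_def)
  have le: "x (j-1) \<le> x j" using mesh(1)[OF j4] by simp
  have 1: "integral {x (j-1)..x j} (\<lambda>y. (u y - poly (PU j) y) * poly (pderiv (R j)) y) = 0"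
    by (rule fine_u[OF j4 f]) (rule degree_pderiv_le[OF deg_RV(1)])
  have 2: "integral {x (j-1)..x j} (\<lambda>y. (q y - poly (PQ j) y) * poly (pderiv (V j)) y)
      = \<delta> * (poly (V j) (x j) - poly (V j) (x (j-1)))"
    using fine_q[OF j4 f degree_pderiv_le[OF deg_RV(2)]] j integral_pderiv[OF le, of "V j"] by simp
  have 3: "au j = 0" using au_fine[of j] j4 f by simp
  have 4: "au (j-1) = 0" by (rule au_fine) (use j in \<open>auto simp: fine_cell_def\<close>)
  have 5: "aq j = \<delta>"
  proof (cases "j = M")
    case True then show ?thesis by (simp add: aq_M)
  next
    case False then show ?thesis using aq_left[of j] j by simp
  qed
  have 6: "aq (j-1) = \<delta> - (if j = 1 then s * poly (PU 1) (x 0) else 0)"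
    using aq_left[of "j-1"] j by (auto split: if_splits)
  have 7: "s * poly (PU 1) (x 0) * poly (V 1) (x 0) \<le> s * (K * hh)\<^sup>2 + s * (poly (V 1) (x 0))\<^sup>2 / 4"
  proof -
    have "(poly (PU 1) (x 0))\<^sup>2 \<le> (K * hh)\<^sup>2"
      using end_bound(1) u_bd power_mono[of "\<bar>poly (PU 1) (x 0)\<bar>" "K * hh" 2] by simp
    then have "poly (PU 1) (x 0) * poly (V 1) (x 0) \<le> (K * hh)\<^sup>2 + (poly (V 1) (x 0))\<^sup>2 / 4"
      using young_quarter[of "poly (PU 1) (x 0)" "poly (V 1) (x 0)"] by linarith
    from mult_left_mono[OF this, of s] s show ?thesis by (simp add: algebra_simps)
  qed
  have "consistency j = - (inverse (s\<^sup>2) * integral {x (j-1)..x j} (\<lambda>y. (q y - poly (PQ j) y) * poly (R j) y)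
      + integral {x (j-1)..x j} (\<lambda>y. b y * (u y - poly (PU j) y) * poly (V j) y))
      + (if j = 1 then s * poly (PU 1) (x 0) * poly (V 1) (x 0) else 0)"
    unfolding consistency_def 1 2 3 4 5 6 by (simp add: algebra_simps)
  then show ?thesis using fine_young[OF j4] 7 by auto
qed

text \<open>The lower bound for the width of a coarse cell replaces the width in the inverse
  inequality. In the second estimate the factor in front is the measure of the cell, which
  integration will supply.\<close>

lemma coarse_inverse:
  assumes j: "j \<in> {1..4*M}" "\<not> fine_cell M j" and y: "y \<in> {x (j-1)..x j}" and p: "degree (p::real poly) \<le> k"
  defines "J \<equiv> integral {x (j-1)..x j} (\<lambda>y. (poly p y)\<^sup>2)"
  shows "\<bar>poly p y\<bar> \<le> sqrt (\<kappa> * real (4*M) * J)"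
    "(x j - x (j-1)) * \<bar>poly (pderiv p) y\<bar> \<le> sqrt (\<kappa> * real (4*M) * J)"
proof -
  define H where "H = x j - x (j-1)"
  have ac: "x (j-1) < x j" using mesh(1)[OF j(1)] .
  have H: "H > 0" "1 / H \<le> real (4*M)"
    using ac coarse_width[OF j] M by (auto simp: H_def field_simps)
  have J: "J \<ge> 0" unfolding J_def
    by (intro integral_nonneg integrable_continuous_real continuous_intros) auto
  have HJ: "\<kappa> / H * J \<le> \<kappa> * real (4*M) * J"
    using H(2) J nonneg(4) mult_left_mono[OF H(2), of "\<kappa> * J"] by (simp add: mult_ac)
  show "\<bar>poly p y\<bar> \<le> sqrt (\<kappa> * real (4*M) * J)"
    using inv[OF p ac y] HJ by (intro real_le_rsqrt) (simp add: H_def J_def)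
  have "(H * \<bar>poly (pderiv p) y\<bar>)\<^sup>2 \<le> H\<^sup>2 * (\<kappa> / H ^ 3 * J)"
    unfolding power_mult_distrib power2_abs
    by (rule mult_left_mono) (use inv'[OF p ac y] in \<open>simp_all add: H_def J_def\<close>)
  also have "\<dots> = \<kappa> / H * J" using H(1) by (simp add: power2_eq_square power3_eq_cube)
  finally show "(x j - x (j-1)) * \<bar>poly (pderiv p) y\<bar> \<le> sqrt (\<kappa> * real (4*M) * J)"
    using HJ by (intro real_le_rsqrt) (simp add: H_def)
qed

text \<open>Young's inequality with the parameters that produce a quarter of the local energy:
  \<open>A * s\<^sup>2\<close> against the weight \<open>inverse (s\<^sup>2)\<close> of
  \<open>R\<close>, and \<open>A / bmin\<close> against the weight \<open>b\<close> of
  \<open>V\<close>. The remainder is of order \<open>N * s\<^sup>2 * S\<^sup>2\<close> per cell, so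
  its sum over the cells is of the order of the square of \<open>s * N * S\<close>.\<close>

lemma coarse_absorb:
  assumes j: "j \<in> {1..4*M}" "\<not> fine_cell M j"
  shows "c * K * S * sqrt (\<kappa> * real (4*M) * integral {x (j-1)..x j} (\<lambda>y. (poly (R j) y)\<^sup>2))
      + d * K * S * s * sqrt (\<kappa> * real (4*M) * integral {x (j-1)..x j} (\<lambda>y. (poly (V j) y)\<^sup>2))
    \<le> local_energy j / 4 + \<kappa> * real (4*M) * s\<^sup>2 * K\<^sup>2 * S\<^sup>2 * (c\<^sup>2 + d\<^sup>2 / bmin)"
proof -
  define A where "A = \<kappa> * real (4*M)"
  define \<rho> where "\<rho> = integral {x (j-1)..x j} (\<lambda>y. (poly (R j) y)\<^sup>2)"
  define \<nu> where "\<nu> = integral {x (j-1)..x j} (\<lambda>y. (poly (V j) y)\<^sup>2)"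
  have A: "A > 0" using M nonneg by (simp add: A_def)
  have n: "\<rho> \<ge> 0" "\<nu> \<ge> 0" unfolding \<rho>_def \<nu>_def
    by (intro integral_nonneg integrable_continuous_real continuous_intros; simp)+
  have nu: "bmin * \<nu> \<le> integral {x (j-1)..x j} (\<lambda>y. b y * (poly (V j) y)\<^sup>2)"
  proof -
    have "bmin * \<nu> = integral {x (j-1)..x j} (\<lambda>y. bmin * (poly (V j) y)\<^sup>2)" by (simp add: \<nu>_def)
    also have "\<dots> \<le> integral {x (j-1)..x j} (\<lambda>y. b y * (poly (V j) y)\<^sup>2)"
      by (intro integral_le integrable_continuous_real continuous_intros cell_cont[OF j(1)])
        (use b_lower mesh(2)[OF j(1)] in \<open>auto intro!: mult_right_mono\<close>)
    finally show ?thesis .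
  qed
  have "(c * K * S) * sqrt (A * \<rho>) \<le> (A * s\<^sup>2) * (c * K * S)\<^sup>2 + (sqrt (A * \<rho>))\<^sup>2 / (4 * (A * s\<^sup>2))"
    by (rule young_scaled) (use A s in simp)
  also have "(sqrt (A * \<rho>))\<^sup>2 / (4 * (A * s\<^sup>2)) = inverse (s\<^sup>2) * \<rho> / 4"
    using A n s by (simp add: field_simps)
  finally have 1: "(c * K * S) * sqrt (A * \<rho>) \<le> (A * s\<^sup>2) * (c * K * S)\<^sup>2 + inverse (s\<^sup>2) * \<rho> / 4" .
  have "(d * K * S * s) * sqrt (A * \<nu>) \<le> (A / bmin) * (d * K * S * s)\<^sup>2 + (sqrt (A * \<nu>))\<^sup>2 / (4 * (A / bmin))"
    by (rule young_scaled) (use A nonneg(5) in simp)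
  also have "(sqrt (A * \<nu>))\<^sup>2 / (4 * (A / bmin)) = bmin * \<nu> / 4"
    using A n nonneg(5) by (simp add: field_simps)
  finally have 2: "(d * K * S * s) * sqrt (A * \<nu>) \<le> (A / bmin) * (d * K * S * s)\<^sup>2 + bmin * \<nu> / 4" .
  have 3: "(A * s\<^sup>2) * (c * K * S)\<^sup>2 + (A / bmin) * (d * K * S * s)\<^sup>2 = A * s\<^sup>2 * K\<^sup>2 * S\<^sup>2 * (c\<^sup>2 + d\<^sup>2 / bmin)"
    using nonneg(5) by (simp add: power_mult_distrib field_simps)
  have lin: "l1 + l2 \<le> (r + t') / 4 + Q"
    if "l1 \<le> p1 + r / 4" "l2 \<le> p2 + t / 4" "p1 + p2 = Q" "t \<le> t'" for l1 l2 p1 p2 r t t' Q :: real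
    using that by (simp add: field_simps)
  show ?thesis
    unfolding \<rho>_def[symmetric] \<nu>_def[symmetric] A_def[symmetric] local_energy_def by (rule lin[OF 1 2 3 nu])
qed

text \<open>Both projections remove their zero-order terms, and that of \<open>q\<close> also the
  term with the derivative of \<open>V\<close>; the \<open>b\<close>-weighted one does not remove
  the term with the derivative of \<open>R\<close>. This integral and two traces with the factor 2
  make 5 against \<open>R\<close>, and there are two traces against \<open>V\<close>: hence
  \<open>25 = 5\<^sup>2\<close> and \<open>4 = 2\<^sup>2\<close>.\<close>

lemma coarse_consistency:
  assumes j: "j \<in> {1..4*M}" "\<not> fine_cell M j"
  shows "consistency j \<le> local_energy j / 4 + \<kappa> * real (4*M) * s\<^sup>2 * K\<^sup>2 * S\<^sup>2 * (25 + 4 / bmin)"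
proof -
  note c = cell_cont[OF j(1)]
  define \<rho> where "\<rho> = sqrt (\<kappa> * real (4*M) * integral {x (j-1)..x j} (\<lambda>y. (poly (R j) y)\<^sup>2))"
  define \<nu> where "\<nu> = sqrt (\<kappa> * real (4*M) * integral {x (j-1)..x j} (\<lambda>y. (poly (V j) y)\<^sup>2))"
  define H where "H = x j - x (j-1)"
  have H: "H > 0" using mesh(1)[OF j(1)] by (simp add: H_def)
  have ends: "x (j-1) \<in> {x (j-1)..x j}" "x j \<in> {x (j-1)..x j}" using H by (auto simp: H_def)
  have KS: "K * S \<ge> 0" using nonneg by simp
  have dv: "degree (pderiv (V j)) \<le> k" using degree_pderiv_le[OF deg_RV(2), of j] by linarith
  have r: "\<bar>poly (R j) (x (j-1))\<bar> \<le> \<rho>" "\<bar>poly (R j) (x j)\<bar> \<le> \<rho>"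
    and v: "\<bar>poly (V j) (x (j-1))\<bar> \<le> \<nu>" "\<bar>poly (V j) (x j)\<bar> \<le> \<nu>"
    unfolding \<rho>_def \<nu>_def using coarse_inverse(1)[OF j _ deg_RV(1)] coarse_inverse(1)[OF j _ deg_RV(2)] ends
    by blast+
  have jm: "j \<in> {M..3*M}" "j - 1 \<in> {M..3*M}" using j by (auto simp: fine_cell_def)
  have I: "- integral {x (j-1)..x j} (\<lambda>y. (u y - poly (PU j) y) * poly (pderiv (R j)) y) \<le> K * S * \<rho>"
  proof -
    have "integral {x (j-1)..x j} (\<lambda>y. - ((u y - poly (PU j) y) * poly (pderiv (R j)) y)) \<le> (K * S * (\<rho> / H)) * (x j - x (j-1))"
    proof (rule integral_le_const_mult)
      show "x (j-1) \<le> x j" using H by (simp add: H_def)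
      show "continuous_on {x (j-1)..x j} (\<lambda>y. - ((u y - poly (PU j) y) * poly (pderiv (R j)) y))"
        by (intro continuous_intros c)
    next
      fix y assume y: "y \<in> {x (j-1)..x j}"
      have "\<bar>poly (pderiv (R j)) y\<bar> \<le> \<rho> / H"
        using coarse_inverse(2)[OF j y deg_RV(1)[of j]] H
        unfolding H_def[symmetric] \<rho>_def[symmetric] by (simp add: pos_le_divide_eq mult.commute)
      then have "\<bar>u y - poly (PU j) y\<bar> * \<bar>poly (pderiv (R j)) y\<bar> \<le> (K * S) * (\<rho> / H)"
        using coarse_bound(1)[OF j y] KS by (intro mult_mono) auto
      then show "- ((u y - poly (PU j) y) * poly (pderiv (R j)) y) \<le> K * S * (\<rho> / H)"
        unfolding abs_mult[symmetric] by linarith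
    qed
    then show ?thesis using H unfolding H_def[symmetric] by simp
  qed
  have bil: "t * z \<le> T * Z" if "\<bar>t\<bar> \<le> T" "\<bar>z\<bar> \<le> Z" for t z T Z :: real
  proof -
    have "t * z \<le> \<bar>t\<bar> * \<bar>z\<bar>" by (metis abs_ge_self abs_mult)
    also have "\<dots> \<le> T * Z" using that by (intro mult_mono) linarith+
    finally show ?thesis .
  qed
  have "consistency j = - integral {x (j-1)..x j} (\<lambda>y. (u y - poly (PU j) y) * poly (pderiv (R j)) y)
      + au j * poly (R j) (x j) + (- au (j-1)) * poly (R j) (x (j-1))
      + aq j * poly (V j) (x j) + (- aq (j-1)) * poly (V j) (x (j-1))"
    unfolding consistency_def using coarse_q[OF j deg_RV(1)] coarse_q[OF j dv] coarse_u[OF j deg_RV(2)] by simp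
  also have "\<dots> \<le> K * S * \<rho> + 2 * K * S * \<rho> + 2 * K * S * \<rho> + K * S * s * \<nu> + K * S * s * \<nu>"
    by (intro add_mono I bil r v) (use au_bound aq_bound jm in auto)
  also have "\<dots> = 5 * K * S * \<rho> + 2 * K * S * s * \<nu>" by simp
  also have "\<dots> \<le> local_energy j / 4 + \<kappa> * real (4*M) * s\<^sup>2 * K\<^sup>2 * S\<^sup>2 * (25 + 4 / bmin)"
    using coarse_absorb[OF j, of 5 2] by (simp add: \<rho>_def \<nu>_def)
  finally show ?thesis .
qed

text \<open>Here the defect of the flux of \<open>u\<close> meets a trace of \<open>R\<close> on a
  fine cell, where the inverse inequality is too expensive. That trace is rewritten as the jump plus
  the trace from the coarse side: the penalty in the energy pays for the former, the coarse inverse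
  inequality for the latter.\<close>

lemma interface_bound:
  "- au (3*M) * poly (R (Suc (3*M))) (x (3*M))
    \<le> (1/s) * q_jump\<^sup>2 / 4 + 4 * s * K\<^sup>2 * S\<^sup>2 + local_energy (3*M) / 4 + \<kappa> * real (4*M) * s\<^sup>2 * K\<^sup>2 * S\<^sup>2 * 4"
proof -
  have j: "3*M \<in> {1..4*M}" "\<not> fine_cell M (3*M)" using M by (auto simp: fine_cell_def)
  define \<rho> where "\<rho> = sqrt (\<kappa> * real (4*M) * integral {x (3*M-1)..x (3*M)} (\<lambda>y. (poly (R (3*M)) y)\<^sup>2))"
  have xin: "x (3*M) \<in> {x (3*M-1)..x (3*M)}" using mesh(1)[OF j(1)] by simp
  have r: "\<bar>poly (R (3*M)) (x (3*M))\<bar> \<le> \<rho>"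
    unfolding \<rho>_def by (rule coarse_inverse(1)[OF j xin deg_RV(1)])
  have KS: "0 \<le> 2 * K * S" using nonneg by simp
  have "- au (3*M) * poly (R (Suc (3*M))) (x (3*M)) \<le> \<bar>au (3*M)\<bar> * \<bar>poly (R (Suc (3*M))) (x (3*M))\<bar>"
    by (metis abs_ge_minus_self abs_mult mult_minus_left)
  also have "\<dots> \<le> (2 * K * S) * (\<bar>q_jump\<bar> + \<rho>)"
  proof (rule mult_mono)
    show "\<bar>au (3*M)\<bar> \<le> 2 * K * S" by (rule au_bound) simp
    show "\<bar>poly (R (Suc (3*M))) (x (3*M))\<bar> \<le> \<bar>q_jump\<bar> + \<rho>" using r unfolding q_jump_def by linarith
  qed (use KS in auto)
  also have "\<dots> = (2 * K * S) * \<bar>q_jump\<bar> + 2 * K * S * \<rho>" by (simp add: algebra_simps)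
  also have "\<dots> \<le> (s * (2 * K * S)\<^sup>2 + \<bar>q_jump\<bar>\<^sup>2 / (4 * s))
     + (local_energy (3*M) / 4 + \<kappa> * real (4*M) * s\<^sup>2 * K\<^sup>2 * S\<^sup>2 * (2\<^sup>2 + 0\<^sup>2 / bmin))"
    using young_scaled[OF s, of "2 * K * S" "\<bar>q_jump\<bar>"] coarse_absorb[OF j, of 2 0] by (simp add: \<rho>_def)
  finally show ?thesis by (simp add: power_mult_distrib)
qed

text \<open>\<open>PQ\<close> is exact at the left end of each of these cells and the flux of
  \<open>q\<close> is taken from the right, so no shift occurs. At the last node the flux uses the
  left trace, where \<open>PQ\<close> is not exact; that defect carries a factor \<open>s\<close>
  and is absorbed by the boundary square of \<open>V\<close>.\<close>

lemma fine_consistency_right: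
  assumes j: "j \<in> {3*M<..4*M}"
  shows "consistency j \<le> proj_error j + local_energy j / 4
     + (if j = Suc (3*M) then - au (3*M) * poly (R (Suc (3*M))) (x (3*M)) else 0)
     + (if j = 4*M then s * (K * hh)\<^sup>2 + s * (poly (V (4*M)) (x (4*M)))\<^sup>2 / 4 else 0)"
proof -
  have j4: "j \<in> {1..4*M}" and f: "fine_cell M j" and nl: "\<not> j \<le> M" using j by (auto simp: fine_cell_def)
  have 1: "integral {x (j-1)..x j} (\<lambda>y. (u y - poly (PU j) y) * poly (pderiv (R j)) y) = 0"
    by (rule fine_u[OF j4 f]) (rule degree_pderiv_le[OF deg_RV(1)])
  have 2: "integral {x (j-1)..x j} (\<lambda>y. (q y - poly (PQ j) y) * poly (pderiv (V j)) y) = 0"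
    using fine_q[OF j4 f degree_pderiv_le[OF deg_RV(2)]] nl by simp
  have 3: "au j = 0" using au_fine[of j] j4 f by simp
  have 4: "au (j-1) = (if j = Suc (3*M) then au (3*M) else 0)"
  proof (cases "j = Suc (3*M)")
    case False
    then have "j - 1 \<le> 4*M" "fine_cell M (j-1)" using j by (auto simp: fine_cell_def)
    then show ?thesis using au_fine False by simp
  qed simp
  have 5: "aq (j-1) = 0" using aq_right[of "j-1"] j by auto
  have 6: "aq j = (if j = 4*M then q (x (4*M)) - poly (PQ (4*M)) (x (4*M)) else 0)"
    using aq_right[of j] aq_last j by auto
  have 7: "(q (x (4*M)) - poly (PQ (4*M)) (x (4*M))) * poly (V (4*M)) (x (4*M))
     \<le> s * (K * hh)\<^sup>2 + s * (poly (V (4*M)) (x (4*M)))\<^sup>2 / 4"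
  proof -
    let ?e = "q (x (4*M)) - poly (PQ (4*M)) (x (4*M))"
    have "?e\<^sup>2 \<le> (K * hh * s)\<^sup>2"
      using end_bound(2) power_mono[of "\<bar>?e\<bar>" "K * hh * s" 2] by simp
    \<comment> \<open>The weight \<open>1 / s\<close> suits a defect of order \<open>s\<close>: the
      other half of Young's inequality is then a quarter of the boundary penalty.\<close>
    then have "(1/s) * ?e\<^sup>2 \<le> (1/s) * (K * hh * s)\<^sup>2" using s by (intro mult_left_mono) auto
    also have "\<dots> = s * (K * hh)\<^sup>2" using s by (simp add: power2_eq_square)
    finally show ?thesis
      using young_scaled[of "1/s" ?e "poly (V (4*M)) (x (4*M))"] s by (simp add: mult.commute)
  qed
  have "consistency j = - (inverse (s\<^sup>2) * integral {x (j-1)..x j} (\<lambda>y. (q y - poly (PQ j) y) * poly (R j) y)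
      + integral {x (j-1)..x j} (\<lambda>y. b y * (u y - poly (PU j) y) * poly (V j) y))
      + (if j = Suc (3*M) then - au (3*M) * poly (R (Suc (3*M))) (x (3*M)) else 0)
      + (if j = 4*M then (q (x (4*M)) - poly (PQ (4*M)) (x (4*M))) * poly (V (4*M)) (x (4*M)) else 0)"
    unfolding consistency_def 1 2 3 4 5 6 by (auto simp: algebra_simps)
  then show ?thesis using fine_young[OF j4] 7 by (auto split: if_splits)
qed

text \<open>Each cell spends a quarter of its energy, the interface another quarter of that of cell
  \<open>3 * M\<close>, and the boundary and jump terms a quarter of theirs. This is at most half of
  the energy, whence the leading factor 2; \<open>29 = 25 + 4\<close> adds the interface to the
  coarse cells.\<close>

lemma energy_bound:
  "energy \<le> 2 * ((\<Sum>j\<in>{j\<in>{1..4*M}. fine_cell M j}. proj_error j)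
     + 2 * s * (K * hh)\<^sup>2 + 4 * s * K\<^sup>2 * S\<^sup>2 + \<kappa> * (real (4*M))\<^sup>2 * s\<^sup>2 * K\<^sup>2 * S\<^sup>2 * (29 + 4 / bmin))"
proof -
  define A where "A = \<kappa> * real (4*M) * s\<^sup>2 * K\<^sup>2 * S\<^sup>2"
  have A: "A \<ge> 0" using nonneg by (simp add: A_def)
  define B where "B = 25 + 4 / bmin"
  have B: "B \<ge> 0" using nonneg(5) by (simp add: B_def)
  define e1 where "e1 = s * (K * hh)\<^sup>2 + s * (poly (V 1) (x 0))\<^sup>2 / 4"
  define e2 where "e2 = - au (3*M) * poly (R (Suc (3*M))) (x (3*M))"
  define e3 where "e3 = s * (K * hh)\<^sup>2 + s * (poly (V (4*M)) (x (4*M)))\<^sup>2 / 4"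
  have le_nonneg: "local_energy j \<ge> 0" if j: "j \<in> {1..4*M}" for j
  proof -
    have "b y \<ge> 0" if "y \<in> {x (j-1)..x j}" for y
      using b_lower[of y] mesh(2)[OF j] that nonneg(5) by fastforce
    then show ?thesis unfolding local_energy_def
      by (intro add_nonneg_nonneg mult_nonneg_nonneg integral_nonneg integrable_continuous_real
          continuous_intros cell_cont[OF j]) auto
  qed
  have pw: "consistency j \<le> (if fine_cell M j then proj_error j else 0) + A * B + local_energy j / 4
      + (if j = 1 then e1 else 0) + (if j = Suc (3*M) then e2 else 0) + (if j = 4*M then e3 else 0)"
    if j: "j \<in> {1..4*M}" for j
  proof -
    have AB: "A * B \<ge> 0" using A B by simp
    consider "j \<in> {1..M}" | "\<not> fine_cell M j" | "j \<in> {3*M<..4*M}" using j by (auto simp: fine_cell_def)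
    then show ?thesis
    proof cases
      case 1
      then have "fine_cell M j" "j \<noteq> Suc (3*M)" "j \<noteq> 4*M" by (auto simp: fine_cell_def)
      then show ?thesis using fine_consistency_left[OF 1] AB e1_def by auto
    next
      case 2
      then have "j \<noteq> 1" "j \<noteq> Suc (3*M)" "j \<noteq> 4*M" using M by (auto simp: fine_cell_def)
      then show ?thesis using coarse_consistency[OF j 2] 2 by (simp add: A_def B_def)
    next
      case 3
      then have "fine_cell M j" "j \<noteq> 1" using M by (auto simp: fine_cell_def)
      then show ?thesis using fine_consistency_right[OF 3] AB unfolding e2_def e3_def by (simp split: if_splits)
    qed
  qed
  have lin: "e \<le> 2 * (P + Z + T + W)"
    if "e \<le> P + X + L + a + c + J + T + Y" "L + a + c + J \<le> e / 2 + Z" "X + Y \<le> W"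
    for e P X L a c J T Y Z W :: real
    using that by (simp add: field_simps)
  have filt: "(\<Sum>j=1..4*M. if fine_cell M j then proj_error j else 0)
      = (\<Sum>j\<in>{j\<in>{1..4*M}. fine_cell M j}. proj_error j)"
    by (rule sum.inter_filter[symmetric]) simp
  have "energy = (\<Sum>j=1..4*M. consistency j)" by (rule energy_identity)
  also have "\<dots> \<le> (\<Sum>j=1..4*M. (if fine_cell M j then proj_error j else 0) + A * B + local_energy j / 4
      + (if j = 1 then e1 else 0) + (if j = Suc (3*M) then e2 else 0) + (if j = 4*M then e3 else 0))"
    by (rule sum_mono) (rule pw)
  also have "\<dots> = (\<Sum>j\<in>{j\<in>{1..4*M}. fine_cell M j}. proj_error j) + real (4*M) * (A * B)
      + (\<Sum>j=1..4*M. local_energy j) / 4 + e1 + e2 + e3"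
    using M by (simp add: sum.distrib sum_divide_distrib filt[simplified])
  also have "e2 \<le> (1/s) * q_jump\<^sup>2 / 4 + 4 * s * K\<^sup>2 * S\<^sup>2 + local_energy (3*M) / 4 + A * 4"
    unfolding e2_def A_def by (rule interface_bound)
  \<comment> \<open>The single cell is replaced by the whole sum; with the quarter already spent on
    every cell this makes one half.\<close>
  also have "local_energy (3*M) \<le> (\<Sum>j=1..4*M. local_energy j)"
    by (rule member_le_sum) (use le_nonneg M in auto)
  finally have "energy \<le> (\<Sum>j\<in>{j\<in>{1..4*M}. fine_cell M j}. proj_error j) + real (4*M) * (A * B)
      + (\<Sum>j=1..4*M. local_energy j) / 2 + e1 + e3 + (1/s) * q_jump\<^sup>2 / 4 + 4 * s * K\<^sup>2 * S\<^sup>2 + A * 4"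
    by simp
  moreover have "(\<Sum>j=1..4*M. local_energy j) / 2 + e1 + e3 + (1/s) * q_jump\<^sup>2 / 4 \<le> energy / 2 + 2 * s * (K * hh)\<^sup>2"
    using s unfolding e1_def e3_def energy_def by (simp add: field_simps)
  moreover have "real (4*M) * (A * B) + A * 4 \<le> \<kappa> * (real (4*M))\<^sup>2 * s\<^sup>2 * K\<^sup>2 * S\<^sup>2 * (29 + 4 / bmin)"
  proof -
    have "A * 4 \<le> real (4*M) * (A * 4)" using mult_right_mono[of 1 "real (4*M)" "A * 4"] M A by simp
    then have "real (4*M) * (A * B) + A * 4 \<le> real (4*M) * (A * B) + real (4*M) * (A * 4)" by linarith
    also have "\<dots> = real (4*M) * A * (29 + 4 / bmin)" by (simp add: B_def algebra_simps)
    also have "\<dots> = \<kappa> * (real (4*M))\<^sup>2 * s\<^sup>2 * K\<^sup>2 * S\<^sup>2 * (29 + 4 / bmin)"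
      by (simp only: A_def power2_eq_square mult_ac)
    finally show ?thesis .
  qed
  ultimately show ?thesis by (rule lin)
qed

end

subsection \<open>The Shishkin mesh and the layer decomposition\<close>

text \<open>If the width of a cell, in units of the layer, is at most \<open>Z\<close>, then the
  width times the largest value of the exponential is at most a constant times its decrease over the
  cell. Sums of such terms telescope.\<close>

lemma exp_telescope_step:
  fixes z Z :: real
  assumes "0 \<le> z" "z \<le> Z"
  shows "z \<le> (1 + Z) * (1 - exp (- z))"
proof -
  have "1 + z \<le> exp z" by (rule exp_ge_add_one_self)
  then have "exp (- z) \<le> 1 / (1 + z)"
    using assms by (simp add: exp_minus field_simps)
  then have "z / (1 + z) \<le> 1 - exp (- z)"
    using assms by (simp add: field_simps)
  then have "z \<le> (1 + z) * (1 - exp (- z))"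
    using assms by (simp add: field_simps)
  also have "\<dots> \<le> (1 + Z) * (1 - exp (- z))"
    using assms by (intro mult_right_mono) auto
  finally show ?thesis .
qed

locale layer_decomposition =
  fixes k M :: nat and \<beta> \<sigma> C1 \<epsilon> :: real and u0 u1 u2 :: "real \<Rightarrow> real"
  assumes beta: "\<beta> > 0" and sigma: "\<sigma> \<ge> real k + 1" and C1: "C1 > 0"
    and eps: "0 < \<epsilon>" "\<epsilon> < 1" and M: "M \<ge> 1"
    and trans: "transition \<sigma> \<beta> \<epsilon> (4*M) \<le> 1 / 4"
    and diff: "times_differentiable_on {0..1} (k + 2) u0" "times_differentiable_on {0..1} (k + 2) u1"
      "times_differentiable_on {0..1} (k + 2) u2"
    and bound: "\<And>j y. j \<le> k + 2 \<Longrightarrow> y \<in> {0..1} \<Longrightarrow> \<bar>nderiv_on {0..1} j u0 y\<bar> \<le> C1"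
      "\<And>j y. j \<le> k + 2 \<Longrightarrow> y \<in> {0..1} \<Longrightarrow>
         \<bar>nderiv_on {0..1} j u1 y\<bar> \<le> C1 * \<epsilon> powr (- (real j / 2)) * exp (- \<beta> * y / sqrt \<epsilon>)"
      "\<And>j y. j \<le> k + 2 \<Longrightarrow> y \<in> {0..1} \<Longrightarrow>
         \<bar>nderiv_on {0..1} j u2 y\<bar> \<le> C1 * \<epsilon> powr (- (real j / 2)) * exp (- \<beta> * (1 - y) / sqrt \<epsilon>)"
begin

definition "s = sqrt \<epsilon>"
definition "n = real (4 * M)"
definition "\<tau> = transition \<sigma> \<beta> \<epsilon> (4*M)"
definition "x = shishkin \<sigma> \<beta> \<epsilon> (4*M)"
definition "h = ln n / n"
definition "S = (1 / n) ^ (k + 1)"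
definition "hh = h ^ (k + 1)"
definition "E0 y = exp (- \<beta> * y / s)"
definition "E1 y = exp (- \<beta> * (1 - y) / s)"
text \<open>On a fine cell this is the largest value of both layer functions, taken at the end point
  nearer to the boundary.\<close>

definition "E j = (if j \<le> M then E0 (x (j - 1)) else E1 (x j))"
definition "us y = u0 y + u1 y + u2 y"
text \<open>The flux \<open>q\<close>, built from derivatives within \<open>[0, 1]\<close>: it is
  continuous up to the end points, where \<open>deriv u\<close> is not controlled.\<close>

definition "qs y = s\<^sup>2 * (nderiv_on {0..1} 1 u0 y + nderiv_on {0..1} 1 u1 y + nderiv_on {0..1} 1 u2 y)"

lemma s: "0 < s" "s < 1" "s\<^sup>2 = \<epsilon>" "s\<^sup>2 < 1"
  using eps by (auto simp: s_def real_sqrt_lt_1_iff)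

lemma n: "n \<ge> 4" "n > 0" using M by (auto simp: n_def)

text \<open>Four exceeds the base of the logarithm. Powers of \<open>ln n\<close> can therefore be
  inserted freely in upper bounds.\<close>

lemma ln_n: "ln n \<ge> 1" 
proof -
  have "exp 1 \<le> n" using exp_le n(1) by linarith
  then show ?thesis using ln_ge_iff[of n 1] n by simp
qed

lemma h: "0 < h" "h \<le> 1" "1 / n \<le> h"
proof -
  show "0 < h" "1 / n \<le> h" using n ln_n by (auto simp: h_def divide_right_mono)
  have "ln n \<le> n" using ln_le_minus_one[of n] n by linarith
  then show "h \<le> 1" using n by (simp add: h_def)
qed

lemma S: "0 < S" "S \<le> hh" "hh \<le> 1" "0 < hh"
  using n h by (auto simp: S_def hh_def intro!: power_mono power_le_one simp del: power_Suc)

lemma tau: "\<tau> = (\<sigma> / \<beta>) * s * ln n" "0 < \<tau>" "\<tau> \<le> 1 / 4"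
proof -
  have "ln n > 0" using ln_n by linarith
  moreover have "\<sigma> > 0" using sigma by linarith
  moreover show eq: "\<tau> = (\<sigma> / \<beta>) * s * ln n" by (simp add: \<tau>_def transition_def s_def n_def)
  ultimately show "0 < \<tau>" unfolding eq using beta s(1) by simp
  show "\<tau> \<le> 1 / 4" using trans by (simp add: \<tau>_def)
qed

lemma sigma_pos: "\<sigma> > 0" using sigma by linarith

lemma x_eq: "x j = (if j \<le> M then real j * (\<tau> / (n / 4))
    else if j \<le> 3 * M then \<tau> + (real j - n / 4) * ((1 - 2 * \<tau>) / (n / 2))
    else (1 - \<tau>) + (real j - 3 * n / 4) * (\<tau> / (n / 4)))"
  by (simp add: x_def shishkin_def Let_def \<tau>_def[symmetric] n_def)

lemma x_left: "j \<le> M \<Longrightarrow> x j = real j * (4 * \<tau> / n)"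
  by (simp add: x_eq)

text \<open>Neighbouring formulas agree at the breakpoints \<open>M\<close> and
  \<open>3 * M\<close>, so both ends of every cell can be computed with one formula.\<close>

lemma x_mid: "M \<le> j \<Longrightarrow> j \<le> 3 * M \<Longrightarrow> x j = \<tau> + (real j - n / 4) * (2 * (1 - 2 * \<tau>) / n)"
  using M by (cases "j = M") (simp_all add: x_eq n_def field_simps)

lemma x_right: "3 * M \<le> j \<Longrightarrow> x j = (1 - \<tau>) + (real j - 3 * n / 4) * (4 * \<tau> / n)"
  using M by (cases "j = 3 * M") (simp_all add: x_eq n_def field_simps)

lemma x_special: "x 0 = 0" "x M = \<tau>" "x (3 * M) = 1 - \<tau>" "x (4 * M) = 1"
  using M x_left[of 0] x_left[of M] x_mid[of "3*M"] x_right[of "3*M"] x_right[of "4*M"] by (auto simp: n_def)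

lemma step:
  assumes "j \<in> {1..4*M}"
  shows "x j - x (j-1) = (if fine_cell M j then 4 * \<tau> / n else 2 * (1 - 2 * \<tau>) / n)"
proof -
  have j: "real (j - 1) = real j - 1" using assms by (simp add: of_nat_diff)
  have d: "(a + (real j - c) * w) - (a + (real j - 1 - c) * w) = w" for a c w :: real
    by (simp add: algebra_simps)
  consider "j \<le> M" | "M < j" "j \<le> 3 * M" | "3 * M < j" by linarith
  then show ?thesis
  proof cases
    case 1
    then have "j - 1 \<le> M" by simp
    then show ?thesis using 1 d[of 0 0 "4 * \<tau> / n"] x_left[of j] x_left[of "j-1"]
      by (simp add: fine_cell_def j del: One_nat_def)
  next
    case 2
    then have "M \<le> j - 1" "j - 1 \<le> 3 * M" by auto
    then show ?thesis
      using 2 d[of \<tau> "n / 4" "2 * (1 - 2 * \<tau>) / n"] x_mid[of j] x_mid[of "j-1"]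
      by (simp only: fine_cell_def j) simp
  next
    case 3
    then have "3 * M \<le> j - 1" by simp
    then show ?thesis
      using 3 d[of "1 - \<tau>" "3 * n / 4" "4 * \<tau> / n"] x_right[of j] x_right[of "j-1"]
      by (simp only: fine_cell_def j) simp
  qed
qed

lemma fine_step: "4 * \<tau> / n = (4 * \<sigma> / \<beta>) * s * h"
  by (simp add: tau(1) h_def)

lemma x_less: "j \<in> {1..4*M} \<Longrightarrow> x (j-1) < x j"
proof -
  assume j: "j \<in> {1..4*M}"
  have "0 < 4 * \<tau> / n" "0 < 2 * (1 - 2 * \<tau>) / n" using tau(2,3) n by simp_all
  then have "x j - x (j-1) > 0" unfolding step[OF j] by simp
  then show ?thesis by simp
qed

lemma x_mono:
  assumes "i \<le> j" "j \<le> 4*M"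
  shows "x i \<le> x j"
  using assms
proof (induction j)
  case (Suc j)
  then show ?case
  proof (cases "i = Suc j")
    case False
    then have "x i \<le> x j" using Suc by simp
    then show ?thesis using x_less[of "Suc j"] Suc.prems by simp
  qed simp
qed simp

lemma x_cell: "j \<in> {1..4*M} \<Longrightarrow> {x (j-1)..x j} \<subseteq> {0..1}"
  using x_mono[of 0 "j-1"] x_mono[of j "4*M"] x_special by auto

lemma coarse_width: "j \<in> {1..4*M} \<Longrightarrow> \<not> fine_cell M j \<Longrightarrow> x j - x (j-1) \<ge> 1 / n"
  "j \<in> {1..4*M} \<Longrightarrow> \<not> fine_cell M j \<Longrightarrow> x j - x (j-1) \<le> 2 / n"
  using step[of j] tau(2,3) n by (auto simp: divide_right_mono)

section \<open>Size of the layer functions on fine and coarse cells\<close>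

lemma E_pos: "E0 y > 0" "E1 y > 0" "E j > 0"
  by (auto simp: E0_def E1_def E_def)

lemma E0_antimono: "y \<le> z \<Longrightarrow> E0 z \<le> E0 y"
  using s(1) beta by (simp add: E0_def divide_right_mono)

lemma E1_mono: "y \<le> z \<Longrightarrow> E1 y \<le> E1 z"
  using s(1) beta by (simp add: E1_def divide_right_mono)

text \<open>This is where \<open>\<sigma> \<ge> k + 1\<close> enters: at the transition points the
  layers have decayed to \<open>n\<close> to the power \<open>- \<sigma>\<close>, hence to the size
  of the approximation error on coarse cells.\<close>

lemma E_tau: "E0 \<tau> \<le> S" "E1 (1 - \<tau>) \<le> S"
proof -
  have "E0 \<tau> = exp (- (\<sigma> * ln n))" using s(1) beta by (simp add: E0_def tau(1))
  also have "\<dots> \<le> exp (- (real (k + 1) * ln n))"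
    using sigma ln_n by (simp add: mult_right_mono)
  also have "\<dots> = S"
    using n(2) by (simp only: exp_minus exp_of_nat_mult exp_ln S_def power_one_over inverse_eq_divide)
  finally show "E0 \<tau> \<le> S" .
  then show "E1 (1 - \<tau>) \<le> S" by (simp add: E0_def E1_def)
qed

text \<open>Since \<open>\<tau> \<le> 1 / 4\<close>, each fine part lies in the half of
  \<open>[0, 1]\<close> near its own boundary point, and the layer attached to that point dominates
  the other one.\<close>

lemma fine_layer:
  assumes "j \<in> {1..4*M}" "fine_cell M j" "y \<in> {x (j-1)..x j}"
  shows "E0 y \<le> E j" "E1 y \<le> E j"
proof -
  have "E0 y \<le> E j \<and> E1 y \<le> E j"
  proof (cases "j \<le> M")
    case True
    have "y \<le> \<tau>" using assms x_mono[of j M] True x_special by auto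
    then have "E1 y \<le> E0 y"
      using s(1) beta tau(3) unfolding E0_def E1_def by (simp add: divide_right_mono)
    moreover have "E0 y \<le> E0 (x (j-1))" using assms by (intro E0_antimono) auto
    ultimately show ?thesis using True by (simp add: E_def)
  next
    case False
    then have "3 * M \<le> j - 1" "j - 1 \<le> 4 * M" using assms by (auto simp: fine_cell_def)
    then have "1 - \<tau> \<le> y" using assms x_mono[of "3*M" "j-1"] x_special by auto
    then have "E0 y \<le> E1 y"
      using s(1) beta tau(3) unfolding E0_def E1_def by (simp add: divide_right_mono)
    moreover have "E1 y \<le> E1 (x j)" using assms by (intro E1_mono) auto
    ultimately show ?thesis using False by (simp add: E_def)
  qed
  then show "E0 y \<le> E j" "E1 y \<le> E j" by auto
qed

lemma E_le_1: "j \<in> {1..4*M} \<Longrightarrow> E j \<le> 1"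
  using x_cell[of j] x_less[of j] beta s(1) by (auto simp: E_def E0_def E1_def)

lemma coarse_layer:
  assumes "j \<in> {1..4*M}" "\<not> fine_cell M j" "y \<in> {x (j-1)..x j}"
  shows "E0 y \<le> S" "E1 y \<le> S"
proof -
  have "M \<le> j - 1" "j - 1 \<le> 4 * M" "j \<le> 3 * M" using assms by (auto simp: fine_cell_def)
  then have "\<tau> \<le> y" "y \<le> 1 - \<tau>"
    using assms x_mono[of M "j-1"] x_mono[of j "3*M"] x_special by auto
  then show "E0 y \<le> S" "E1 y \<le> S"
    using E_tau E0_antimono E1_mono order_trans by blast+
qed

section \<open>Polynomial approximation of the solution and its flux on a cell\<close>

lemma eps_powr: "\<epsilon> powr (- (real j / 2)) = 1 / s ^ j"
proof -
  have "\<epsilon> powr (real j / 2) = (\<epsilon> powr (1/2)) powr real j" by (subst powr_powr) simp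
  also have "\<epsilon> powr (1/2) = s" using eps powr_half_sqrt[of \<epsilon>] by (simp only: s_def less_imp_le)
  also have "s powr real j = s ^ j" by (rule powr_realpow[OF s(1)])
  finally show ?thesis by (simp only: powr_minus_divide)
qed

lemma layer_bound:
  assumes "j \<le> k + 2" "y \<in> {0..1}"
  shows "\<bar>nderiv_on {0..1} j u1 y\<bar> \<le> C1 / s ^ j * E0 y" "\<bar>nderiv_on {0..1} j u2 y\<bar> \<le> C1 / s ^ j * E1 y"
  using bound(2,3)[OF assms] by (simp_all add: eps_powr E0_def E1_def s_def[symmetric])

lemma taylor_nderiv:
  assumes "times_differentiable_on {0..1} (k + 2) g" "i \<le> 1" "a \<le> c" "{a..c} \<subseteq> {0..1}"
    and "\<And>y. y \<in> {a..c} \<Longrightarrow> \<bar>nderiv_on {0..1} (Suc k + i) g y\<bar> \<le> B"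
  obtains p where "degree p \<le> k" "\<And>y. y \<in> {a..c} \<Longrightarrow> \<bar>nderiv_on {0..1} i g y - poly p y\<bar> \<le> B * (c - a) ^ Suc k"
proof -
  have der: "((\<lambda>l. nderiv_on {0..1} (l + i) g) l has_field_derivative (\<lambda>l. nderiv_on {0..1} (l + i) g) (Suc l) y) (at y within {0..1})"
    if "y \<in> {0..1}" "l \<le> k" for l y
    using times_differentiable_on_has_derivative[OF assms(1), of "l + i" y] that assms(2) by simp
  show ?thesis
    by (rule taylor_polynomial_bound[OF assms(3,4) der assms(5)]) (auto intro: that)
qed

text \<open>The case \<open>i = 0\<close> serves \<open>u\<close>, the case \<open>i = 1\<close> serves \<open>q / sqrt \<epsilon>\<close>.\<close>

lemma fine_taylor:
  assumes j: "j \<in> {1..4*M}" "fine_cell M j" and i: "i \<le> 1"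
  shows "\<exists>p. degree p \<le> k \<and> (\<forall>y\<in>{x (j-1)..x j}.
    \<bar>s ^ i * (nderiv_on {0..1} i u0 y + nderiv_on {0..1} i u1 y + nderiv_on {0..1} i u2 y) - poly p y\<bar>
      \<le> 2 * C1 * (4 * \<sigma> / \<beta>) ^ (k+1) * (hh * (sqrt s + E j)))"
proof -
  define H where "H = x j - x (j-1)"
  have H: "H = (4 * \<sigma> / \<beta>) * s * h" using step[OF j(1)] j(2) fine_step by (simp add: H_def)
  define c4 where "c4 = (4 * \<sigma> / \<beta>) ^ (k+1)"
  have c4: "c4 > 0" using sigma_pos beta by (simp add: c4_def)
  have HS: "H ^ Suc k = c4 * s ^ Suc k * hh" 
    unfolding H c4_def hh_def power_mult_distrib by simp
  have le: "x (j-1) \<le> x j" using x_less[OF j(1)] by simp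
  note sub = x_cell[OF j(1)]
  have ki: "Suc k + i \<le> k + 2" using i by simp
  have sp: "s ^ (Suc k + i) > 0" using s(1) by simp
  obtain p0 where p0: "degree p0 \<le> k"
    "\<And>y. y \<in> {x (j-1)..x j} \<Longrightarrow> \<bar>nderiv_on {0..1} i u0 y - poly p0 y\<bar> \<le> C1 * H ^ Suc k"
    unfolding H_def by (rule taylor_nderiv[OF diff(1) i le sub bound(1)[OF ki]]) (use sub in auto)
  have B1: "\<bar>nderiv_on {0..1} (Suc k + i) u1 y\<bar> \<le> C1 / s ^ (Suc k + i) * E j"
    "\<bar>nderiv_on {0..1} (Suc k + i) u2 y\<bar> \<le> C1 / s ^ (Suc k + i) * E j" if y: "y \<in> {x (j-1)..x j}" for y
  proof -
    have y1: "y \<in> {0..1}" using sub y by blast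
    have "C1 / s ^ (Suc k + i) * E0 y \<le> C1 / s ^ (Suc k + i) * E j"
      "C1 / s ^ (Suc k + i) * E1 y \<le> C1 / s ^ (Suc k + i) * E j"
      by (rule mult_left_mono[OF _ less_imp_le[OF divide_pos_pos[OF C1 sp]]], rule fine_layer[OF j y])+
    then show "\<bar>nderiv_on {0..1} (Suc k + i) u1 y\<bar> \<le> C1 / s ^ (Suc k + i) * E j"
      "\<bar>nderiv_on {0..1} (Suc k + i) u2 y\<bar> \<le> C1 / s ^ (Suc k + i) * E j"
      using layer_bound[OF ki y1] by linarith+
  qed
  obtain p1 where p1: "degree p1 \<le> k"
    "\<And>y. y \<in> {x (j-1)..x j} \<Longrightarrow> \<bar>nderiv_on {0..1} i u1 y - poly p1 y\<bar> \<le> C1 / s ^ (Suc k + i) * E j * H ^ Suc k"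
    unfolding H_def by (rule taylor_nderiv[OF diff(2) i le sub B1(1)]) auto
  obtain p2 where p2: "degree p2 \<le> k"
    "\<And>y. y \<in> {x (j-1)..x j} \<Longrightarrow> \<bar>nderiv_on {0..1} i u2 y - poly p2 y\<bar> \<le> C1 / s ^ (Suc k + i) * E j * H ^ Suc k"
    unfolding H_def by (rule taylor_nderiv[OF diff(3) i le sub B1(2)]) auto
  show ?thesis
  proof (intro exI[of _ "smult (s ^ i) (p0 + p1 + p2)"] conjI ballI)
    show "degree (smult (s ^ i) (p0 + p1 + p2)) \<le> k"
      by (intro order_trans[OF degree_smult_le] degree_add_le p0(1) p1(1) p2(1))
    fix y assume y: "y \<in> {x (j-1)..x j}"
    let ?d = "\<lambda>g p. nderiv_on {0..1} i g y - poly p y"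
    have si: "0 < s ^ i" "s ^ i \<le> 1" using s by (auto simp: power_le_one)
    \<comment> \<open>The width contributes \<open>s ^ Suc k\<close>, which together with
      \<open>s ^ i\<close> cancels the negative powers of \<open>s\<close> from the derivatives of
      the layer parts.\<close>
    have lay: "s ^ i * (C1 / s ^ (Suc k + i) * E j * H ^ Suc k) = C1 * c4 * hh * E j"
      unfolding HS using s(1) by (simp add: power_add field_simps)
    \<comment> \<open>A generous bound is enough for the smooth part, because the layer part has an
      \<open>L^2\<close> norm of order \<open>sqrt s\<close> as well.\<close>
    have "s ^ Suc k \<le> sqrt s"
    proof -
      have "s ^ Suc k \<le> s" using s by (simp add: mult_left_le power_le_one)
      also have "s \<le> sqrt s"
        using s real_sqrt_le_mono[of "s * s" s] mult_left_le[of s s] by simp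
      finally show ?thesis .
    qed
    moreover have "s ^ i * s ^ Suc k \<le> s ^ Suc k" using s by (simp add: mult_left_le_one_le power_le_one)
    ultimately have sk: "s ^ i * s ^ Suc k \<le> sqrt s" by linarith
    have "s ^ i * (C1 * H ^ Suc k) = C1 * c4 * hh * (s ^ i * s ^ Suc k)" unfolding HS by (simp add: algebra_simps)
    also have "\<dots> \<le> C1 * c4 * hh * sqrt s" using C1 c4 S(4) by (intro mult_left_mono[OF sk]) simp
    finally have sm: "s ^ i * (C1 * H ^ Suc k) \<le> C1 * c4 * hh * sqrt s" .
    have t: "s ^ i * \<bar>?d u0 p0\<bar> \<le> C1 * c4 * hh * sqrt s" "s ^ i * \<bar>?d u1 p1\<bar> \<le> C1 * c4 * hh * E j"
      "s ^ i * \<bar>?d u2 p2\<bar> \<le> C1 * c4 * hh * E j"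
      using mult_left_mono[OF p0(2)[OF y], of "s ^ i"] mult_left_mono[OF p1(2)[OF y], of "s ^ i"]
        mult_left_mono[OF p2(2)[OF y], of "s ^ i"] si sm unfolding lay by linarith+
    have "\<bar>s ^ i * (nderiv_on {0..1} i u0 y + nderiv_on {0..1} i u1 y + nderiv_on {0..1} i u2 y)
          - poly (smult (s ^ i) (p0 + p1 + p2)) y\<bar>
       = \<bar>s ^ i * (?d u0 p0 + ?d u1 p1 + ?d u2 p2)\<bar>"
      by (simp add: algebra_simps)
    also have "\<dots> = s ^ i * \<bar>?d u0 p0 + ?d u1 p1 + ?d u2 p2\<bar>"
      using si by (simp add: abs_mult)
    also have "\<dots> \<le> s ^ i * (\<bar>?d u0 p0\<bar> + \<bar>?d u1 p1\<bar> + \<bar>?d u2 p2\<bar>)"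
      by (rule mult_left_mono) (use si in linarith)+
    also have "\<dots> = s ^ i * \<bar>?d u0 p0\<bar> + s ^ i * \<bar>?d u1 p1\<bar> + s ^ i * \<bar>?d u2 p2\<bar>"
      by (simp only: distrib_left)
    also have "\<dots> \<le> C1 * c4 * hh * sqrt s + C1 * c4 * hh * E j + C1 * c4 * hh * E j"
      using t by linarith
    also have "\<dots> \<le> 2 * C1 * c4 * (hh * (sqrt s + E j))"
    proof -
      have "0 \<le> C1 * c4 * hh * sqrt s" using C1 c4 S(4) s(1) by simp
      then show ?thesis by (simp add: algebra_simps)
    qed
    finally show "\<bar>s ^ i * (nderiv_on {0..1} i u0 y + nderiv_on {0..1} i u1 y + nderiv_on {0..1} i u2 y)
          - poly (smult (s ^ i) (p0 + p1 + p2)) y\<bar> \<le> 2 * C1 * (4 * \<sigma> / \<beta>) ^ (k+1) * (hh * (sqrt s + E j))"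
      by (simp add: c4_def)
  qed
qed

text \<open>Only the smooth part is approximated; the layer parts are already small between the
  transition points and stay in the error. They are kept as functions of \<open>y\<close>, so that
  their squares can be integrated later.\<close>

lemma coarse_taylor:
  assumes j: "j \<in> {1..4*M}" "\<not> fine_cell M j" and i: "i \<le> 1"
  shows "\<exists>p. degree p \<le> k \<and> (\<forall>y\<in>{x (j-1)..x j}.
    \<bar>s ^ i * (nderiv_on {0..1} i u0 y + nderiv_on {0..1} i u1 y + nderiv_on {0..1} i u2 y) - poly p y\<bar>
      \<le> C1 * 2 ^ (k+1) * (s ^ i * S + E0 y + E1 y))"
proof -
  define H where "H = x j - x (j-1)"
  have H: "0 \<le> H" "H \<le> 2 / n" using coarse_width(2)[OF j] x_less[OF j(1)] by (auto simp: H_def)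
  have HS: "H ^ Suc k \<le> 2 ^ (k+1) * S"
    using power_mono[OF H(2) H(1), of "Suc k"] by (simp add: S_def power_divide)
  have le: "x (j-1) \<le> x j" using x_less[OF j(1)] by simp
  note sub = x_cell[OF j(1)]
  have ki: "Suc k + i \<le> k + 2" using i by simp
  obtain p0 where p0: "degree p0 \<le> k"
    "\<And>y. y \<in> {x (j-1)..x j} \<Longrightarrow> \<bar>nderiv_on {0..1} i u0 y - poly p0 y\<bar> \<le> C1 * H ^ Suc k"
    unfolding H_def by (rule taylor_nderiv[OF diff(1) i le sub bound(1)[OF ki]]) (use sub in auto)
  show ?thesis
  proof (intro exI[of _ "smult (s ^ i) p0"] conjI ballI)
    show "degree (smult (s ^ i) p0) \<le> k"
      by (intro order_trans[OF degree_smult_le] p0(1))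
    fix y assume y: "y \<in> {x (j-1)..x j}"
    then have y1: "y \<in> {0..1}" using sub by blast
    have si: "0 < s ^ i" using s by simp
    have i2: "i \<le> k + 2" using i by simp
    have two: "(1::real) \<le> 2 ^ (k+1)" by (rule one_le_power) simp
    have l: "s ^ i * \<bar>nderiv_on {0..1} i u1 y\<bar> \<le> C1 * E0 y" "s ^ i * \<bar>nderiv_on {0..1} i u2 y\<bar> \<le> C1 * E1 y"
      using layer_bound[OF i2 y1] si by (simp_all add: field_simps)
    have "C1 * E0 y \<le> C1 * 2 ^ (k+1) * E0 y" "C1 * E1 y \<le> C1 * 2 ^ (k+1) * E1 y"
      using mult_right_mono[OF two, of "C1 * E0 y"] mult_right_mono[OF two, of "C1 * E1 y"] C1 E_pos(1,2)[of y]
      by (simp_all add: mult_ac)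
    note l = order_trans[OF l(1) this(1)] order_trans[OF l(2) this(2)]
    have "\<bar>nderiv_on {0..1} i u0 y - poly p0 y\<bar> \<le> C1 * (2 ^ (k+1) * S)"
      using p0(2)[OF y] mult_left_mono[OF HS, of C1] C1 by linarith
    from mult_left_mono[OF this, of "s ^ i"] 
    have sm: "s ^ i * \<bar>nderiv_on {0..1} i u0 y - poly p0 y\<bar> \<le> C1 * 2 ^ (k+1) * (s ^ i * S)"
      using si by (simp add: mult_ac)
    have "\<bar>s ^ i * (nderiv_on {0..1} i u0 y + nderiv_on {0..1} i u1 y + nderiv_on {0..1} i u2 y) - poly (smult (s ^ i) p0) y\<bar>
      = s ^ i * \<bar>(nderiv_on {0..1} i u0 y - poly p0 y) + nderiv_on {0..1} i u1 y + nderiv_on {0..1} i u2 y\<bar>"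
      using abs_mult_pos[of "s ^ i" "(nderiv_on {0..1} i u0 y - poly p0 y) + nderiv_on {0..1} i u1 y + nderiv_on {0..1} i u2 y"]
        si by (simp add: algebra_simps)
    also have "\<dots> \<le> s ^ i * (\<bar>nderiv_on {0..1} i u0 y - poly p0 y\<bar> + \<bar>nderiv_on {0..1} i u1 y\<bar> + \<bar>nderiv_on {0..1} i u2 y\<bar>)"
      by (rule mult_left_mono) (use si in linarith)+
    also have "\<dots> \<le> C1 * 2 ^ (k+1) * (s ^ i * S) + C1 * 2 ^ (k+1) * E0 y + C1 * 2 ^ (k+1) * E1 y"
      unfolding distrib_left using l sm by linarith
    finally show "\<bar>s ^ i * (nderiv_on {0..1} i u0 y + nderiv_on {0..1} i u1 y + nderiv_on {0..1} i u2 y) - poly (smult (s ^ i) p0) y\<bar>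
      \<le> C1 * 2 ^ (k+1) * (s ^ i * S + E0 y + E1 y)"
      by (simp only: distrib_left)
  qed
qed

lemma us_qs_eq:
  "s ^ 0 * (nderiv_on {0..1} 0 u0 y + nderiv_on {0..1} 0 u1 y + nderiv_on {0..1} 0 u2 y) = us y"
  "s * (s ^ 1 * (nderiv_on {0..1} 1 u0 y + nderiv_on {0..1} 1 u1 y + nderiv_on {0..1} 1 u2 y)) = qs y"
  by (simp_all add: us_def qs_def power2_eq_square)

text \<open>The first summand serves the fine cells. The second serves the coarse ones, where each
  of three terms is at most \<open>S\<close>.\<close>

definition "K1 = 2 * C1 * ((4 * \<sigma> / \<beta>) ^ (k+1) + 3 * 2 ^ (k+1))"

lemma K1: "K1 > 0" using C1 sigma_pos beta by (simp add: K1_def add_pos_pos)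

lemma fine_approx:
  assumes j: "j \<in> {1..4*M}" "fine_cell M j"
  obtains pu pq where "degree pu \<le> k" "degree pq \<le> k"
    "\<forall>y\<in>{x (j-1)..x j}. \<bar>us y - poly pu y\<bar> \<le> K1 * (hh * (sqrt s + E j))"
    "\<forall>y\<in>{x (j-1)..x j}. \<bar>qs y - poly pq y\<bar> \<le> s * (K1 * (hh * (sqrt s + E j)))"
proof -
  define B where "B = hh * (sqrt s + E j)"
  have B: "B \<ge> 0" using S(4) s(1) E_pos(3)[of j] by (simp add: B_def)
  have KB: "2 * C1 * (4 * \<sigma> / \<beta>) ^ (k+1) * B \<le> K1 * B"
    unfolding K1_def by (intro mult_right_mono mult_left_mono) (use B C1 in \<open>simp_all del: power_Suc\<close>)
  obtain pu where pu: "degree pu \<le> k" "\<forall>y\<in>{x (j-1)..x j}. \<bar>us y - poly pu y\<bar> \<le> 2 * C1 * (4 * \<sigma> / \<beta>) ^ (k+1) * B"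
    using fine_taylor[OF j, of 0] unfolding us_qs_eq B_def by auto
  obtain p where p: "degree p \<le> k" "\<forall>y\<in>{x (j-1)..x j}.
    \<bar>s ^ 1 * (nderiv_on {0..1} 1 u0 y + nderiv_on {0..1} 1 u1 y + nderiv_on {0..1} 1 u2 y) - poly p y\<bar>
      \<le> 2 * C1 * (4 * \<sigma> / \<beta>) ^ (k+1) * B"
    using fine_taylor[OF j, of 1] unfolding B_def by blast
  show ?thesis
  proof (rule that[of pu "smult s p"])
    show "degree (smult s p) \<le> k" by (intro order_trans[OF degree_smult_le] p(1))
    show "\<forall>y\<in>{x (j-1)..x j}. \<bar>us y - poly pu y\<bar> \<le> K1 * (hh * (sqrt s + E j))"
      using pu(2) KB unfolding B_def[symmetric] by (meson order_trans)
    show "\<forall>y\<in>{x (j-1)..x j}. \<bar>qs y - poly (smult s p) y\<bar> \<le> s * (K1 * (hh * (sqrt s + E j)))"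
    proof
      fix y assume y: "y \<in> {x (j-1)..x j}"
      have "\<bar>qs y - poly (smult s p) y\<bar> = s * \<bar>s ^ 1 * (nderiv_on {0..1} 1 u0 y + nderiv_on {0..1} 1 u1 y + nderiv_on {0..1} 1 u2 y) - poly p y\<bar>"
        unfolding us_qs_eq(2)[symmetric] using s(1) by (simp only: poly_smult right_diff_distrib[symmetric] abs_mult abs_of_pos)
      also have "\<dots> \<le> s * (K1 * B)"
        using p(2) y KB s(1) by (intro mult_left_mono) force+
      finally show "\<bar>qs y - poly (smult s p) y\<bar> \<le> s * (K1 * (hh * (sqrt s + E j)))" by (simp add: B_def)
    qed
  qed (rule pu(1))
qed

text \<open>There are two bounds for \<open>q\<close>: the uniform one serves the traces, the
  pointwise one the \<open>L^2\<close> estimate.\<close>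

lemma coarse_approx:
  assumes j: "j \<in> {1..4*M}" "\<not> fine_cell M j"
  obtains pu pq where "degree pu \<le> k" "degree pq \<le> k"
    "\<forall>y\<in>{x (j-1)..x j}. \<bar>us y - poly pu y\<bar> \<le> K1 * S"
    "\<forall>y\<in>{x (j-1)..x j}. \<bar>qs y - poly pq y\<bar> \<le> s * (K1 * S)"
    "\<forall>y\<in>{x (j-1)..x j}. \<bar>qs y - poly pq y\<bar> \<le> s * (K1 * (s * S + E0 y + E1 y))"
proof -
  define c where "c = C1 * 2 ^ (k+1)"
  have c: "c > 0" "3 * c \<le> K1" using C1 sigma_pos beta by (auto simp: c_def K1_def algebra_simps intro!: add_nonneg_nonneg)
  have cS: "c * (s ^ i * S + E0 y + E1 y) \<le> K1 * S" if "y \<in> {x (j-1)..x j}" for y and i :: nat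
  proof -
    have "s ^ i * S \<le> S" using s S(1) by (simp add: mult_left_le_one_le power_le_one)
    then have "s ^ i * S + E0 y + E1 y \<le> 3 * S" using coarse_layer[OF j that] by linarith
    then have "c * (s ^ i * S + E0 y + E1 y) \<le> (3 * c) * S" using c by (simp add: mult_left_mono)
    also have "\<dots> \<le> K1 * S" using c S(1) by (intro mult_right_mono) auto
    finally show ?thesis .
  qed
  obtain pu where pu: "degree pu \<le> k" "\<forall>y\<in>{x (j-1)..x j}. \<bar>us y - poly pu y\<bar> \<le> c * (s ^ 0 * S + E0 y + E1 y)"
    using coarse_taylor[OF j, of 0] unfolding us_qs_eq c_def by auto
  obtain p where p: "degree p \<le> k" "\<forall>y\<in>{x (j-1)..x j}.
    \<bar>s ^ 1 * (nderiv_on {0..1} 1 u0 y + nderiv_on {0..1} 1 u1 y + nderiv_on {0..1} 1 u2 y) - poly p y\<bar>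
      \<le> c * (s ^ 1 * S + E0 y + E1 y)"
    using coarse_taylor[OF j, of 1] unfolding c_def by blast
  have q: "\<bar>qs y - poly (smult s p) y\<bar> \<le> s * (c * (s ^ 1 * S + E0 y + E1 y))" if y: "y \<in> {x (j-1)..x j}" for y
  proof -
    have "\<bar>qs y - poly (smult s p) y\<bar> = s * \<bar>s ^ 1 * (nderiv_on {0..1} 1 u0 y + nderiv_on {0..1} 1 u1 y + nderiv_on {0..1} 1 u2 y) - poly p y\<bar>"
      unfolding us_qs_eq(2)[symmetric] using s(1) by (simp only: poly_smult right_diff_distrib[symmetric] abs_mult abs_of_pos)
    also have "\<dots> \<le> s * (c * (s ^ 1 * S + E0 y + E1 y))"
      using p(2) y s(1) by (intro mult_left_mono) auto
    finally show ?thesis .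
  qed
  show ?thesis
  proof (rule that[of pu "smult s p"])
    show "degree (smult s p) \<le> k" by (intro order_trans[OF degree_smult_le] p(1))
    show "\<forall>y\<in>{x (j-1)..x j}. \<bar>us y - poly pu y\<bar> \<le> K1 * S"
      using pu(2) cS by (meson order_trans)
    show "\<forall>y\<in>{x (j-1)..x j}. \<bar>qs y - poly (smult s p) y\<bar> \<le> s * (K1 * S)"
    proof
      fix y assume y: "y \<in> {x (j-1)..x j}"
      show "\<bar>qs y - poly (smult s p) y\<bar> \<le> s * (K1 * S)"
        using q[OF y] mult_left_mono[OF cS[OF y, of 1], of s] s(1) by linarith
    qed
    show "\<forall>y\<in>{x (j-1)..x j}. \<bar>qs y - poly (smult s p) y\<bar> \<le> s * (K1 * (s * S + E0 y + E1 y))"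
    proof
      fix y assume y: "y \<in> {x (j-1)..x j}"
      have "c * (s ^ 1 * S + E0 y + E1 y) \<le> K1 * (s * S + E0 y + E1 y)"
      proof -
        have "0 \<le> s * S + E0 y + E1 y" using s(1) S(1) E_pos(1,2)[of y] by simp
        then show ?thesis using c by (simp add: mult_right_mono)
      qed
      then show "\<bar>qs y - poly (smult s p) y\<bar> \<le> s * (K1 * (s * S + E0 y + E1 y))"
        using q[OF y] mult_left_mono[of "c * (s ^ 1 * S + E0 y + E1 y)" "K1 * (s * S + E0 y + E1 y)" s] s(1)
        by linarith
    qed
  qed (rule pu(1))
qed

end

subsection \<open>Projection errors on the Shishkin mesh\<close>

lemma sum3_square_le: "((a::real) + b + c)\<^sup>2 \<le> 3 * (a\<^sup>2 + b\<^sup>2 + c\<^sup>2)"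
proof -
  have "0 \<le> (a - b)\<^sup>2 + (b - c)\<^sup>2 + (a - c)\<^sup>2" by simp
  then show ?thesis by (simp add: power2_eq_square algebra_simps)
qed

context layer_decomposition
begin

lemma us_qs_cont: "continuous_on {0..1} us" "continuous_on {0..1} qs"
proof -
  have c: "continuous_on {0..1} (nderiv_on {0..1} i g)" if "times_differentiable_on {0..1} (k + 2) g" "i \<le> 1" for i g
    using times_differentiable_on_has_derivative[OF that(1), of i] that(2)
    by (intro DERIV_continuous_on) auto
  from c[OF diff(1)] c[OF diff(2)] c[OF diff(3)]
  have "continuous_on {0..1} (\<lambda>y. nderiv_on {0..1} i u0 y + nderiv_on {0..1} i u1 y + nderiv_on {0..1} i u2 y)" if "i \<le> 1" for i
    using that by (intro continuous_intros) auto
  from this[of 0] this[of 1] show "continuous_on {0..1} us" "continuous_on {0..1} qs"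
    unfolding us_def qs_def by (auto intro!: continuous_intros)
qed

section \<open>Sums over the fine and the coarse part\<close>

definition "fine_cells = {j\<in>{1..4*M}. fine_cell M j}"
definition "coarse_cells = {j\<in>{1..4*M}. \<not> fine_cell M j}"

lemma cells_split:
  "fine_cells = {Suc 0..M} \<union> {Suc (3*M)..4*M}" "coarse_cells = {Suc M..3*M}"
  using M by (auto simp: fine_cells_def coarse_cells_def fine_cell_def)

lemma sum_fine: "(\<Sum>j\<in>fine_cells. g j) = (\<Sum>j=Suc 0..M. g j) + (\<Sum>j=Suc (3*M)..4*M. (g j :: real))"
  unfolding cells_split(1) by (rule sum.union_disjoint) auto

lemma sum_cells: "(\<Sum>j=1..4*M. g j) = (\<Sum>j\<in>fine_cells. g j) + (\<Sum>j\<in>coarse_cells. (g j :: real))"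
proof -
  have "{1..4*M} = fine_cells \<union> coarse_cells" by (auto simp: fine_cells_def coarse_cells_def)
  then show ?thesis
    by (simp only:) (rule sum.union_disjoint, auto simp: fine_cells_def coarse_cells_def)
qed

text \<open>An upper Riemann sum for the squared layer functions. Each term is at most a constant
  times the decrease over its cell, and the sum telescopes to at most \<open>c\<close> in either
  fine part; \<open>c\<close> is of order \<open>s\<close>, uniformly in the number of
  cells.\<close>

lemma fine_layer_sum: "(\<Sum>j\<in>fine_cells. 4 * \<tau> / n * (E j)\<^sup>2) \<le> 2 * ((1 + 8 * \<sigma>) / (2 * \<beta>)) * s"
proof -
  \<comment> \<open>The decrease of the exponent of the squared layer function across one fine cell,
    that is \<open>2 * \<beta> / s\<close> times the width. It is bounded because
    \<open>h \<le> 1\<close>.\<close>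
  define z where "z = 8 * \<sigma> * h"
  have z: "0 \<le> z" "z \<le> 8 * \<sigma>" using sigma_pos h by (auto simp: z_def)
  have Hz: "4 * \<tau> / n = s / (2 * \<beta>) * z" unfolding fine_step z_def using beta by simp
  define c where "c = s / (2 * \<beta>) * (1 + 8 * \<sigma>)"
  have c: "c \<ge> 0" using s(1) beta sigma_pos by (simp add: c_def)
  have alg: "w * (q * (1 - e) * a) = w * q * (a - a * e)" for w q e a :: real
    by (simp add: algebra_simps)
  have key: "4 * \<tau> / n * a \<le> c * (a - a * exp (- z))" if "a \<ge> 0" for a
  proof -
    have "4 * \<tau> / n * a = s / (2 * \<beta>) * (z * a)" by (simp add: Hz)
    also have "\<dots> \<le> s / (2 * \<beta>) * ((1 + 8 * \<sigma>) * (1 - exp (- z)) * a)"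
      using exp_telescope_step[OF z] that s(1) beta by (intro mult_left_mono mult_right_mono) auto
    also have "\<dots> = c * (a - a * exp (- z))" unfolding c_def by (rule alg)
    finally show ?thesis .
  qed
  have sq: "(exp t)\<^sup>2 = exp (2 * t)" for t :: real by (simp add: exp_double)
  have left: "4 * \<tau> / n * (E j)\<^sup>2 \<le> - (c * (E0 (x j))\<^sup>2 - c * (E0 (x (j-1)))\<^sup>2)" if j: "j \<in> {Suc 0..M}" for j
  proof -
    have "x j = x (j-1) + s / (2 * \<beta>) * z"
      using step[of j] j Hz by (auto simp: fine_cell_def)
    then have "2 * (- \<beta> * x j / s) = 2 * (- \<beta> * x (j-1) / s) + (- z)" using s(1) beta by (simp add: field_simps)
    then have "(E0 (x j))\<^sup>2 = (E0 (x (j-1)))\<^sup>2 * exp (- z)"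
      unfolding E0_def sq by (simp only: exp_add)
    then show ?thesis using key[of "(E0 (x (j-1)))\<^sup>2"] j by (simp add: E_def algebra_simps)
  qed
  have right: "4 * \<tau> / n * (E j)\<^sup>2 \<le> c * (E1 (x j))\<^sup>2 - c * (E1 (x (j-1)))\<^sup>2" if j: "j \<in> {Suc (3*M)..4*M}" for j
  proof -
    have "x j = x (j-1) + s / (2 * \<beta>) * z"
      using step[of j] j Hz by (auto simp: fine_cell_def)
    then have "2 * (- \<beta> * (1 - x (j-1)) / s) = 2 * (- \<beta> * (1 - x j) / s) + (- z)" using s(1) beta by (simp add: field_simps)
    then have "(E1 (x (j-1)))\<^sup>2 = (E1 (x j))\<^sup>2 * exp (- z)"
      unfolding E1_def sq by (simp only: exp_add)
    then show ?thesis using key[of "(E1 (x j))\<^sup>2"] j by (simp add: E_def algebra_simps)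
  qed
  have "(\<Sum>j=Suc 0..M. 4 * \<tau> / n * (E j)\<^sup>2) \<le> (\<Sum>j=Suc 0..M. - (c * (E0 (x j))\<^sup>2 - c * (E0 (x (j-1)))\<^sup>2))"
    by (rule sum_mono) (rule left)
  also have "\<dots> = - (c * (E0 (x M))\<^sup>2 - c * (E0 (x 0))\<^sup>2)"
    unfolding sum_negf by (subst sum_telescope'') auto
  also have "\<dots> \<le> c" using c by (simp add: x_special E0_def)
  finally have L: "(\<Sum>j=Suc 0..M. 4 * \<tau> / n * (E j)\<^sup>2) \<le> c" .
  have "(\<Sum>j=Suc (3*M)..4*M. 4 * \<tau> / n * (E j)\<^sup>2) \<le> (\<Sum>j=Suc (3*M)..4*M. c * (E1 (x j))\<^sup>2 - c * (E1 (x (j-1)))\<^sup>2)"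
    by (rule sum_mono) (rule right)
  also have "\<dots> = c * (E1 (x (4*M)))\<^sup>2 - c * (E1 (x (3*M)))\<^sup>2"
    by (subst sum_telescope'') auto
  also have "\<dots> \<le> c" using c by (simp add: x_special E1_def)
  finally have R: "(\<Sum>j=Suc (3*M)..4*M. 4 * \<tau> / n * (E j)\<^sup>2) \<le> c" .
  have "2 * ((1 + 8 * \<sigma>) / (2 * \<beta>)) * s = c + c" using beta by (simp add: c_def field_simps)
  then show ?thesis using L R unfolding sum_fine by linarith
qed

definition "Cf = 3 * (1 + 2 * \<sigma> / \<beta> + (1 + 8 * \<sigma>) / \<beta>)"

lemma fine_sum:
  "(\<Sum>j\<in>fine_cells. 4 * \<tau> / n * (hh * (sqrt s + E j) + S)\<^sup>2) \<le> Cf * s * hh\<^sup>2"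
proof -
  define H where "H = 4 * \<tau> / n"
  have H: "H \<ge> 0" using tau(2) n by (simp add: H_def)
  have card: "real (card fine_cells) * H = 2 * \<tau>"
  proof -
    have "card fine_cells = 2 * M"
      unfolding cells_split(1) using M by (subst card_Un_disjoint) auto
    then show ?thesis using n by (simp add: H_def n_def)
  qed
  \<comment> \<open>The total width of the fine cells contains a factor \<open>ln n\<close>. It is
    absorbed by \<open>hh\<close>, which is \<open>S\<close> times a power of
    \<open>ln n\<close>.\<close>
  have SS: "2 * \<tau> * S\<^sup>2 \<le> 2 * \<sigma> / \<beta> * s * hh\<^sup>2"
  proof -
    have "ln n * S\<^sup>2 \<le> ((ln n) ^ (k+1))\<^sup>2 * S\<^sup>2"
    proof (rule mult_right_mono)
      have "ln n \<le> (ln n) ^ (2 * (k+1))" using ln_n by (intro self_le_power) auto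
      then show "ln n \<le> ((ln n) ^ (k+1))\<^sup>2" by (simp only: power_mult[symmetric] mult.commute)
    qed simp
    also have "\<dots> = hh\<^sup>2"
      by (simp only: hh_def h_def S_def power_mult_distrib[symmetric]) (simp add: power_mult_distrib power_divide)
    finally have "(2 * \<sigma> / \<beta> * s) * (ln n * S\<^sup>2) \<le> (2 * \<sigma> / \<beta> * s) * hh\<^sup>2"
      using sigma_pos beta s(1) by (intro mult_left_mono) auto
    then show ?thesis by (simp add: tau(1) mult_ac)
  qed
  have "(\<Sum>j\<in>fine_cells. H * (hh * (sqrt s + E j) + S)\<^sup>2)
     \<le> (\<Sum>j\<in>fine_cells. H * (3 * (hh\<^sup>2 * s + S\<^sup>2)) + 3 * hh\<^sup>2 * (H * (E j)\<^sup>2))"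
  proof (rule sum_mono)
    fix j
    have "(hh * sqrt s + hh * E j + S)\<^sup>2 \<le> 3 * ((hh * sqrt s)\<^sup>2 + (hh * E j)\<^sup>2 + S\<^sup>2)"
      by (rule sum3_square_le)
    then have "(hh * (sqrt s + E j) + S)\<^sup>2 \<le> 3 * (hh\<^sup>2 * s + hh\<^sup>2 * (E j)\<^sup>2 + S\<^sup>2)"
      using s(1) by (simp add: power_mult_distrib distrib_left)
    from mult_left_mono[OF this H]
    show "H * (hh * (sqrt s + E j) + S)\<^sup>2 \<le> H * (3 * (hh\<^sup>2 * s + S\<^sup>2)) + 3 * hh\<^sup>2 * (H * (E j)\<^sup>2)"
      by (simp add: algebra_simps)
  qed
  also have "\<dots> = 2 * \<tau> * (3 * (hh\<^sup>2 * s + S\<^sup>2)) + 3 * hh\<^sup>2 * (\<Sum>j\<in>fine_cells. H * (E j)\<^sup>2)"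
    unfolding sum.distrib sum_distrib_left[symmetric] sum_constant card[symmetric] by (simp add: algebra_simps)
  also have "\<dots> \<le> 3 * (hh\<^sup>2 * s) + 3 * (2 * \<sigma> / \<beta> * s * hh\<^sup>2) + 3 * hh\<^sup>2 * (2 * ((1 + 8 * \<sigma>) / (2 * \<beta>)) * s)"
  proof -
    have "2 * \<tau> * (hh\<^sup>2 * s) \<le> 1 * (hh\<^sup>2 * s)" using tau(3) s(1) by (intro mult_right_mono) auto
    moreover have "3 * hh\<^sup>2 * (\<Sum>j\<in>fine_cells. H * (E j)\<^sup>2) \<le> 3 * hh\<^sup>2 * (2 * ((1 + 8 * \<sigma>) / (2 * \<beta>)) * s)"
      unfolding H_def by (rule mult_left_mono[OF fine_layer_sum]) simp
    ultimately show ?thesis using SS unfolding distrib_left by linarith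
  qed
  also have "\<dots> = Cf * s * hh\<^sup>2" using beta by (simp add: Cf_def field_simps)
  finally show ?thesis by (simp add: H_def)
qed

lemma coarse_width_sum: "(\<Sum>j\<in>coarse_cells. x j - x (j-1)) \<le> 1"
proof -
  have "(\<Sum>j\<in>coarse_cells. x j - x (j-1)) = x (3*M) - x M"
    unfolding cells_split(2) by (rule sum_telescope'') simp
  then show ?thesis using x_special tau(2) by simp
qed

lemma E_square_integral:
  assumes "a \<le> c"
  shows "((\<lambda>y. (E0 y)\<^sup>2) has_integral s / (2 * \<beta>) * ((E0 a)\<^sup>2 - (E0 c)\<^sup>2)) {a..c}"
    "((\<lambda>y. (E1 y)\<^sup>2) has_integral s / (2 * \<beta>) * ((E1 c)\<^sup>2 - (E1 a)\<^sup>2)) {a..c}"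
proof -
  have d0: "((\<lambda>y. - s / (2 * \<beta>) * (E0 y)\<^sup>2) has_real_derivative (E0 y)\<^sup>2) (at y within {a..c})" for y
    unfolding E0_def using s(1) beta
    by (auto intro!: derivative_eq_intros simp: power2_eq_square field_simps)
  have d1: "((\<lambda>y. s / (2 * \<beta>) * (E1 y)\<^sup>2) has_real_derivative (E1 y)\<^sup>2) (at y within {a..c})" for y
    unfolding E1_def using s(1) beta
    by (auto intro!: derivative_eq_intros simp: power2_eq_square field_simps)
  have "((\<lambda>y. (E0 y)\<^sup>2) has_integral (- s / (2 * \<beta>) * (E0 c)\<^sup>2 - (- s / (2 * \<beta>) * (E0 a)\<^sup>2))) {a..c}"
    using d0 by (intro fundamental_theorem_of_calculus assms) (simp add: has_real_derivative_iff_has_vector_derivative)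
  then show "((\<lambda>y. (E0 y)\<^sup>2) has_integral s / (2 * \<beta>) * ((E0 a)\<^sup>2 - (E0 c)\<^sup>2)) {a..c}"
    by (simp add: algebra_simps diff_divide_distrib)
  have "((\<lambda>y. (E1 y)\<^sup>2) has_integral (s / (2 * \<beta>) * (E1 c)\<^sup>2 - (s / (2 * \<beta>) * (E1 a)\<^sup>2))) {a..c}"
    using d1 by (intro fundamental_theorem_of_calculus assms) (simp add: has_real_derivative_iff_has_vector_derivative)
  then show "((\<lambda>y. (E1 y)\<^sup>2) has_integral s / (2 * \<beta>) * ((E1 c)\<^sup>2 - (E1 a)\<^sup>2)) {a..c}"
    by (simp add: algebra_simps diff_divide_distrib)
qed

lemma E_cont: "continuous_on A E0" "continuous_on A E1"
  unfolding E0_def E1_def using s(1) by (intro continuous_intros; simp)+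

text \<open>Over the coarse part the squared layer functions integrate to at most
  \<open>s / (2 * \<beta>)\<close> times their squares at the transition points, which are bounded
  by \<open>S\<^sup>2\<close>. With the factor \<open>s\<^sup>2\<close> of \<open>q\<close> this
  yields \<open>s ^ 3\<close>, where the uniform bound would give \<open>s\<^sup>2\<close>.\<close>

lemma coarse_q_sum:
  assumes "\<And>j. j \<in> coarse_cells \<Longrightarrow> J j \<le> integral {x (j-1)..x j} (\<lambda>y. (s * (K1 * (s * S + E0 y + E1 y)))\<^sup>2)"
  shows "(\<Sum>j\<in>coarse_cells. J j) \<le> 3 * K1\<^sup>2 * (1 + 1 / \<beta>) * s ^ 3 * S\<^sup>2"
proof -
  define c where "c = 3 * s\<^sup>2 * K1\<^sup>2"
  have c: "c \<ge> 0" by (simp add: c_def)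
  have pw: "J j \<le> c * (s\<^sup>2 * S\<^sup>2) * (x j - x (j-1)) + - (c * (s / (2 * \<beta>)) * (E0 (x j))\<^sup>2 - c * (s / (2 * \<beta>)) * (E0 (x (j-1)))\<^sup>2)
     + (c * (s / (2 * \<beta>)) * (E1 (x j))\<^sup>2 - c * (s / (2 * \<beta>)) * (E1 (x (j-1)))\<^sup>2)"
    if j: "j \<in> coarse_cells" for j
  proof -
    have le: "x (j-1) \<le> x j" using x_less[of j] j by (simp add: coarse_cells_def)
    have "J j \<le> integral {x (j-1)..x j} (\<lambda>y. (s * (K1 * (s * S + E0 y + E1 y)))\<^sup>2)" by (rule assms[OF j])
    also have "\<dots> \<le> integral {x (j-1)..x j} (\<lambda>y. c * (s\<^sup>2 * S\<^sup>2) + c * (E0 y)\<^sup>2 + c * (E1 y)\<^sup>2)"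
    proof (intro integral_le integrable_continuous_real continuous_intros E_cont)
      fix y
      have "(s * (K1 * (s * S + E0 y + E1 y)))\<^sup>2 = s\<^sup>2 * K1\<^sup>2 * (s * S + E0 y + E1 y)\<^sup>2" by (simp add: power_mult_distrib)
      also have "\<dots> \<le> s\<^sup>2 * K1\<^sup>2 * (3 * ((s * S)\<^sup>2 + (E0 y)\<^sup>2 + (E1 y)\<^sup>2))"
        by (intro mult_left_mono sum3_square_le) simp
      also have "\<dots> = c * (s\<^sup>2 * S\<^sup>2) + c * (E0 y)\<^sup>2 + c * (E1 y)\<^sup>2" by (simp add: c_def power_mult_distrib algebra_simps)
      finally show "(s * (K1 * (s * S + E0 y + E1 y)))\<^sup>2 \<le> c * (s\<^sup>2 * S\<^sup>2) + c * (E0 y)\<^sup>2 + c * (E1 y)\<^sup>2" .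
    qed
    also have "\<dots> = (x j - x (j-1)) * (c * (s\<^sup>2 * S\<^sup>2)) + c * (s / (2 * \<beta>) * ((E0 (x (j-1)))\<^sup>2 - (E0 (x j))\<^sup>2))
        + c * (s / (2 * \<beta>) * ((E1 (x j))\<^sup>2 - (E1 (x (j-1)))\<^sup>2))"
      using has_integral_const_real[of "c * (s\<^sup>2 * S\<^sup>2)" "x (j-1)" "x j"] le
      by (intro integral_unique has_integral_add has_integral_mult_right E_square_integral) simp_all
    finally show ?thesis by (simp add: algebra_simps)
  qed
  have "(\<Sum>j\<in>coarse_cells. J j) \<le> (\<Sum>j\<in>coarse_cells. c * (s\<^sup>2 * S\<^sup>2) * (x j - x (j-1)) + - (c * (s / (2 * \<beta>)) * (E0 (x j))\<^sup>2 - c * (s / (2 * \<beta>)) * (E0 (x (j-1)))\<^sup>2)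
     + (c * (s / (2 * \<beta>)) * (E1 (x j))\<^sup>2 - c * (s / (2 * \<beta>)) * (E1 (x (j-1)))\<^sup>2))"
    by (rule sum_mono) (rule pw)
  also have "\<dots> = c * (s\<^sup>2 * S\<^sup>2) * (\<Sum>j\<in>coarse_cells. x j - x (j-1))
     - (c * (s / (2 * \<beta>)) * (E0 (x (3*M)))\<^sup>2 - c * (s / (2 * \<beta>)) * (E0 (x M))\<^sup>2)
     + (c * (s / (2 * \<beta>)) * (E1 (x (3*M)))\<^sup>2 - c * (s / (2 * \<beta>)) * (E1 (x M))\<^sup>2)"
    unfolding sum.distrib sum_negf sum_distrib_left[symmetric] cells_split(2)
    by (subst (2 3) sum_telescope'') auto
  also have "\<dots> \<le> c * (s\<^sup>2 * S\<^sup>2) * 1 + c * (s / (2 * \<beta>)) * S\<^sup>2 + c * (s / (2 * \<beta>)) * S\<^sup>2"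
  proof -
    have cb: "c * (s / (2 * \<beta>)) \<ge> 0" using c s(1) beta by simp
    have e: "(E0 (x M))\<^sup>2 \<le> S\<^sup>2" "(E1 (x (3*M)))\<^sup>2 \<le> S\<^sup>2"
      using E_tau E_pos(1)[of \<tau>] E_pos(2)[of "1 - \<tau>"] by (auto simp: x_special intro!: power_mono)
    have 1: "c * (s\<^sup>2 * S\<^sup>2) * (\<Sum>j\<in>coarse_cells. x j - x (j-1)) \<le> c * (s\<^sup>2 * S\<^sup>2) * 1"
      using c by (intro mult_left_mono coarse_width_sum) auto
    have 2: "0 \<le> c * (s / (2 * \<beta>)) * (E0 (x (3*M)))\<^sup>2" "0 \<le> c * (s / (2 * \<beta>)) * (E1 (x M))\<^sup>2"
      using mult_nonneg_nonneg[OF cb zero_le_power2] by blast+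
    show ?thesis using 1 2 mult_left_mono[OF e(1) cb] mult_left_mono[OF e(2) cb] by linarith
  qed
  also have "\<dots> = c * s * S\<^sup>2 * (s + 1 / \<beta>)" using beta by (simp add: field_simps power2_eq_square)
  also have "\<dots> \<le> c * s * S\<^sup>2 * (1 + 1 / \<beta>)" using s c by (intro mult_left_mono) auto
  also have "\<dots> = 3 * K1\<^sup>2 * (1 + 1 / \<beta>) * s ^ 3 * S\<^sup>2" by (simp add: c_def power2_eq_square power3_eq_cube)
  finally show ?thesis .
qed

end

section \<open>The projections on the cells of the mesh\<close>

locale shishkin_projection = layer_decomposition +
  fixes b :: "real \<Rightarrow> real" and bmin bmax KP :: real
  assumes b_cont: "continuous_on {0..1} b" and bmin: "bmin > 0"
    and b_bounds: "\<And>y. y \<in> {0..1} \<Longrightarrow> bmin \<le> b y \<and> b y \<le> bmax"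
    and KP: "KP \<ge> 1"
    and proj_b: "\<And>a c g. a < c \<Longrightarrow> {a..c} \<subseteq> {0..1} \<Longrightarrow> continuous_on {a..c} g \<Longrightarrow>
      \<exists>p. is_L2_projection b a c k KP g p"
    and proj_1: "\<And>a c g. a < c \<Longrightarrow> continuous_on {a..c} g \<Longrightarrow> \<exists>p. is_L2_projection (\<lambda>_. 1) a c k KP g p"
    and proj_r: "\<And>a c e g. a < c \<Longrightarrow> e = a \<or> e = c \<Longrightarrow> continuous_on {a..c} g \<Longrightarrow>
      \<exists>p. is_radau_projection e a c k KP g p"
begin

definition "A = KP * K1"

lemma A: "A > 0"
  using KP K1 by (auto simp: A_def)

lemma cell_cont:
  assumes "j \<in> {1..4*M}"
  shows "continuous_on {x (j-1)..x j} us" "continuous_on {x (j-1)..x j} qs" "continuous_on {x (j-1)..x j} b"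
  using us_qs_cont b_cont x_cell[OF assms] continuous_on_subset by blast+

text \<open>The projections of \<open>u\<close> and \<open>q\<close> are paired, so that a single
  choice over all cells suffices in \<open>projections\<close>.\<close>

lemma fine_projection:
  assumes j: "j \<in> {1..4*M}" "fine_cell M j"
  shows "\<exists>p. degree (fst p) \<le> k \<and> degree (snd p) \<le> k \<and>
    poly (fst p) (x j) = us (x j) \<and> poly (snd p) (x (j-1)) = qs (x (j-1)) \<and>
    (\<forall>v. degree v \<le> k - 1 \<longrightarrow> integral {x (j-1)..x j} (\<lambda>y. (us y - poly (fst p) y) * poly v y) = 0) \<and>
    (\<forall>v. degree v \<le> k - 1 \<longrightarrow> integral {x (j-1)..x j} (\<lambda>y. (qs y - poly (snd p) y) * poly v y) = 0) \<and>
    (\<forall>y\<in>{x (j-1)..x j}. \<bar>us y - poly (fst p) y\<bar> \<le> A * (hh * (sqrt s + E j))) \<and>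
    (\<forall>y\<in>{x (j-1)..x j}. \<bar>qs y - poly (snd p) y\<bar> \<le> s * (A * (hh * (sqrt s + E j))))"
proof -
  note c = cell_cont[OF j(1)] and lt = x_less[OF j(1)]
  obtain pu pq where a: "degree pu \<le> k" "degree pq \<le> k"
    "\<forall>y\<in>{x (j-1)..x j}. \<bar>us y - poly pu y\<bar> \<le> K1 * (hh * (sqrt s + E j))"
    "\<forall>y\<in>{x (j-1)..x j}. \<bar>qs y - poly pq y\<bar> \<le> s * (K1 * (hh * (sqrt s + E j)))"
    by (rule fine_approx[OF j])
  obtain Pu where Pu: "degree Pu \<le> k" "poly Pu (x j) = us (x j)"
    "\<forall>v. degree v \<le> k - 1 \<longrightarrow> integral {x (j-1)..x j} (\<lambda>y. (us y - poly Pu y) * poly v y) = 0"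
    "\<forall>y\<in>{x (j-1)..x j}. \<bar>us y - poly Pu y\<bar> \<le> KP * (K1 * (hh * (sqrt s + E j)))"
    using proj_r[OF lt _ c(1), of "x j"] a(1,3)
    unfolding is_radau_projection_def quasi_optimal_def by blast
  obtain Pq where Pq: "degree Pq \<le> k" "poly Pq (x (j-1)) = qs (x (j-1))"
    "\<forall>v. degree v \<le> k - 1 \<longrightarrow> integral {x (j-1)..x j} (\<lambda>y. (qs y - poly Pq y) * poly v y) = 0"
    "\<forall>y\<in>{x (j-1)..x j}. \<bar>qs y - poly Pq y\<bar> \<le> KP * (s * (K1 * (hh * (sqrt s + E j))))"
    using proj_r[OF lt _ c(2), of "x (j-1)"] a(2,4)
    unfolding is_radau_projection_def quasi_optimal_def by blast
  show ?thesis
    using Pu Pq by (intro exI[of _ "(Pu, Pq)"]) (simp add: A_def mult_ac)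
qed

lemma coarse_projection:
  assumes j: "j \<in> {1..4*M}" "\<not> fine_cell M j"
  shows "\<exists>p. degree (fst p) \<le> k \<and> degree (snd p) \<le> k \<and>
    (\<forall>v. degree v \<le> k \<longrightarrow> integral {x (j-1)..x j} (\<lambda>y. b y * (us y - poly (fst p) y) * poly v y) = 0) \<and>
    (\<forall>v. degree v \<le> k \<longrightarrow> integral {x (j-1)..x j} (\<lambda>y. (qs y - poly (snd p) y) * poly v y) = 0) \<and>
    (\<forall>y\<in>{x (j-1)..x j}. \<bar>us y - poly (fst p) y\<bar> \<le> A * S) \<and>
    (\<forall>y\<in>{x (j-1)..x j}. \<bar>qs y - poly (snd p) y\<bar> \<le> A * S * s) \<and>
    integral {x (j-1)..x j} (\<lambda>y. (qs y - poly (snd p) y)\<^sup>2)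
       \<le> integral {x (j-1)..x j} (\<lambda>y. (s * (K1 * (s * S + E0 y + E1 y)))\<^sup>2)"
proof -
  note c = cell_cont[OF j(1)] and lt = x_less[OF j(1)]
  obtain pu pq where a: "degree pu \<le> k" "degree pq \<le> k"
    "\<forall>y\<in>{x (j-1)..x j}. \<bar>us y - poly pu y\<bar> \<le> K1 * S"
    "\<forall>y\<in>{x (j-1)..x j}. \<bar>qs y - poly pq y\<bar> \<le> s * (K1 * S)"
    "\<forall>y\<in>{x (j-1)..x j}. \<bar>qs y - poly pq y\<bar> \<le> s * (K1 * (s * S + E0 y + E1 y))"
    by (rule coarse_approx[OF j])
  obtain Pu where Pu: "degree Pu \<le> k"
    "\<forall>v. degree v \<le> k \<longrightarrow> integral {x (j-1)..x j} (\<lambda>y. b y * (us y - poly Pu y) * poly v y) = 0"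
    "\<forall>y\<in>{x (j-1)..x j}. \<bar>us y - poly Pu y\<bar> \<le> KP * (K1 * S)"
    using proj_b[OF lt x_cell[OF j(1)] c(1)] a(1,3)
    unfolding is_L2_projection_def quasi_optimal_def by blast
  obtain Pq where Pq: "degree Pq \<le> k"
    "\<forall>v. degree v \<le> k \<longrightarrow> integral {x (j-1)..x j} (\<lambda>y. (qs y - poly Pq y) * poly v y) = 0"
    "integral {x (j-1)..x j} (\<lambda>y. (qs y - poly Pq y)\<^sup>2) \<le> integral {x (j-1)..x j} (\<lambda>y. (qs y - poly pq y)\<^sup>2)"
    "\<forall>y\<in>{x (j-1)..x j}. \<bar>qs y - poly Pq y\<bar> \<le> KP * (s * (K1 * S))"
    using proj_1[OF lt c(2)] a(2,4)
    unfolding is_L2_projection_def quasi_optimal_def mult_1 by blast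
  have "integral {x (j-1)..x j} (\<lambda>y. (qs y - poly pq y)\<^sup>2)
     \<le> integral {x (j-1)..x j} (\<lambda>y. (s * (K1 * (s * S + E0 y + E1 y)))\<^sup>2)"
  proof (intro integral_le integrable_continuous_real continuous_intros E_cont c)
    fix y assume "y \<in> {x (j-1)..x j}"
    then show "(qs y - poly pq y)\<^sup>2 \<le> (s * (K1 * (s * S + E0 y + E1 y)))\<^sup>2"
      using a(5) power_mono[of "\<bar>qs y - poly pq y\<bar>" "s * (K1 * (s * S + E0 y + E1 y))" 2] by auto
  qed
  then show ?thesis
    using Pu Pq by (intro exI[of _ "(Pu, Pq)"]) (simp add: A_def mult_ac)
qed

lemma square_integral_le:
  fixes g :: "real \<Rightarrow> real"
  assumes "a \<le> c" "continuous_on {a..c} g" "\<forall>y\<in>{a..c}. \<bar>g y\<bar> \<le> B"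
  shows "integral {a..c} (\<lambda>y. (g y)\<^sup>2) \<le> B\<^sup>2 * (c - a)"
  using assms(1)
proof (rule integral_le_const_mult)
  show "continuous_on {a..c} (\<lambda>y. (g y)\<^sup>2)" by (intro continuous_intros assms)
  fix y assume "y \<in> {a..c}"
  then show "(g y)\<^sup>2 \<le> B\<^sup>2" using assms(3) power_mono[of "\<bar>g y\<bar>" B 2] by auto
qed

text \<open>The constant shift on the left fine cells is applied after all projections have been
  chosen, since it is read off from the one on cell \<open>Suc M\<close>. Being bounded by the
  coarse error, it only adds the term \<open>S\<close> to the fine bounds.\<close>

lemma projections:
  obtains PQ PU :: "nat \<Rightarrow> real poly" and \<delta> :: real where
    "\<And>j. degree (PQ j) \<le> k" "\<And>j. degree (PU j) \<le> k"
    "\<And>j v. j \<in> {1..4*M} \<Longrightarrow> fine_cell M j \<Longrightarrow> degree v \<le> k - 1 \<Longrightarrow>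
       integral {x (j-1)..x j} (\<lambda>y. (us y - poly (PU j) y) * poly v y) = 0"
    "\<And>j. j \<in> {1..4*M} \<Longrightarrow> fine_cell M j \<Longrightarrow> poly (PU j) (x j) = us (x j)"
    "\<And>j v. j \<in> {1..4*M} \<Longrightarrow> fine_cell M j \<Longrightarrow> degree v \<le> k - 1 \<Longrightarrow>
       integral {x (j-1)..x j} (\<lambda>y. (qs y - poly (PQ j) y) * poly v y)
         = (if j \<le> M then \<delta> else 0) * integral {x (j-1)..x j} (poly v)"
    "\<And>j. j \<in> {1..4*M} \<Longrightarrow> fine_cell M j \<Longrightarrow>
       poly (PQ j) (x (j-1)) = qs (x (j-1)) - (if j \<le> M then \<delta> else 0)"
    "qs (x M) - poly (PQ (Suc M)) (x M) = \<delta>"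
    "\<And>j v. j \<in> {1..4*M} \<Longrightarrow> \<not> fine_cell M j \<Longrightarrow> degree v \<le> k \<Longrightarrow>
       integral {x (j-1)..x j} (\<lambda>y. b y * (us y - poly (PU j) y) * poly v y) = 0"
    "\<And>j v. j \<in> {1..4*M} \<Longrightarrow> \<not> fine_cell M j \<Longrightarrow> degree v \<le> k \<Longrightarrow>
       integral {x (j-1)..x j} (\<lambda>y. (qs y - poly (PQ j) y) * poly v y) = 0"
    "\<And>j y. j \<in> {1..4*M} \<Longrightarrow> \<not> fine_cell M j \<Longrightarrow> y \<in> {x (j-1)..x j} \<Longrightarrow> \<bar>us y - poly (PU j) y\<bar> \<le> A * S"
    "\<And>j y. j \<in> {1..4*M} \<Longrightarrow> \<not> fine_cell M j \<Longrightarrow> y \<in> {x (j-1)..x j} \<Longrightarrow> \<bar>qs y - poly (PQ j) y\<bar> \<le> A * S * s"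
    "\<And>j y. j \<in> {1..4*M} \<Longrightarrow> fine_cell M j \<Longrightarrow> y \<in> {x (j-1)..x j} \<Longrightarrow>
       \<bar>us y - poly (PU j) y\<bar> \<le> A * (hh * (sqrt s + E j) + S)"
    "\<And>j y. j \<in> {1..4*M} \<Longrightarrow> fine_cell M j \<Longrightarrow> y \<in> {x (j-1)..x j} \<Longrightarrow>
       \<bar>qs y - poly (PQ j) y\<bar> \<le> s * (A * (hh * (sqrt s + E j) + S))"
    "\<And>j. j \<in> coarse_cells \<Longrightarrow> integral {x (j-1)..x j} (\<lambda>y. (qs y - poly (PQ j) y)\<^sup>2)
       \<le> integral {x (j-1)..x j} (\<lambda>y. (s * (K1 * (s * S + E0 y + E1 y)))\<^sup>2)"
proof -
  \<comment> \<open>The requirements for both kinds of cells are guarded by the kind, so that one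
    choice function yields all the polynomials.\<close>
  define G where "G j p \<longleftrightarrow> degree (fst p) \<le> k \<and> degree (snd p) \<le> k \<and>
    (j \<in> {1..4*M} \<and> fine_cell M j \<longrightarrow>
      poly (fst p) (x j) = us (x j) \<and> poly (snd p) (x (j-1)) = qs (x (j-1)) \<and>
      (\<forall>v. degree v \<le> k - 1 \<longrightarrow> integral {x (j-1)..x j} (\<lambda>y. (us y - poly (fst p) y) * poly v y) = 0) \<and>
      (\<forall>v. degree v \<le> k - 1 \<longrightarrow> integral {x (j-1)..x j} (\<lambda>y. (qs y - poly (snd p) y) * poly v y) = 0) \<and>
      (\<forall>y\<in>{x (j-1)..x j}. \<bar>us y - poly (fst p) y\<bar> \<le> A * (hh * (sqrt s + E j))) \<and>
      (\<forall>y\<in>{x (j-1)..x j}. \<bar>qs y - poly (snd p) y\<bar> \<le> s * (A * (hh * (sqrt s + E j))))) \<and>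
    (j \<in> {1..4*M} \<and> \<not> fine_cell M j \<longrightarrow>
      (\<forall>v. degree v \<le> k \<longrightarrow> integral {x (j-1)..x j} (\<lambda>y. b y * (us y - poly (fst p) y) * poly v y) = 0) \<and>
      (\<forall>v. degree v \<le> k \<longrightarrow> integral {x (j-1)..x j} (\<lambda>y. (qs y - poly (snd p) y) * poly v y) = 0) \<and>
      (\<forall>y\<in>{x (j-1)..x j}. \<bar>us y - poly (fst p) y\<bar> \<le> A * S) \<and>
      (\<forall>y\<in>{x (j-1)..x j}. \<bar>qs y - poly (snd p) y\<bar> \<le> A * S * s) \<and>
      integral {x (j-1)..x j} (\<lambda>y. (qs y - poly (snd p) y)\<^sup>2)
         \<le> integral {x (j-1)..x j} (\<lambda>y. (s * (K1 * (s * S + E0 y + E1 y)))\<^sup>2))" for j p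
  have "\<exists>p. G j p" for j
  proof -
    consider "j \<in> {1..4*M} \<and> fine_cell M j" | "j \<in> {1..4*M} \<and> \<not> fine_cell M j" | "j \<notin> {1..4*M}" by blast
    then show ?thesis
    proof cases
      case 1
      then show ?thesis using fine_projection[of j] unfolding G_def by blast
    next
      case 2
      then show ?thesis using coarse_projection[of j] unfolding G_def by blast
    next
      case 3
      \<comment> \<open>Outside the index range the zero polynomials keep the degree bounds
        unconditional.\<close>
      then have "G j (0, 0)" unfolding G_def by (simp del: atLeastAtMost_iff)
      then show ?thesis ..
    qed
  qed
  then obtain P where P: "\<And>j. G j (P j)" by metis
  define PU where "PU j = fst (P j)" for j
  define GQ where "GQ j = snd (P j)" for j
  define \<delta> where "\<delta> = qs (x M) - poly (GQ (Suc M)) (x M)"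
  define d where "d j = (if j \<le> M then \<delta> else 0)" for j
  define PQ where "PQ j = GQ j - [:d j:]" for j
  have F: "degree (PU j) \<le> k" "degree (GQ j) \<le> k" for j
    using P[of j] by (auto simp: G_def PU_def GQ_def)
  have fine: "poly (PU j) (x j) = us (x j)" "poly (GQ j) (x (j-1)) = qs (x (j-1))"
      "\<And>v. degree v \<le> k - 1 \<Longrightarrow> integral {x (j-1)..x j} (\<lambda>y. (us y - poly (PU j) y) * poly v y) = 0"
      "\<And>v. degree v \<le> k - 1 \<Longrightarrow> integral {x (j-1)..x j} (\<lambda>y. (qs y - poly (GQ j) y) * poly v y) = 0"
      "\<And>y. y\<in>{x (j-1)..x j} \<Longrightarrow> \<bar>us y - poly (PU j) y\<bar> \<le> A * (hh * (sqrt s + E j))"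
      "\<And>y. y\<in>{x (j-1)..x j} \<Longrightarrow> \<bar>qs y - poly (GQ j) y\<bar> \<le> s * (A * (hh * (sqrt s + E j)))"
    if "j \<in> {1..4*M}" "fine_cell M j" for j
    using P[of j] that unfolding G_def PU_def GQ_def by blast+
  have coarse: "\<And>v. degree v \<le> k \<Longrightarrow> integral {x (j-1)..x j} (\<lambda>y. b y * (us y - poly (PU j) y) * poly v y) = 0"
      "\<And>v. degree v \<le> k \<Longrightarrow> integral {x (j-1)..x j} (\<lambda>y. (qs y - poly (GQ j) y) * poly v y) = 0"
      "\<And>y. y\<in>{x (j-1)..x j} \<Longrightarrow> \<bar>us y - poly (PU j) y\<bar> \<le> A * S"
      "\<And>y. y\<in>{x (j-1)..x j} \<Longrightarrow> \<bar>qs y - poly (GQ j) y\<bar> \<le> A * S * s"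
      "integral {x (j-1)..x j} (\<lambda>y. (qs y - poly (GQ j) y)\<^sup>2)
         \<le> integral {x (j-1)..x j} (\<lambda>y. (s * (K1 * (s * S + E0 y + E1 y)))\<^sup>2)"
    if "j \<in> {1..4*M}" "\<not> fine_cell M j" for j
    using P[of j] that unfolding G_def PU_def GQ_def by blast+
  have PQc: "PQ j = GQ j" if "\<not> fine_cell M j" for j using that by (auto simp: PQ_def d_def fine_cell_def)
  have SM: "Suc M \<in> {1..4*M}" "\<not> fine_cell M (Suc M)" using M by (auto simp: fine_cell_def)
  have "x M \<in> {x (Suc M - 1)..x (Suc M)}" using x_less[OF SM(1)] by simp
  from coarse(4)[OF SM this] have delta: "\<bar>\<delta>\<bar> \<le> A * S * s" by (simp add: \<delta>_def)
  have dj: "\<bar>d j\<bar> \<le> A * S * s" for j using delta A S s by (simp add: d_def)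
  show ?thesis
  proof (rule that[of PQ PU \<delta>])
    show "degree (PQ j) \<le> k" for j unfolding PQ_def by (intro degree_diff_le F) simp
    show "degree (PU j) \<le> k" for j by (rule F)
    show "qs (x M) - poly (PQ (Suc M)) (x M) = \<delta>" unfolding PQc[OF SM(2)] \<delta>_def ..
    fix j assume j: "j \<in> {1..4*M}"
    note c = cell_cont[OF j]
    show "poly (PU j) (x j) = us (x j)" if "fine_cell M j" using fine(1)[OF j that] .
    show "integral {x (j-1)..x j} (\<lambda>y. (us y - poly (PU j) y) * poly v y) = 0"
      if "fine_cell M j" "degree v \<le> k - 1" for v using fine(3)[OF j that] .
    show "integral {x (j-1)..x j} (\<lambda>y. (qs y - poly (PQ j) y) * poly v y)
         = (if j \<le> M then \<delta> else 0) * integral {x (j-1)..x j} (poly v)"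
      if v: "fine_cell M j" "degree v \<le> k - 1" for v
    proof -
      have "integral {x (j-1)..x j} (\<lambda>y. (qs y - poly (PQ j) y) * poly v y)
        = integral {x (j-1)..x j} (\<lambda>y. 1 * ((qs y - poly (GQ j) y) * poly v y) + d j * poly v y + 0 * 0 + 0 * 0)"
        by (rule arg_cong[where f = "integral {x (j-1)..x j}"], rule ext) (simp add: PQ_def algebra_simps)
      also have "\<dots> = d j * integral {x (j-1)..x j} (poly v)"
        by (subst integral_lincomb4) ((intro continuous_intros c)+, use fine(4)[OF j v] in simp)
      finally show ?thesis by (simp add: d_def)
    qed
    show "poly (PQ j) (x (j-1)) = qs (x (j-1)) - (if j \<le> M then \<delta> else 0)" if "fine_cell M j"
      using fine(2)[OF j that] by (simp add: PQ_def d_def)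
    show "integral {x (j-1)..x j} (\<lambda>y. b y * (us y - poly (PU j) y) * poly v y) = 0"
      if "\<not> fine_cell M j" "degree v \<le> k" for v using coarse(1)[OF j that] .
    show "integral {x (j-1)..x j} (\<lambda>y. (qs y - poly (PQ j) y) * poly v y) = 0"
      if "\<not> fine_cell M j" "degree v \<le> k" for v using coarse(2)[OF j that] unfolding PQc[OF that(1)] .
    fix y assume y: "y \<in> {x (j-1)..x j}"
    show "\<bar>us y - poly (PU j) y\<bar> \<le> A * S" if "\<not> fine_cell M j" using coarse(3)[OF j that y] .
    show "\<bar>qs y - poly (PQ j) y\<bar> \<le> A * S * s" if "\<not> fine_cell M j"
      using coarse(4)[OF j that y] unfolding PQc[OF that] .
    have AS: "A * S \<ge> 0" using A S by simp
    show "\<bar>us y - poly (PU j) y\<bar> \<le> A * (hh * (sqrt s + E j) + S)" if "fine_cell M j"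
      unfolding distrib_left[of A] using fine(5)[OF j that y] AS by linarith
    show "\<bar>qs y - poly (PQ j) y\<bar> \<le> s * (A * (hh * (sqrt s + E j) + S))" if "fine_cell M j"
    proof -
      have "\<bar>qs y - poly (PQ j) y\<bar> \<le> \<bar>qs y - poly (GQ j) y\<bar> + \<bar>d j\<bar>" by (simp add: PQ_def)
      also have "\<dots> \<le> s * (A * (hh * (sqrt s + E j))) + A * S * s"
        using fine(6)[OF j that y] dj[of j] by linarith
      also have "\<dots> = s * (A * (hh * (sqrt s + E j) + S))" by (simp add: algebra_simps)
      finally show ?thesis .
    qed
  next
    fix j assume "j \<in> coarse_cells"
    then have j: "j \<in> {1..4*M}" "\<not> fine_cell M j" by (auto simp: coarse_cells_def)
    show "integral {x (j-1)..x j} (\<lambda>y. (qs y - poly (PQ j) y)\<^sup>2)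
       \<le> integral {x (j-1)..x j} (\<lambda>y. (s * (K1 * (s * S + E0 y + E1 y)))\<^sup>2)"
      using coarse(5)[OF j] unfolding PQc[OF j(2)] .
  qed
qed

end

subsection \<open>Reduction of the scheme to polynomials on the cells\<close>

lemma Lim_right_eq:
  fixes v G :: "real \<Rightarrow> real"
  assumes "a < c" "continuous_on {a..c} G" "\<And>y. y \<in> {a<..<c} \<Longrightarrow> v y = G y"
  shows "Lim (at_right a) v = G a"
proof (rule tendsto_Lim)
  have "(G \<longlongrightarrow> G a) (at a within {a..c})" using assms(1,2) by (simp add: continuous_on_def)
  then have "(G \<longlongrightarrow> G a) (at_right a)" using at_within_Icc_at_right[OF assms(1)] by simp
  moreover have "eventually (\<lambda>y. G y = v y) (at_right a)"
    using eventually_at_right_real[OF assms(1)] by (rule eventually_mono) (simp add: assms(3))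
  ultimately show "(v \<longlongrightarrow> G a) (at_right a)" by (rule Lim_transform_eventually)
qed simp

lemma Lim_left_eq:
  fixes v G :: "real \<Rightarrow> real"
  assumes "a < c" "continuous_on {a..c} G" "\<And>y. y \<in> {a<..<c} \<Longrightarrow> v y = G y"
  shows "Lim (at_left c) v = G c"
proof (rule tendsto_Lim)
  have "(G \<longlongrightarrow> G c) (at c within {a..c})" using assms(1,2) by (simp add: continuous_on_def)
  then have "(G \<longlongrightarrow> G c) (at_left c)" using at_within_Icc_at_left[OF assms(1)] by simp
  moreover have "eventually (\<lambda>y. G y = v y) (at_left c)"
    using eventually_at_left_real[OF assms(1)] by (rule eventually_mono) (simp add: assms(3))
  ultimately show "(v \<longlongrightarrow> G c) (at_left c)" by (rule Lim_transform_eventually)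
qed simp

text \<open>The scheme integrates over open cells, since discrete functions are unconstrained at
  mesh points; the estimates use gauge integrals of continuous representatives over closed
  cells.\<close>

lemma open_interval_integral:
  fixes F G :: "real \<Rightarrow> real"
  assumes "continuous_on {a..c} G" "\<And>y. y \<in> {a<..<c} \<Longrightarrow> F y = G y"
  shows "set_integrable lborel {a<..<c} F" "(LINT y:{a<..<c}|lborel. F y) = integral {a..c} G"
proof -
  have G: "set_integrable lborel {a<..<c} G"
    by (rule set_integrable_subset[OF borel_integrable_atLeastAtMost'[OF assms(1)]]) auto
  show i: "set_integrable lborel {a<..<c} F"
    using G assms(2) by (subst set_integrable_cong[where f' = G]) auto
  have "(LINT y:{a<..<c}|lborel. F y) = (LINT y:{a<..<c}|lborel. G y)"
    by (rule set_lebesgue_integral_cong) (use assms(2) in auto)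
  also have "\<dots> = integral {a<..<c} G" by (rule set_borel_integral_eq_integral(2)[OF G])
  finally show "(LINT y:{a<..<c}|lborel. F y) = integral {a..c} G"
    by (simp add: integral_open_interval_real)
qed

text \<open>On a singleton every function agrees with a constant one, which settles the arbitrary
  values at mesh points.\<close>

lemma singleton_integral:
  fixes F :: "real \<Rightarrow> real"
  shows "set_integrable lborel {c} F" "(LINT y:{c}|lborel. F y) = 0"
proof -
  have eq: "(\<lambda>y. indicat_real {c} y *\<^sub>R F y) = (\<lambda>y. indicat_real {c} y *\<^sub>R F c)"
    by (auto simp: indicator_def)
  show "set_integrable lborel {c} F"
    unfolding set_integrable_def eq by (intro integrable_scaleR_left integrable_real_indicator) auto
  show "(LINT y:{c}|lborel. F y) = 0"
    unfolding set_lebesgue_integral_def eq by simp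
qed

text \<open>Half-open intervals are glued, so that each interior mesh point belongs to exactly one
  piece; the last end point is removed again at the end.\<close>

lemma piecewise_integral:
  fixes F :: "real \<Rightarrow> real" and G :: "nat \<Rightarrow> real \<Rightarrow> real" and x :: "nat \<Rightarrow> real"
  assumes "\<And>j. j \<in> {1..m} \<Longrightarrow> x (j-1) < x j"
    "\<And>j. j \<in> {1..m} \<Longrightarrow> continuous_on {x (j-1)..x j} (G j)"
    "\<And>j y. j \<in> {1..m} \<Longrightarrow> y \<in> {x (j-1)<..<x j} \<Longrightarrow> F y = G j y"
  shows "(LINT y:{x 0<..<x m}|lborel. F y) = (\<Sum>j=1..m. integral {x (j-1)..x j} (G j))"
proof -
  have step: "set_integrable lborel {a<..c} F \<and> (LINT y:{a<..c}|lborel. F y) = (LINT y:{a<..<c}|lborel. F y)"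
    if "a < c" "set_integrable lborel {a<..<c} F" for a c
  proof -
    have eq: "{a<..c} = {a<..<c} \<union> {c}" using that by auto
    have "{a<..<c} \<inter> {c} = {}" by simp
    from set_integral_Un[OF this that(2) singleton_integral(1)]
    have "(LINT y:{a<..<c} \<union> {c}|lborel. F y) = (LINT y:{a<..<c}|lborel. F y)"
      by (simp only: singleton_integral(2) add_0_right)
    moreover have "set_integrable lborel ({a<..<c} \<union> {c}) F"
      by (rule set_integrable_Un[OF that(2) singleton_integral(1)]) simp_all
    ultimately show ?thesis unfolding eq by (intro conjI)
  qed
  have main: "x 0 \<le> x i \<and> set_integrable lborel {x 0<..x i} F \<and>
      (LINT y:{x 0<..x i}|lborel. F y) = (\<Sum>j=1..i. integral {x (j-1)..x j} (G j))" if "i \<le> m" for i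
    using that
  proof (induction i)
    case 0
    then show ?case by (simp add: set_integrable_def set_lebesgue_integral_def)
  next
    case (Suc i)
    then have j: "Suc i \<in> {1..m}" by simp
    have lt: "x i < x (Suc i)" using assms(1)[OF j] by simp
    have G: "continuous_on {x i..x (Suc i)} (G (Suc i))" "\<And>y. y \<in> {x i<..<x (Suc i)} \<Longrightarrow> F y = G (Suc i) y"
      using assms(2)[OF j] assms(3)[OF j] by simp_all
    note oi = open_interval_integral[OF G]
    note st = step[OF lt oi(1)]
    have "i \<le> m" using Suc.prems by simp
    note IH = Suc.IH[OF this, THEN conjunct1] Suc.IH[OF this, THEN conjunct2, THEN conjunct1]
      Suc.IH[OF this, THEN conjunct2, THEN conjunct2]
    have eq: "{x 0<..x (Suc i)} = {x 0<..x i} \<union> {x i<..x (Suc i)}"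
      by (rule ivl_disj_un_two(6)[symmetric]) (use IH(1) lt in auto)
    have "set_integrable lborel {x 0<..x (Suc i)} F"
      unfolding eq by (rule set_integrable_Un[OF IH(2) st[THEN conjunct1]]) simp_all
    moreover have "(LINT y:{x 0<..x (Suc i)}|lborel. F y) = (LINT y:{x 0<..x i}|lborel. F y) + (LINT y:{x i<..x (Suc i)}|lborel. F y)"
      unfolding eq by (rule set_integral_Un[OF _ IH(2) st[THEN conjunct1]]) auto
    moreover have "(LINT y:{x i<..x (Suc i)}|lborel. F y) = integral {x i..x (Suc i)} (G (Suc i))"
      using st[THEN conjunct2] oi(2) by (rule trans)
    moreover have "(\<Sum>j=1..Suc i. integral {x (j-1)..x j} (G j))
        = (\<Sum>j=1..i. integral {x (j-1)..x j} (G j)) + integral {x i..x (Suc i)} (G (Suc i))" by simp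
    moreover have "x 0 \<le> x (Suc i)" using IH(1) lt by linarith
    ultimately show ?case using IH(3) by (intro conjI) simp_all
  qed
  show ?thesis
  proof (cases "x 0 < x m")
    case True
    have "set_integrable lborel {x 0<..<x m} F"
      by (rule set_integrable_subset[OF main[OF order_refl, THEN conjunct2, THEN conjunct1]]) auto
    from step[OF True this, THEN conjunct2, symmetric] main[OF order_refl, THEN conjunct2, THEN conjunct2]
    show ?thesis by (rule trans)
  next
    \<comment> \<open>By strict monotonicity this occurs for \<open>m = 0\<close> only, where both
      intervals are empty.\<close>
    case False
    then have e: "{x 0<..<x m} = {x 0<..x m}" using main[of m] by auto
    show ?thesis unfolding e by (rule main[OF order_refl, THEN conjunct2, THEN conjunct2])
  qed
qed

locale shishkin_ldg = shishkin_projection +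
  fixes f u Q U :: "real \<Rightarrow> real" and \<kappa> :: real
  assumes f_cont: "continuous_on {0..1} f"
    and bvp: "is_bvp_solution \<epsilon> b f u"
    and decomp: "\<forall>y\<in>{0..1}. u y = u0 y + u1 y + u2 y"
    and ldg: "is_LDG_solution k \<epsilon> b f (shishkin \<sigma> \<beta> \<epsilon> (4*M)) (4*M) Q U"
    and kappa: "\<kappa> > 0"
    and inv: "\<And>(p::real poly) a c y. degree p \<le> k \<Longrightarrow> a < c \<Longrightarrow> y \<in> {a..c} \<Longrightarrow>
       (poly p y)\<^sup>2 \<le> \<kappa> / (c - a) * integral {a..c} (\<lambda>y. (poly p y)\<^sup>2)"
    and inv': "\<And>(p::real poly) a c y. degree p \<le> k \<Longrightarrow> a < c \<Longrightarrow> y \<in> {a..c} \<Longrightarrow>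
       (poly (pderiv p) y)\<^sup>2 \<le> \<kappa> / (c - a) ^ 3 * integral {a..c} (\<lambda>y. (poly p y)\<^sup>2)"
begin

section \<open>The exact solution as a first-order system\<close>

lemma us_derivative:
  assumes "y \<in> {0..1}"
  shows "(us has_field_derivative qs y / s\<^sup>2) (at y within {0..1})"
proof -
  have "((\<lambda>y. u0 y + u1 y + u2 y) has_field_derivative
      nderiv_on {0..1} (Suc 0) u0 y + nderiv_on {0..1} (Suc 0) u1 y + nderiv_on {0..1} (Suc 0) u2 y) (at y within {0..1})"
    using times_differentiable_on_has_derivative[OF diff(1), of 0 y] times_differentiable_on_has_derivative[OF diff(2), of 0 y]
      times_differentiable_on_has_derivative[OF diff(3), of 0 y] assms by (intro DERIV_add) auto
  then show ?thesis using s(1) unfolding us_def[abs_def] qs_def by simp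
qed

lemma us_eq: "y \<in> {0..1} \<Longrightarrow> us y = u y"
  using decomp by (simp add: us_def)

lemma us_bd: "us (x 0) = 0" "us (x (4*M)) = 0"
  using bvp us_eq[of 0] us_eq[of 1] by (auto simp: is_bvp_solution_def x_special)

text \<open>\<open>u\<close> and \<open>us\<close> agree on \<open>[0, 1]\<close> alone, but this
  determines the two-sided derivative at interior points.\<close>

lemma deriv_u:
  assumes "y \<in> {0<..<1}"
  shows "s\<^sup>2 * deriv u y = qs y"
proof -
  have y: "y \<in> {0..1}" using assms by simp
  have "(us has_field_derivative qs y / s\<^sup>2) (at y)"
    using us_derivative[OF y] assms at_within_interior[of y "{0..1}"] by simp
  then have "(u has_field_derivative qs y / s\<^sup>2) (at y)"
    by (rule has_field_derivative_transform_within_open[of _ _ _ "{0<..<1}"]) (use assms us_eq in auto)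
  then show ?thesis using s(1) by (simp add: DERIV_imp_deriv)
qed

lemma qs_derivative:
  assumes "y \<in> {0<..<1}"
  shows "(qs has_field_derivative b y * us y - f y) (at y)"
proof -
  have B: "deriv u differentiable (at y)" "- \<epsilon> * deriv (deriv u) y + b y * u y = f y"
    using bvp assms by (auto simp: is_bvp_solution_def)
  have "(deriv u has_field_derivative deriv (deriv u) y) (at y)"
    using B(1) by (simp add: DERIV_deriv_iff_real_differentiable)
  then have "((\<lambda>y. s\<^sup>2 * deriv u y) has_field_derivative s\<^sup>2 * deriv (deriv u) y) (at y)"
    by (rule DERIV_cmult)
  then have "(qs has_field_derivative s\<^sup>2 * deriv (deriv u) y) (at y)"
    by (rule has_field_derivative_transform_within_open[of _ _ _ "{0<..<1}"]) (use assms deriv_u in auto)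
  moreover have "s\<^sup>2 * deriv (deriv u) y = b y * us y - f y"
    using B(2) us_eq[of y] assms by (simp add: s(3))
  ultimately show ?thesis by simp
qed

lemma exact_q:
  assumes j: "j \<in> {1..4*M}"
  shows "inverse (s\<^sup>2) * integral {x (j-1)..x j} (\<lambda>y. qs y * poly r y)
       + integral {x (j-1)..x j} (\<lambda>y. us y * poly (pderiv r) y)
     = us (x j) * poly r (x j) - us (x (j-1)) * poly r (x (j-1))"
proof -
  note c = cell_cont[OF j]
  have le: "x (j-1) \<le> x j" using x_less[OF j] by simp
  have "((\<lambda>y. qs y / s\<^sup>2 * poly r y + us y * poly (pderiv r) y) has_integral
      us (x j) * poly r (x j) - us (x (j-1)) * poly r (x (j-1))) {x (j-1)..x j}"
  proof (rule fundamental_theorem_of_calculus[OF le])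
    fix y assume y: "y \<in> {x (j-1)..x j}"
    then have "y \<in> {0..1}" using x_cell[OF j] by blast
    from DERIV_subset[OF us_derivative[OF this] x_cell[OF j]]
    have "((\<lambda>y. us y * poly r y) has_field_derivative (qs y / s\<^sup>2 * poly r y + us y * poly (pderiv r) y)) (at y within {x (j-1)..x j})"
      by (auto intro!: derivative_eq_intros poly_DERIV simp: algebra_simps)
    then show "((\<lambda>y. us y * poly r y) has_vector_derivative (qs y / s\<^sup>2 * poly r y + us y * poly (pderiv r) y)) (at y within {x (j-1)..x j})"
      by (simp add: has_real_derivative_iff_has_vector_derivative)
  qed
  then have "integral {x (j-1)..x j} (\<lambda>y. qs y / s\<^sup>2 * poly r y + us y * poly (pderiv r) y)
     = us (x j) * poly r (x j) - us (x (j-1)) * poly r (x (j-1))"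
    by (rule integral_unique)
  moreover have "integral {x (j-1)..x j} (\<lambda>y. qs y / s\<^sup>2 * poly r y + us y * poly (pderiv r) y)
     = integral {x (j-1)..x j} (\<lambda>y. inverse (s\<^sup>2) * (qs y * poly r y) + 1 * (us y * poly (pderiv r) y) + 0 * 0 + 0 * 0)"
    by (rule arg_cong[where f = "integral {x (j-1)..x j}"], rule ext) (simp add: divide_inverse)
  moreover have "\<dots> = inverse (s\<^sup>2) * integral {x (j-1)..x j} (\<lambda>y. qs y * poly r y)
       + integral {x (j-1)..x j} (\<lambda>y. us y * poly (pderiv r) y)"
    by (subst integral_lincomb4) ((intro continuous_intros c)+, simp)
  ultimately show ?thesis by simp
qed

lemma f_cell: "j \<in> {1..4*M} \<Longrightarrow> continuous_on {x (j-1)..x j} f"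
  using f_cont x_cell continuous_on_subset by blast

text \<open>The differential equation is available in the open interval only. The fundamental
  theorem is therefore used in the form that asks for a derivative inside the cell and continuity up
  to its ends, which \<open>qs\<close> has.\<close>

lemma exact_u:
  assumes j: "j \<in> {1..4*M}"
  shows "integral {x (j-1)..x j} (\<lambda>y. qs y * poly (pderiv v) y) + integral {x (j-1)..x j} (\<lambda>y. b y * us y * poly v y)
     = integral {x (j-1)..x j} (\<lambda>y. f y * poly v y) + qs (x j) * poly v (x j) - qs (x (j-1)) * poly v (x (j-1))"
proof -
  note c = cell_cont[OF j]
  have le: "x (j-1) \<le> x j" using x_less[OF j] by simp
  have "((\<lambda>y. (b y * us y - f y) * poly v y + qs y * poly (pderiv v) y) has_integral
      qs (x j) * poly v (x j) - qs (x (j-1)) * poly v (x (j-1))) {x (j-1)..x j}"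
  proof (rule fundamental_theorem_of_calculus_interior[OF le])
    show "continuous_on {x (j-1)..x j} (\<lambda>y. qs y * poly v y)" by (intro continuous_intros c)
    fix y assume y: "y \<in> {x (j-1)<..<x j}"
    then have "y \<in> {0<..<1}" using x_cell[OF j] y
      by (metis atLeastAtMost_iff atLeastatMost_subset_iff greaterThanLessThan_iff le less_le_trans le_less_trans)
    from qs_derivative[OF this]
    have "((\<lambda>y. qs y * poly v y) has_field_derivative ((b y * us y - f y) * poly v y + qs y * poly (pderiv v) y)) (at y)"
      by (auto intro!: derivative_eq_intros poly_DERIV simp: algebra_simps)
    then show "((\<lambda>y. qs y * poly v y) has_vector_derivative ((b y * us y - f y) * poly v y + qs y * poly (pderiv v) y)) (at y)"
      by (simp add: has_real_derivative_iff_has_vector_derivative)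
  qed
  then have "integral {x (j-1)..x j} (\<lambda>y. (b y * us y - f y) * poly v y + qs y * poly (pderiv v) y)
     = qs (x j) * poly v (x j) - qs (x (j-1)) * poly v (x (j-1))"
    by (rule integral_unique)
  moreover have "integral {x (j-1)..x j} (\<lambda>y. (b y * us y - f y) * poly v y + qs y * poly (pderiv v) y)
     = integral {x (j-1)..x j} (\<lambda>y. 1 * (b y * us y * poly v y) + (-1) * (f y * poly v y) + 1 * (qs y * poly (pderiv v) y) + 0 * 0)"
    by (rule arg_cong[where f = "integral {x (j-1)..x j}"], rule ext) (simp add: algebra_simps)
  moreover have "\<dots> = integral {x (j-1)..x j} (\<lambda>y. b y * us y * poly v y) - integral {x (j-1)..x j} (\<lambda>y. f y * poly v y)
       + integral {x (j-1)..x j} (\<lambda>y. qs y * poly (pderiv v) y)"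
    by (subst integral_lincomb4) ((intro continuous_intros c f_cell[OF j])+, simp)
  ultimately show ?thesis by simp
qed

section \<open>From the scheme to equations between polynomials\<close>

lemma cell_traces:
  assumes j: "j \<in> {1..4*M}" and G: "continuous_on {x (j-1)..x j} G" and eq: "\<And>y. y \<in> cell x j \<Longrightarrow> v y = G y"
  shows "trace_minus x v j = G (x j)" "trace_plus x v (j-1) = G (x (j-1))"
  unfolding trace_minus_def trace_plus_def
  using Lim_left_eq[OF x_less[OF j] G] Lim_right_eq[OF x_less[OF j] G] eq by (auto simp: cell_def)

lemma cell_inner:
  assumes j: "j \<in> {1..4*M}" and "continuous_on {x (j-1)..x j} G" "continuous_on {x (j-1)..x j} G'"
    and "\<And>y. y \<in> cell x j \<Longrightarrow> g y = G y" "\<And>y. y \<in> cell x j \<Longrightarrow> g' y = G' y"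
  shows "inner_on (cell x j) g g' = integral {x (j-1)..x j} (\<lambda>y. G y * G' y)"
  unfolding inner_on_def cell_def
  by (rule open_interval_integral(2)) (use assms in \<open>auto simp: cell_def intro!: continuous_on_mult\<close>)

lemma discrete_solution:
  obtains QP UP :: "nat \<Rightarrow> real poly" where "\<And>j. degree (QP j) \<le> k" "\<And>j. degree (UP j) \<le> k"
    "\<And>j y. j \<in> {1..4*M} \<Longrightarrow> y \<in> cell x j \<Longrightarrow> Q y = poly (QP j) y"
    "\<And>j y. j \<in> {1..4*M} \<Longrightarrow> y \<in> cell x j \<Longrightarrow> U y = poly (UP j) y"
proof -
  have fe: "Q \<in> fe_space k x (4*M)" "U \<in> fe_space k x (4*M)"
    using ldg by (auto simp: is_LDG_solution_def x_def)
  have ex: "\<exists>P. \<forall>j. degree (P j) \<le> k \<and> (j \<in> {1..4*M} \<longrightarrow> (\<forall>y\<in>cell x j. v y = poly (P j) y))"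
    if "v \<in> fe_space k x (4*M)" for v
  proof -
    have "\<exists>p. degree p \<le> k \<and> (j \<in> {1..4*M} \<longrightarrow> (\<forall>y\<in>cell x j. v y = poly p y))" for j
    proof (cases "j \<in> {1..4*M}")
      case True
      then show ?thesis using that unfolding fe_space_def by blast
    next
      case False
      then show ?thesis by (intro exI[of _ 0]) (simp del: atLeastAtMost_iff)
    qed
    then show ?thesis by metis
  qed
  show ?thesis using ex[OF fe(1)] ex[OF fe(2)] that by blast
qed

context
  fixes QP UP :: "nat \<Rightarrow> real poly"
  assumes deg: "\<And>j. degree (QP j) \<le> k" "\<And>j. degree (UP j) \<le> k"
    and on_cell: "\<And>j y. j \<in> {1..4*M} \<Longrightarrow> y \<in> cell x j \<Longrightarrow> Q y = poly (QP j) y"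
      "\<And>j y. j \<in> {1..4*M} \<Longrightarrow> y \<in> cell x j \<Longrightarrow> U y = poly (UP j) y"
begin

lemma solution_traces:
  "j \<in> {1..4*M} \<Longrightarrow> trace_minus x Q j = poly (QP j) (x j)"
  "j \<in> {1..4*M} \<Longrightarrow> trace_minus x U j = poly (UP j) (x j)"
  "j < 4*M \<Longrightarrow> trace_plus x Q j = poly (QP (Suc j)) (x j)"
  "j < 4*M \<Longrightarrow> trace_plus x U j = poly (UP (Suc j)) (x j)"
  using cell_traces[OF _ continuous_on_poly_real on_cell(1), of j] cell_traces[OF _ continuous_on_poly_real on_cell(2), of j]
    cell_traces[OF _ continuous_on_poly_real on_cell(1), of "Suc j"] cell_traces[OF _ continuous_on_poly_real on_cell(2), of "Suc j"]
  by auto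

lemma solution_fluxes:
  assumes "j \<le> 4*M"
  shows "flux_Q \<epsilon> x (4*M) Q U j = polyflux_Q s M x QP UP j"
    "flux_U \<epsilon> x (4*M) Q U j = polyflux_U s M x QP UP j"
  using assms M by (auto simp: flux_Q_def flux_U_def polyflux_Q_def polyflux_U_def lam_bd_def lam_q_def jump_def
      s_def[symmetric] solution_traces)

lemma poly_fe_space: "degree p \<le> k \<Longrightarrow> poly p \<in> fe_space k x (4*M)"
  by (auto simp: fe_space_def)

lemma deriv_poly: "deriv (poly p) y = poly (pderiv p) (y::real)"
  by (rule DERIV_imp_deriv) (rule poly_DERIV)

lemma discrete_equations:
  assumes j: "j \<in> {1..4*M}" and r: "degree r \<le> k"
  shows "inverse (s\<^sup>2) * integral {x (j-1)..x j} (\<lambda>y. poly (QP j) y * poly r y)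
       + integral {x (j-1)..x j} (\<lambda>y. poly (UP j) y * poly (pderiv r) y)
     = polyflux_U s M x QP UP j * poly r (x j) - polyflux_U s M x QP UP (j-1) * poly r (x (j-1))"
    "integral {x (j-1)..x j} (\<lambda>y. poly (QP j) y * poly (pderiv r) y)
       + integral {x (j-1)..x j} (\<lambda>y. b y * poly (UP j) y * poly r y)
     = integral {x (j-1)..x j} (\<lambda>y. f y * poly r y)
       + polyflux_Q s M x QP UP j * poly r (x j) - polyflux_Q s M x QP UP (j-1) * poly r (x (j-1))"
proof -
  note c = cell_cont[OF j]
  have j': "j \<le> 4*M" "j - 1 \<le> 4*M" using j by auto
  have tr: "trace_minus x (poly r) j = poly r (x j)" "trace_plus x (poly r) (j-1) = poly r (x (j-1))"
    using cell_traces[OF j continuous_on_poly_real, of "poly r" r] by auto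
  have i: "inner_on (cell x j) Q (poly r) = integral {x (j-1)..x j} (\<lambda>y. poly (QP j) y * poly r y)"
    "inner_on (cell x j) U (deriv (poly r)) = integral {x (j-1)..x j} (\<lambda>y. poly (UP j) y * poly (pderiv r) y)"
    "inner_on (cell x j) Q (deriv (poly r)) = integral {x (j-1)..x j} (\<lambda>y. poly (QP j) y * poly (pderiv r) y)"
    "inner_on (cell x j) (\<lambda>y. b y * U y) (poly r) = integral {x (j-1)..x j} (\<lambda>y. b y * poly (UP j) y * poly r y)"
    "inner_on (cell x j) f (poly r) = integral {x (j-1)..x j} (\<lambda>y. f y * poly r y)"
    by (rule cell_inner[OF j]; (intro continuous_intros c f_cell[OF j])?; use on_cell j deriv_poly in auto)+
  have L: "inverse \<epsilon> * inner_on (cell x j) Q (poly r) + inner_on (cell x j) U (deriv (poly r))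
          - flux_U \<epsilon> x (4*M) Q U j * trace_minus x (poly r) j
          + flux_U \<epsilon> x (4*M) Q U (j - 1) * trace_plus x (poly r) (j - 1) = 0"
    "inner_on (cell x j) Q (deriv (poly r)) + inner_on (cell x j) (\<lambda>y. b y * U y) (poly r)
          - flux_Q \<epsilon> x (4*M) Q U j * trace_minus x (poly r) j
          + flux_Q \<epsilon> x (4*M) Q U (j - 1) * trace_plus x (poly r) (j - 1) = inner_on (cell x j) f (poly r)"
    using ldg j poly_fe_space[OF r] unfolding is_LDG_solution_def x_def[symmetric] by blast+
  show "inverse (s\<^sup>2) * integral {x (j-1)..x j} (\<lambda>y. poly (QP j) y * poly r y)
       + integral {x (j-1)..x j} (\<lambda>y. poly (UP j) y * poly (pderiv r) y)
     = polyflux_U s M x QP UP j * poly r (x j) - polyflux_U s M x QP UP (j-1) * poly r (x (j-1))"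
    using L(1) unfolding i tr solution_fluxes[OF j'(1)] solution_fluxes[OF j'(2)] s(3) by linarith
  show "integral {x (j-1)..x j} (\<lambda>y. poly (QP j) y * poly (pderiv r) y)
       + integral {x (j-1)..x j} (\<lambda>y. b y * poly (UP j) y * poly r y)
     = integral {x (j-1)..x j} (\<lambda>y. f y * poly r y)
       + polyflux_Q s M x QP UP j * poly r (x j) - polyflux_Q s M x QP UP (j-1) * poly r (x (j-1))"
    using L(2) unfolding i tr solution_fluxes[OF j'(1)] solution_fluxes[OF j'(2)] by linarith
qed

text \<open>The exact solution satisfies the cell equations with its nodal values as fluxes;
  subtracting the scheme gives what \<open>ldg_error\<close> assumes.\<close>

lemma error_equations:
  assumes j: "j \<in> {1..4*M}" and r: "degree r \<le> k"
  shows "inverse (s\<^sup>2) * integral {x (j-1)..x j} (\<lambda>y. (qs y - poly (QP j) y) * poly r y)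
       + integral {x (j-1)..x j} (\<lambda>y. (us y - poly (UP j) y) * poly (pderiv r) y)
       - (us (x j) - polyflux_U s M x QP UP j) * poly r (x j)
       + (us (x (j-1)) - polyflux_U s M x QP UP (j-1)) * poly r (x (j-1)) = 0"
    "integral {x (j-1)..x j} (\<lambda>y. (qs y - poly (QP j) y) * poly (pderiv r) y)
       + integral {x (j-1)..x j} (\<lambda>y. b y * (us y - poly (UP j) y) * poly r y)
       - (qs (x j) - polyflux_Q s M x QP UP j) * poly r (x j)
       + (qs (x (j-1)) - polyflux_Q s M x QP UP (j-1)) * poly r (x (j-1)) = 0"
proof -
  note c = cell_cont[OF j]
  have i1: "integral {x (j-1)..x j} (\<lambda>y. (g y - poly p y) * poly t y)
      = integral {x (j-1)..x j} (\<lambda>y. g y * poly t y) - integral {x (j-1)..x j} (\<lambda>y. poly p y * poly t y)"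
    if "continuous_on {x (j-1)..x j} g" for g p t
  proof -
    have "integral {x (j-1)..x j} (\<lambda>y. (g y - poly p y) * poly t y)
      = integral {x (j-1)..x j} (\<lambda>y. g y * poly t y - poly p y * poly t y)" by (simp add: left_diff_distrib)
    also have "\<dots> = integral {x (j-1)..x j} (\<lambda>y. g y * poly t y) - integral {x (j-1)..x j} (\<lambda>y. poly p y * poly t y)"
      by (rule integral_diff) (intro integrable_continuous_real continuous_intros that)+
    finally show ?thesis .
  qed
  have "integral {x (j-1)..x j} (\<lambda>y. b y * (us y - poly (UP j) y) * poly r y)
     = integral {x (j-1)..x j} (\<lambda>y. b y * us y * poly r y - b y * poly (UP j) y * poly r y)"
    by (simp add: left_diff_distrib right_diff_distrib)
  also have "\<dots> = integral {x (j-1)..x j} (\<lambda>y. b y * us y * poly r y) - integral {x (j-1)..x j} (\<lambda>y. b y * poly (UP j) y * poly r y)"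
    by (rule integral_diff) (intro integrable_continuous_real continuous_intros c)+
  finally have i2: "integral {x (j-1)..x j} (\<lambda>y. b y * (us y - poly (UP j) y) * poly r y)
    = integral {x (j-1)..x j} (\<lambda>y. b y * us y * poly r y) - integral {x (j-1)..x j} (\<lambda>y. b y * poly (UP j) y * poly r y)" .
  show "inverse (s\<^sup>2) * integral {x (j-1)..x j} (\<lambda>y. (qs y - poly (QP j) y) * poly r y)
       + integral {x (j-1)..x j} (\<lambda>y. (us y - poly (UP j) y) * poly (pderiv r) y)
       - (us (x j) - polyflux_U s M x QP UP j) * poly r (x j)
       + (us (x (j-1)) - polyflux_U s M x QP UP (j-1)) * poly r (x (j-1)) = 0"
    using exact_q[OF j, of r] discrete_equations(1)[OF j r]
    unfolding i1[OF c(1)] i1[OF c(2)] by (simp only: right_diff_distrib left_diff_distrib)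
  show "integral {x (j-1)..x j} (\<lambda>y. (qs y - poly (QP j) y) * poly (pderiv r) y)
       + integral {x (j-1)..x j} (\<lambda>y. b y * (us y - poly (UP j) y) * poly r y)
       - (qs (x j) - polyflux_Q s M x QP UP j) * poly r (x j)
       + (qs (x (j-1)) - polyflux_Q s M x QP UP (j-1)) * poly r (x (j-1)) = 0"
    using exact_u[OF j, of r] discrete_equations(2)[OF j r]
    unfolding i1[OF c(2)] i2 by (simp only: right_diff_distrib left_diff_distrib)
qed

end

end

subsection \<open>Error bounds in the two norms\<close>

lemma square_sum_le: "((a::real) + b)\<^sup>2 \<le> 2 * a\<^sup>2 + 2 * b\<^sup>2"
  using sum_squares_bound[of a b] by (simp add: power2_sum)

lemma integral_square_split:
  fixes w g :: "real \<Rightarrow> real"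
  assumes "continuous_on {a..c} w" "continuous_on {a..c} g" "\<forall>y\<in>{a..c}. w y \<ge> 0"
  shows "integral {a..c} (\<lambda>y. w y * (g y - poly P' y)\<^sup>2)
    \<le> 2 * integral {a..c} (\<lambda>y. w y * (g y - poly P y)\<^sup>2) + 2 * integral {a..c} (\<lambda>y. w y * (poly (P - P') y)\<^sup>2)"
proof -
  have "integral {a..c} (\<lambda>y. w y * (g y - poly P' y)\<^sup>2)
    \<le> integral {a..c} (\<lambda>y. 2 * (w y * (g y - poly P y)\<^sup>2) + 2 * (w y * (poly (P - P') y)\<^sup>2) + 0 * 0 + 0 * 0)"
  proof (intro integral_le integrable_continuous_real continuous_intros assms)
    fix y assume y: "y \<in> {a..c}"
    have "(g y - poly P' y)\<^sup>2 \<le> 2 * (g y - poly P y)\<^sup>2 + 2 * (poly (P - P') y)\<^sup>2"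
      using square_sum_le[of "g y - poly P y" "poly (P - P') y"] by simp
    from mult_left_mono[OF this, of "w y"] assms(3) y
    show "w y * (g y - poly P' y)\<^sup>2 \<le> 2 * (w y * (g y - poly P y)\<^sup>2) + 2 * (w y * (poly (P - P') y)\<^sup>2) + 0 * 0 + 0 * 0"
      by (simp add: algebra_simps)
  qed
  also have "\<dots> = 2 * integral {a..c} (\<lambda>y. w y * (g y - poly P y)\<^sup>2) + 2 * integral {a..c} (\<lambda>y. w y * (poly (P - P') y)\<^sup>2)"
    by (subst integral_lincomb4) ((intro continuous_intros assms)+, simp)
  finally show ?thesis .
qed

context shishkin_ldg
begin

text \<open>These are the numbers from \<open>energy_bound\<close> with \<open>K = 3 * A\<close>:
  \<open>54 = 18 + 36\<close> collects the boundary terms and the interface, and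
  \<open>9 = 3\<^sup>2\<close>. \<open>CE\<close> combines projection errors and discrete error
  after squares of sums have been split; some of its coefficients are generous.\<close>

definition "CX = 2 * ((1 + bmax) * A\<^sup>2 * Cf + 54 * A\<^sup>2 + 9 * \<kappa> * A\<^sup>2 * (29 + 4 / bmin))"
definition "CQ = A\<^sup>2 * Cf + 3 * K1\<^sup>2 * (1 + 1 / \<beta>)"
definition "CE = 2 * CQ + 2 * bmax * A\<^sup>2 * (Cf + 1) + 36 * A\<^sup>2 + 8 * CX"

definition "eq y = \<epsilon> * deriv u y - Q y"
definition "eu y = u y - U y"

lemma bmax: "bmax > 0" using b_bounds[of 0] bmin by simp

lemma b_nonneg: "j \<in> {1..4*M} \<Longrightarrow> \<forall>y\<in>{x (j-1)..x j}. b y \<ge> 0"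
  using b_bounds bmin x_cell by (meson less_imp_le order_trans subsetD)

lemma Cf: "Cf > 0" using sigma_pos beta by (simp add: Cf_def add_pos_pos)

text \<open>The outcome of \<open>ldg_projection\<close> for the concrete projections, stated
  without that locale, so that both norms can be estimated from it.\<close>

lemma discrete_error_bound:
  obtains QP UP PQ PU :: "nat \<Rightarrow> real poly" where
    "\<And>j y. j \<in> {1..4*M} \<Longrightarrow> y \<in> cell x j \<Longrightarrow> Q y = poly (QP j) y"
    "\<And>j y. j \<in> {1..4*M} \<Longrightarrow> y \<in> cell x j \<Longrightarrow> U y = poly (UP j) y"
    "(\<Sum>j=1..4*M. inverse (s\<^sup>2) * integral {x (j-1)..x j} (\<lambda>y. (poly (PQ j - QP j) y)\<^sup>2)
        + integral {x (j-1)..x j} (\<lambda>y. b y * (poly (PU j - UP j) y)\<^sup>2))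
      + s * (poly (PU 1 - UP 1) (x 0))\<^sup>2 + s * (poly (PU (4*M) - UP (4*M)) (x (4*M)))\<^sup>2
      + (1 / s) * (poly (PQ (Suc (3*M)) - QP (Suc (3*M))) (x (3*M)) - poly (PQ (3*M) - QP (3*M)) (x (3*M)))\<^sup>2
     \<le> CX * (s * hh\<^sup>2 + s\<^sup>2 * (n * S)\<^sup>2)"
    "(\<Sum>j=1..4*M. integral {x (j-1)..x j} (\<lambda>y. (qs y - poly (PQ j) y)\<^sup>2)) \<le> CQ * s ^ 3 * hh\<^sup>2"
    "(\<Sum>j=1..4*M. integral {x (j-1)..x j} (\<lambda>y. b y * (us y - poly (PU j) y)\<^sup>2)) \<le> bmax * A\<^sup>2 * (Cf * s * hh\<^sup>2 + S\<^sup>2)"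
    "\<bar>us (x 0) - poly (PU 1) (x 0)\<bar> \<le> 3 * A * hh" "poly (PU (4*M)) (x (4*M)) = us (x (4*M))"
    "poly (PQ (Suc (3*M))) (x (3*M)) = qs (x (3*M))"
    "\<bar>qs (x (3*M)) - poly (PQ (3*M)) (x (3*M))\<bar> \<le> 3 * A * S * s"
proof -
  obtain QP UP :: "nat \<Rightarrow> real poly" where d: "\<And>j. degree (QP j) \<le> k" "\<And>j. degree (UP j) \<le> k"
    and on_cell: "\<And>j y. j \<in> {1..4*M} \<Longrightarrow> y \<in> cell x j \<Longrightarrow> Q y = poly (QP j) y"
      "\<And>j y. j \<in> {1..4*M} \<Longrightarrow> y \<in> cell x j \<Longrightarrow> U y = poly (UP j) y"
    by (fact discrete_solution)
  obtain PQ PU :: "nat \<Rightarrow> real poly" and \<delta> :: real where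
    pd: "\<And>j. degree (PQ j) \<le> k" "\<And>j. degree (PU j) \<le> k" and
    fu: "\<And>j v. j \<in> {1..4*M} \<Longrightarrow> fine_cell M j \<Longrightarrow> degree v \<le> k - 1 \<Longrightarrow>
       integral {x (j-1)..x j} (\<lambda>y. (us y - poly (PU j) y) * poly v y) = 0" and
    fue: "\<And>j. j \<in> {1..4*M} \<Longrightarrow> fine_cell M j \<Longrightarrow> poly (PU j) (x j) = us (x j)" and
    fq: "\<And>j v. j \<in> {1..4*M} \<Longrightarrow> fine_cell M j \<Longrightarrow> degree v \<le> k - 1 \<Longrightarrow>
       integral {x (j-1)..x j} (\<lambda>y. (qs y - poly (PQ j) y) * poly v y)
         = (if j \<le> M then \<delta> else 0) * integral {x (j-1)..x j} (poly v)" and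
    fqe: "\<And>j. j \<in> {1..4*M} \<Longrightarrow> fine_cell M j \<Longrightarrow>
       poly (PQ j) (x (j-1)) = qs (x (j-1)) - (if j \<le> M then \<delta> else 0)" and
    sh: "qs (x M) - poly (PQ (Suc M)) (x M) = \<delta>" and
    cu: "\<And>j v. j \<in> {1..4*M} \<Longrightarrow> \<not> fine_cell M j \<Longrightarrow> degree v \<le> k \<Longrightarrow>
       integral {x (j-1)..x j} (\<lambda>y. b y * (us y - poly (PU j) y) * poly v y) = 0" and
    cq: "\<And>j v. j \<in> {1..4*M} \<Longrightarrow> \<not> fine_cell M j \<Longrightarrow> degree v \<le> k \<Longrightarrow>
       integral {x (j-1)..x j} (\<lambda>y. (qs y - poly (PQ j) y) * poly v y) = 0" and
    cub: "\<And>j y. j \<in> {1..4*M} \<Longrightarrow> \<not> fine_cell M j \<Longrightarrow> y \<in> {x (j-1)..x j} \<Longrightarrow> \<bar>us y - poly (PU j) y\<bar> \<le> A * S" and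
    cqb: "\<And>j y. j \<in> {1..4*M} \<Longrightarrow> \<not> fine_cell M j \<Longrightarrow> y \<in> {x (j-1)..x j} \<Longrightarrow> \<bar>qs y - poly (PQ j) y\<bar> \<le> A * S * s" and
    fub: "\<And>j y. j \<in> {1..4*M} \<Longrightarrow> fine_cell M j \<Longrightarrow> y \<in> {x (j-1)..x j} \<Longrightarrow>
       \<bar>us y - poly (PU j) y\<bar> \<le> A * (hh * (sqrt s + E j) + S)" and
    fqb: "\<And>j y. j \<in> {1..4*M} \<Longrightarrow> fine_cell M j \<Longrightarrow> y \<in> {x (j-1)..x j} \<Longrightarrow>
       \<bar>qs y - poly (PQ j) y\<bar> \<le> s * (A * (hh * (sqrt s + E j) + S))" and
    cqi: "\<And>j. j \<in> coarse_cells \<Longrightarrow> integral {x (j-1)..x j} (\<lambda>y. (qs y - poly (PQ j) y)\<^sup>2)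
       \<le> integral {x (j-1)..x j} (\<lambda>y. (s * (K1 * (s * S + E0 y + E1 y)))\<^sup>2)"
    by (fact projections)
  \<comment> \<open>The coarse bounds hold with \<open>A\<close> already; they are weakened to share
    the constant \<open>3 * A\<close> of the boundary traces.\<close>
  have AS: "A * S \<le> 3 * A * S" using A S(1) by simp
  \<comment> \<open>The factor 3 arises because \<open>sqrt s\<close> and \<open>E j\<close> are at
    most 1 each and \<open>S \<le> hh\<close>.\<close>
  have fine3: "A * (hh * (sqrt s + E j) + S) \<le> 3 * A * hh" if "j \<in> {1..4*M}" for j
  proof -
    have "sqrt s + E j \<le> 2" using E_le_1[OF that] s real_sqrt_le_1_iff[of s] by linarith
    then have "hh * (sqrt s + E j) \<le> hh * 2" using S(4) by (intro mult_left_mono) auto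
    then have "A * (hh * (sqrt s + E j) + S) \<le> A * (3 * hh)" using S(2) A by (intro mult_left_mono) auto
    then show ?thesis by (simp add: mult_ac)
  qed
  have N1: "1 \<in> {1..4*M}" "fine_cell M 1" "4*M \<in> {1..4*M}" "fine_cell M (4*M)" using M by (auto simp: fine_cell_def)
  have e1: "\<bar>us (x 0) - poly (PU 1) (x 0)\<bar> \<le> 3 * A * hh"
    using fub[OF N1(1,2), of "x 0"] x_less[OF N1(1)] fine3[OF N1(1)] by simp
  have e2: "\<bar>qs (x (4*M)) - poly (PQ (4*M)) (x (4*M))\<bar> \<le> 3 * A * hh * s"
  proof -
    have "x (4*M) \<in> {x (4*M-1)..x (4*M)}" using x_less[OF N1(3)] by simp
    then have "\<bar>qs (x (4*M)) - poly (PQ (4*M)) (x (4*M))\<bar> \<le> s * (3 * A * hh)"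
      by (rule order_trans[OF fqb[OF N1(3,4)] mult_left_mono[OF fine3[OF N1(3)]]]) (use s in simp)
    then show ?thesis by (simp add: mult_ac)
  qed
  have eqs: "inverse (s\<^sup>2) * integral {x (j-1)..x j} (\<lambda>y. (qs y - poly (QP j) y) * poly r y)
       + integral {x (j-1)..x j} (\<lambda>y. (us y - poly (UP j) y) * poly (pderiv r) y)
       - (us (x j) - polyflux_U s M x QP UP j) * poly r (x j)
       + (us (x (j-1)) - polyflux_U s M x QP UP (j-1)) * poly r (x (j-1)) = 0"
    "integral {x (j-1)..x j} (\<lambda>y. (qs y - poly (QP j) y) * poly (pderiv r) y)
       + integral {x (j-1)..x j} (\<lambda>y. b y * (us y - poly (UP j) y) * poly r y)
       - (qs (x j) - polyflux_Q s M x QP UP j) * poly r (x j)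
       + (qs (x (j-1)) - polyflux_Q s M x QP UP (j-1)) * poly r (x (j-1)) = 0"
    if "j \<in> {1..4*M}" "degree r \<le> k" for j r
    by (rule error_equations[of QP UP j r, OF d on_cell that]; assumption)+
  have nn: "3 * A \<ge> 0" "S \<ge> 0" "hh \<ge> 0" using A S by simp_all
  have bl: "b y \<ge> bmin" if "y \<in> {0..1}" for y using b_bounds[OF that] by simp
  have cw: "x j - x (j-1) \<ge> 1 / real (4*M)" if "j \<in> {1..4*M}" "\<not> fine_cell M j" for j
    using coarse_width(1)[OF that] by (simp add: n_def)
  have cub3: "\<bar>us y - poly (PU j) y\<bar> \<le> 3 * A * S"
    if "j \<in> {1..4*M}" "\<not> fine_cell M j" "y \<in> {x (j-1)..x j}" for j y
    using cub[OF that] AS by linarith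
  have cqb3: "\<bar>qs y - poly (PQ j) y\<bar> \<le> 3 * A * S * s"
    if "j \<in> {1..4*M}" "\<not> fine_cell M j" "y \<in> {x (j-1)..x j}" for j y
    using cqb[OF that] mult_right_mono[OF AS, of s] s(1) by linarith
  interpret P: ldg_projection k M x s b us qs QP UP PQ PU "3 * A" S hh \<kappa> bmin \<delta>
    by (intro ldg_projection.intro ldg_error.intro ldg_projection_axioms.intro;
        fact M s(1) x_less x_cell b_cont us_qs_cont d pd eqs nn kappa bmin bl inv inv' cw fu fue fq fqe sh
          cu cq cub3 cqb3 e1 e2 us_bd)
  define X where "X j = 4 * \<tau> / n * (hh * (sqrt s + E j) + S)\<^sup>2" for j
  have sumX: "(\<Sum>j\<in>fine_cells. X j) \<le> Cf * s * hh\<^sup>2" unfolding X_def by (rule fine_sum)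
  have wint: "integral {x (j-1)..x j} (\<lambda>y. b y * (us y - poly (PU j) y)\<^sup>2) \<le> bmax * B\<^sup>2 * (x j - x (j-1))"
    if j: "j \<in> {1..4*M}" and B: "\<And>y. y \<in> {x (j-1)..x j} \<Longrightarrow> \<bar>us y - poly (PU j) y\<bar> \<le> B" for j B
  proof (rule integral_le_const_mult)
    show "x (j-1) \<le> x j" using x_less[OF j] by simp
    show "continuous_on {x (j-1)..x j} (\<lambda>y. b y * (us y - poly (PU j) y)\<^sup>2)"
      by (intro continuous_intros cell_cont[OF j])
    fix y assume y: "y \<in> {x (j-1)..x j}"
    have "(us y - poly (PU j) y)\<^sup>2 \<le> B\<^sup>2" using power_mono[OF B[OF y], of 2] by simp
    moreover have "b y \<le> bmax" using b_bounds x_cell[OF j] y by blast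
    ultimately show "b y * (us y - poly (PU j) y)\<^sup>2 \<le> bmax * B\<^sup>2" using bmax by (intro mult_mono) auto
  qed
  have fineu: "integral {x (j-1)..x j} (\<lambda>y. b y * (us y - poly (PU j) y)\<^sup>2) \<le> bmax * A\<^sup>2 * X j"
    and fineq: "integral {x (j-1)..x j} (\<lambda>y. (qs y - poly (PQ j) y)\<^sup>2) \<le> s\<^sup>2 * A\<^sup>2 * X j"
    if "j \<in> fine_cells" for j
  proof -
    have j: "j \<in> {1..4*M}" "fine_cell M j" using that by (auto simp: fine_cells_def)
    have w: "x j - x (j-1) = 4 * \<tau> / n" using step[OF j(1)] j(2) by simp
    show "integral {x (j-1)..x j} (\<lambda>y. b y * (us y - poly (PU j) y)\<^sup>2) \<le> bmax * A\<^sup>2 * X j"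
      using wint[OF j(1) fub[OF j]] unfolding w X_def by (simp add: power_mult_distrib mult_ac)
    have "integral {x (j-1)..x j} (\<lambda>y. (qs y - poly (PQ j) y)\<^sup>2)
      \<le> (s * (A * (hh * (sqrt s + E j) + S)))\<^sup>2 * (x j - x (j-1))"
    proof (rule square_integral_le)
      show "x (j-1) \<le> x j" using x_less[OF j(1)] by simp
      show "continuous_on {x (j-1)..x j} (\<lambda>y. qs y - poly (PQ j) y)" by (intro continuous_intros cell_cont[OF j(1)])
      show "\<forall>y\<in>{x (j-1)..x j}. \<bar>qs y - poly (PQ j) y\<bar> \<le> s * (A * (hh * (sqrt s + E j) + S))"
        using fqb[OF j] by blast
    qed
    then show "integral {x (j-1)..x j} (\<lambda>y. (qs y - poly (PQ j) y)\<^sup>2) \<le> s\<^sup>2 * A\<^sup>2 * X j"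
      unfolding w X_def by (simp add: power_mult_distrib mult_ac)
  qed
  have sfu: "(\<Sum>j\<in>fine_cells. integral {x (j-1)..x j} (\<lambda>y. b y * (us y - poly (PU j) y)\<^sup>2)) \<le> bmax * A\<^sup>2 * (Cf * s * hh\<^sup>2)"
  proof -
    have "(\<Sum>j\<in>fine_cells. integral {x (j-1)..x j} (\<lambda>y. b y * (us y - poly (PU j) y)\<^sup>2)) \<le> (\<Sum>j\<in>fine_cells. bmax * A\<^sup>2 * X j)"
      by (rule sum_mono) (rule fineu)
    also have "\<dots> \<le> bmax * A\<^sup>2 * (Cf * s * hh\<^sup>2)"
      unfolding sum_distrib_left[symmetric] using bmax by (intro mult_left_mono[OF sumX]) simp
    finally show ?thesis .
  qed
  have sfq: "(\<Sum>j\<in>fine_cells. integral {x (j-1)..x j} (\<lambda>y. (qs y - poly (PQ j) y)\<^sup>2)) \<le> s\<^sup>2 * A\<^sup>2 * (Cf * s * hh\<^sup>2)"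
  proof -
    have "(\<Sum>j\<in>fine_cells. integral {x (j-1)..x j} (\<lambda>y. (qs y - poly (PQ j) y)\<^sup>2)) \<le> (\<Sum>j\<in>fine_cells. s\<^sup>2 * A\<^sup>2 * X j)"
      by (rule sum_mono) (rule fineq)
    also have "\<dots> \<le> s\<^sup>2 * A\<^sup>2 * (Cf * s * hh\<^sup>2)"
      unfolding sum_distrib_left[symmetric] by (intro mult_left_mono[OF sumX]) simp
    finally show ?thesis .
  qed
  have scu: "(\<Sum>j\<in>coarse_cells. integral {x (j-1)..x j} (\<lambda>y. b y * (us y - poly (PU j) y)\<^sup>2)) \<le> bmax * A\<^sup>2 * S\<^sup>2"
  proof -
    have "(\<Sum>j\<in>coarse_cells. integral {x (j-1)..x j} (\<lambda>y. b y * (us y - poly (PU j) y)\<^sup>2))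
        \<le> (\<Sum>j\<in>coarse_cells. bmax * (A * S)\<^sup>2 * (x j - x (j-1)))"
    proof (rule sum_mono)
      fix j assume "j \<in> coarse_cells"
      then have j: "j \<in> {1..4*M}" "\<not> fine_cell M j" by (auto simp: coarse_cells_def)
      show "integral {x (j-1)..x j} (\<lambda>y. b y * (us y - poly (PU j) y)\<^sup>2) \<le> bmax * (A * S)\<^sup>2 * (x j - x (j-1))"
        by (rule wint[OF j(1) cub[OF j]])
    qed
    also have "\<dots> \<le> bmax * (A * S)\<^sup>2 * 1"
      unfolding sum_distrib_left[symmetric] using bmax by (intro mult_left_mono[OF coarse_width_sum]) simp
    finally show ?thesis by (simp add: power_mult_distrib mult_ac)
  qed
  have scq: "(\<Sum>j\<in>coarse_cells. integral {x (j-1)..x j} (\<lambda>y. (qs y - poly (PQ j) y)\<^sup>2)) \<le> 3 * K1\<^sup>2 * (1 + 1 / \<beta>) * s ^ 3 * hh\<^sup>2"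
  proof -
    have "0 \<le> 3 * K1\<^sup>2 * (1 + 1 / \<beta>) * s ^ 3" using beta s(1) by simp
    moreover have "S\<^sup>2 \<le> hh\<^sup>2" using S by (intro power_mono) auto
    ultimately have "3 * K1\<^sup>2 * (1 + 1 / \<beta>) * s ^ 3 * S\<^sup>2 \<le> 3 * K1\<^sup>2 * (1 + 1 / \<beta>) * s ^ 3 * hh\<^sup>2"
      by (intro mult_left_mono)
    then show ?thesis using coarse_q_sum[OF cqi] by linarith
  qed
  have sumq: "(\<Sum>j=1..4*M. integral {x (j-1)..x j} (\<lambda>y. (qs y - poly (PQ j) y)\<^sup>2)) \<le> CQ * s ^ 3 * hh\<^sup>2"
  proof -
    have "CQ * s ^ 3 * hh\<^sup>2 = s\<^sup>2 * A\<^sup>2 * (Cf * s * hh\<^sup>2) + 3 * K1\<^sup>2 * (1 + 1 / \<beta>) * s ^ 3 * hh\<^sup>2"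
    proof -
      have alg: "(a * c + e) * s ^ 3 * g = s\<^sup>2 * a * (c * s * g) + e * s ^ 3 * g" for a c e g :: real
        by (simp add: algebra_simps power2_eq_square power3_eq_cube)
      show ?thesis unfolding CQ_def by (rule alg)
    qed
    then show ?thesis using sfq scq unfolding sum_cells by linarith
  qed
  have sumu: "(\<Sum>j=1..4*M. integral {x (j-1)..x j} (\<lambda>y. b y * (us y - poly (PU j) y)\<^sup>2)) \<le> bmax * A\<^sup>2 * (Cf * s * hh\<^sup>2 + S\<^sup>2)"
    using sfu scu unfolding sum_cells distrib_left by linarith
  have pe: "(\<Sum>j\<in>fine_cells. P.proj_error j) \<le> (1 + bmax) * A\<^sup>2 * Cf * (s * hh\<^sup>2)"
  proof -
    have "(\<Sum>j\<in>fine_cells. P.proj_error j)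
       = inverse (s\<^sup>2) * (\<Sum>j\<in>fine_cells. integral {x (j-1)..x j} (\<lambda>y. (qs y - poly (PQ j) y)\<^sup>2))
        + (\<Sum>j\<in>fine_cells. integral {x (j-1)..x j} (\<lambda>y. b y * (us y - poly (PU j) y)\<^sup>2))"
      by (simp add: P.proj_error_def sum.distrib sum_distrib_left)
    also have "\<dots> \<le> inverse (s\<^sup>2) * (s\<^sup>2 * A\<^sup>2 * (Cf * s * hh\<^sup>2)) + bmax * A\<^sup>2 * (Cf * s * hh\<^sup>2)"
      by (intro add_mono mult_left_mono sfq sfu) simp
    also have "\<dots> = (1 + bmax) * A\<^sup>2 * Cf * (s * hh\<^sup>2)" using s(1) by (simp add: field_simps)
    finally show ?thesis .
  qed
  have en: "P.energy \<le> CX * (s * hh\<^sup>2 + s\<^sup>2 * (n * S)\<^sup>2)"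
  proof -
    define c1 where "c1 = (1 + bmax) * A\<^sup>2 * Cf"
    define c3 where "c3 = 9 * \<kappa> * A\<^sup>2 * (29 + 4 / bmin)"
    define a where "a = s * hh\<^sup>2"
    define p where "p = s\<^sup>2 * (n * S)\<^sup>2"
    have pos: "c1 \<ge> 0" "c3 \<ge> 0" "a \<ge> 0" "p \<ge> 0" "A\<^sup>2 \<ge> 0"
      using bmax Cf kappa bmin s(1) by (simp_all add: c1_def c3_def a_def p_def)
    have "s * S\<^sup>2 \<le> a" unfolding a_def using S s(1) by (intro mult_left_mono power_mono) auto
    then have sS: "36 * A\<^sup>2 * (s * S\<^sup>2) \<le> 36 * A\<^sup>2 * a" by (intro mult_left_mono) auto
    have lin: "e \<le> 2 * (c + a1 + b2 + d)" if "e \<le> 2 * (P + a1 + b1 + d)" "P \<le> c" "b1 \<le> b2" for e P a1 b1 b2 c d :: real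
      using that by (simp add: field_simps)
    have "P.energy \<le> 2 * ((\<Sum>j\<in>fine_cells. P.proj_error j)
     + 2 * s * (3 * A * hh)\<^sup>2 + 4 * s * (3 * A)\<^sup>2 * S\<^sup>2 + \<kappa> * (real (4*M))\<^sup>2 * s\<^sup>2 * (3 * A)\<^sup>2 * S\<^sup>2 * (29 + 4 / bmin))"
      using P.energy_bound unfolding fine_cells_def .
    also have "2 * s * (3 * A * hh)\<^sup>2 = 18 * A\<^sup>2 * a" by (simp add: a_def power_mult_distrib)
    also have "4 * s * (3 * A)\<^sup>2 * S\<^sup>2 = 36 * A\<^sup>2 * (s * S\<^sup>2)" by (simp add: power_mult_distrib)
    also have "\<kappa> * (real (4*M))\<^sup>2 * s\<^sup>2 * (3 * A)\<^sup>2 * S\<^sup>2 * (29 + 4 / bmin) = c3 * p"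
      unfolding n_def[symmetric] by (simp add: c3_def p_def power_mult_distrib)
    finally have "P.energy \<le> 2 * (c1 * a + 18 * A\<^sup>2 * a + 36 * A\<^sup>2 * a + c3 * p)"
      using pe sS unfolding c1_def[symmetric] a_def[symmetric] by (rule lin)
    also have "\<dots> \<le> 2 * (c1 + 54 * A\<^sup>2 + c3) * (a + p)"
    proof -
      have "0 \<le> c1 * p + 54 * A\<^sup>2 * p + c3 * a" using pos by simp
      then show ?thesis by (simp add: algebra_simps)
    qed
    finally show ?thesis by (simp add: CX_def c1_def c3_def a_def p_def)
  qed
  have M3: "Suc (3*M) \<in> {1..4*M}" "fine_cell M (Suc (3*M))" "\<not> Suc (3*M) \<le> M"
    "3*M \<in> {1..4*M}" "\<not> fine_cell M (3*M)" using M by (auto simp: fine_cell_def)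
  show ?thesis
  proof (rule that[OF on_cell _ sumq sumu e1 fue[OF N1(3,4)]])
    show "(\<Sum>j=1..4*M. inverse (s\<^sup>2) * integral {x (j-1)..x j} (\<lambda>y. (poly (PQ j - QP j) y)\<^sup>2)
        + integral {x (j-1)..x j} (\<lambda>y. b y * (poly (PU j - UP j) y)\<^sup>2))
      + s * (poly (PU 1 - UP 1) (x 0))\<^sup>2 + s * (poly (PU (4*M) - UP (4*M)) (x (4*M)))\<^sup>2
      + (1 / s) * (poly (PQ (Suc (3*M)) - QP (Suc (3*M))) (x (3*M)) - poly (PQ (3*M) - QP (3*M)) (x (3*M)))\<^sup>2
     \<le> CX * (s * hh\<^sup>2 + s\<^sup>2 * (n * S)\<^sup>2)"
      using en unfolding P.energy_def P.local_energy_def P.q_jump_def P.R_def P.V_def .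
    show "poly (PQ (Suc (3*M))) (x (3*M)) = qs (x (3*M))" using fqe[OF M3(1,2)] M3(3) by simp
    show "\<bar>qs (x (3*M)) - poly (PQ (3*M)) (x (3*M))\<bar> \<le> 3 * A * S * s"
      by (rule cqb3[OF M3(4,5)]) (use x_less[OF M3(4)] in simp)
  qed
qed

lemma CE_pos: "CX > 0" "CQ > 0" "CE > 0"
proof -
  have A2: "A\<^sup>2 > 0" using A by simp
  have 1: "0 < (1 + bmax) * A\<^sup>2 * Cf" "0 < 54 * A\<^sup>2" "0 < 9 * \<kappa> * A\<^sup>2 * (29 + 4 / bmin)"
    using A2 bmax Cf kappa bmin by (simp_all add: add_pos_pos)
  show X: "CX > 0"
    unfolding CX_def by (rule mult_pos_pos[OF zero_less_numeral add_pos_pos[OF add_pos_pos[OF 1(1,2)] 1(3)]])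
  have "0 < A\<^sup>2 * Cf" "0 \<le> 3 * K1\<^sup>2 * (1 + 1 / \<beta>)" using A2 Cf beta by simp_all
  then show Q: "CQ > 0" unfolding CQ_def by (rule add_pos_nonneg)
  have "0 < 2 * bmax * A\<^sup>2 * (Cf + 1)" using bmax A2 Cf by (simp add: add_pos_pos)
  moreover have "0 < 2 * CQ" "0 < 36 * A\<^sup>2" "0 < 8 * CX" using Q X A2 by simp_all
  ultimately show "CE > 0" unfolding CE_def by (simp only: add_pos_pos)
qed

lemma eq_cell:
  assumes "j \<in> {1..4*M}" "y \<in> cell x j"
  shows "eq y = qs y - Q y" "eu y = us y - U y"
proof -
  have "{x (j-1)..x j} \<subseteq> {0..1}" "x (j-1) < x j" using x_cell x_less assms(1) by auto
  then have "y \<in> {0<..<1}" using assms(2) by (auto simp: cell_def)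
  then show "eq y = qs y - Q y" "eu y = us y - U y"
    using deriv_u[of y] us_eq[of y] by (auto simp: eq_def eu_def s(3))
qed

lemma L2_norm01_piecewise:
  assumes "\<And>j. j \<in> {1..4*M} \<Longrightarrow> continuous_on {x (j-1)..x j} (G j)"
    "\<And>j y. j \<in> {1..4*M} \<Longrightarrow> y \<in> cell x j \<Longrightarrow> g y * g y = G j y"
    "\<And>j y. j \<in> {1..4*M} \<Longrightarrow> y \<in> {x (j-1)..x j} \<Longrightarrow> G j y \<ge> 0"
  shows "(L2_norm01 g)\<^sup>2 = (\<Sum>j=1..4*M. integral {x (j-1)..x j} (G j))"
proof -
  have "inner_on {x 0<..<x (4*M)} g g = (\<Sum>j=1..4*M. integral {x (j-1)..x j} (G j))"
    unfolding inner_on_def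
    by (rule piecewise_integral) (use assms(1,2) x_less in \<open>simp_all add: cell_def\<close>)
  moreover have "(\<Sum>j=1..4*M. integral {x (j-1)..x j} (G j)) \<ge> 0"
    by (intro sum_nonneg integral_nonneg integrable_continuous_real assms(1,3)) assumption+
  ultimately show ?thesis by (simp add: L2_norm01_def x_special)
qed

text \<open>The weights of the balanced norm exceed those of the energy norm by a factor of at most
  \<open>1 / s\<close>, so the bound for the discrete energy, divided by \<open>s\<close>, serves
  the discrete part of the balanced norm. Only the projection error has to be estimated
  anew.\<close>

lemma error_bounds:
  "energy_norm \<epsilon> b x (4*M) (eq, eu) \<le> sqrt (CE * (s * hh\<^sup>2 + s\<^sup>2 * (n * S)\<^sup>2 + S\<^sup>2))"
  "balanced_norm \<epsilon> b x (4*M) (eq, eu) \<le> sqrt (CE * (hh\<^sup>2 + s * (n * S)\<^sup>2))"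
proof -
  obtain QP UP PQ PU :: "nat \<Rightarrow> real poly" where
    Qc: "\<And>j y. j \<in> {1..4*M} \<Longrightarrow> y \<in> cell x j \<Longrightarrow> Q y = poly (QP j) y" and
    Uc: "\<And>j y. j \<in> {1..4*M} \<Longrightarrow> y \<in> cell x j \<Longrightarrow> U y = poly (UP j) y" and
    en: "(\<Sum>j=1..4*M. inverse (s\<^sup>2) * integral {x (j-1)..x j} (\<lambda>y. (poly (PQ j - QP j) y)\<^sup>2)
        + integral {x (j-1)..x j} (\<lambda>y. b y * (poly (PU j - UP j) y)\<^sup>2))
      + s * (poly (PU 1 - UP 1) (x 0))\<^sup>2 + s * (poly (PU (4*M) - UP (4*M)) (x (4*M)))\<^sup>2
      + (1 / s) * (poly (PQ (Suc (3*M)) - QP (Suc (3*M))) (x (3*M)) - poly (PQ (3*M) - QP (3*M)) (x (3*M)))\<^sup>2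
     \<le> CX * (s * hh\<^sup>2 + s\<^sup>2 * (n * S)\<^sup>2)" and
    sq: "(\<Sum>j=1..4*M. integral {x (j-1)..x j} (\<lambda>y. (qs y - poly (PQ j) y)\<^sup>2)) \<le> CQ * s ^ 3 * hh\<^sup>2" and
    su: "(\<Sum>j=1..4*M. integral {x (j-1)..x j} (\<lambda>y. b y * (us y - poly (PU j) y)\<^sup>2)) \<le> bmax * A\<^sup>2 * (Cf * s * hh\<^sup>2 + S\<^sup>2)" and
    b0: "\<bar>us (x 0) - poly (PU 1) (x 0)\<bar> \<le> 3 * A * hh" and bN: "poly (PU (4*M)) (x (4*M)) = us (x (4*M))" and
    bq: "poly (PQ (Suc (3*M))) (x (3*M)) = qs (x (3*M))"
      "\<bar>qs (x (3*M)) - poly (PQ (3*M)) (x (3*M))\<bar> \<le> 3 * A * S * s"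
    by (fact discrete_error_bound)
  define IR where "IR = (\<Sum>j=1..4*M. integral {x (j-1)..x j} (\<lambda>y. (poly (PQ j - QP j) y)\<^sup>2))"
  define IV where "IV = (\<Sum>j=1..4*M. integral {x (j-1)..x j} (\<lambda>y. b y * (poly (PU j - UP j) y)\<^sup>2))"
  define V1 where "V1 = poly (PU 1 - UP 1) (x 0)"
  define VN where "VN = poly (PU (4*M) - UP (4*M)) (x (4*M))"
  define J where "J = poly (PQ (Suc (3*M)) - QP (Suc (3*M))) (x (3*M)) - poly (PQ (3*M) - QP (3*M)) (x (3*M))"
  define G where "G = s * hh\<^sup>2 + s\<^sup>2 * (n * S)\<^sup>2"
  have en': "inverse (s\<^sup>2) * IR + IV + s * V1\<^sup>2 + s * VN\<^sup>2 + (1 / s) * J\<^sup>2 \<le> CX * G"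
    using en unfolding IR_def IV_def V1_def VN_def J_def G_def sum.distrib sum_distrib_left .
  have IRV: "IR \<ge> 0" "IV \<ge> 0" unfolding IR_def IV_def
    by (intro sum_nonneg integral_nonneg integrable_continuous_real continuous_intros cell_cont mult_nonneg_nonneg;
        use b_nonneg in auto)+
  have ce: "continuous_on {x (j-1)..x j} (\<lambda>y. qs y - poly (QP j) y)" "continuous_on {x (j-1)..x j} (\<lambda>y. us y - poly (UP j) y)"
    if "j \<in> {1..4*M}" for j by (intro continuous_intros cell_cont[OF that])+
  have Eq: "(L2_norm01 eq)\<^sup>2 = (\<Sum>j=1..4*M. integral {x (j-1)..x j} (\<lambda>y. (qs y - poly (QP j) y)\<^sup>2))"
  proof (rule L2_norm01_piecewise)
    fix j y assume j: "j \<in> {1..4*M}"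
    show "continuous_on {x (j-1)..x j} (\<lambda>y. (qs y - poly (QP j) y)\<^sup>2)" by (intro continuous_intros cell_cont[OF j])
    show "eq y * eq y = (qs y - poly (QP j) y)\<^sup>2" if "y \<in> cell x j"
      using eq_cell(1)[OF j that] Qc[OF j that] by (simp add: power2_eq_square)
  qed simp
  have Eu: "(L2_norm01 (\<lambda>y. sqrt (b y) * eu y))\<^sup>2 = (\<Sum>j=1..4*M. integral {x (j-1)..x j} (\<lambda>y. b y * (us y - poly (UP j) y)\<^sup>2))"
  proof (rule L2_norm01_piecewise)
    fix j y assume j: "j \<in> {1..4*M}"
    show "continuous_on {x (j-1)..x j} (\<lambda>y. b y * (us y - poly (UP j) y)\<^sup>2)" by (intro continuous_intros cell_cont[OF j])
    show "sqrt (b y) * eu y * (sqrt (b y) * eu y) = b y * (us y - poly (UP j) y)\<^sup>2" if y: "y \<in> cell x j"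
    proof -
      have "b y \<ge> 0" using b_nonneg[OF j] y by (auto simp: cell_def)
      then have "sqrt (b y) * sqrt (b y) = b y" by simp
      then have "sqrt (b y) * e * (sqrt (b y) * e) = b y * e\<^sup>2" for e
        unfolding power2_eq_square by (metis mult.assoc mult.left_commute)
      then show ?thesis
        unfolding eq_cell(2)[OF j y] Uc[OF j y] .
    qed
    show "y \<in> {x (j-1)..x j} \<Longrightarrow> 0 \<le> b y * (us y - poly (UP j) y)\<^sup>2" using b_nonneg[OF j] by simp
  qed
  have Eq_le: "(L2_norm01 eq)\<^sup>2 \<le> 2 * (CQ * s ^ 3 * hh\<^sup>2) + 2 * IR"
  proof -
    have "(L2_norm01 eq)\<^sup>2 \<le> (\<Sum>j=1..4*M. 2 * integral {x (j-1)..x j} (\<lambda>y. (qs y - poly (PQ j) y)\<^sup>2)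
       + 2 * integral {x (j-1)..x j} (\<lambda>y. (poly (PQ j - QP j) y)\<^sup>2))"
      unfolding Eq
    proof (rule sum_mono)
      fix j assume j: "j \<in> {1..4*M}"
      show "integral {x (j-1)..x j} (\<lambda>y. (qs y - poly (QP j) y)\<^sup>2) \<le> 2 * integral {x (j-1)..x j} (\<lambda>y. (qs y - poly (PQ j) y)\<^sup>2)
       + 2 * integral {x (j-1)..x j} (\<lambda>y. (poly (PQ j - QP j) y)\<^sup>2)"
        using integral_square_split[OF continuous_on_const[of _ 1] cell_cont(2)[OF j], of "QP j" "PQ j"] by simp
    qed
    then show ?thesis using sq unfolding sum.distrib sum_distrib_left[symmetric] IR_def[symmetric] by linarith
  qed
  have Eu_le: "(L2_norm01 (\<lambda>y. sqrt (b y) * eu y))\<^sup>2 \<le> 2 * (bmax * A\<^sup>2 * (Cf * s * hh\<^sup>2 + S\<^sup>2)) + 2 * IV"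
  proof -
    have "(L2_norm01 (\<lambda>y. sqrt (b y) * eu y))\<^sup>2 \<le> (\<Sum>j=1..4*M. 2 * integral {x (j-1)..x j} (\<lambda>y. b y * (us y - poly (PU j) y)\<^sup>2)
       + 2 * integral {x (j-1)..x j} (\<lambda>y. b y * (poly (PU j - UP j) y)\<^sup>2))"
      unfolding Eu by (rule sum_mono) (rule integral_square_split[OF cell_cont(3,1) b_nonneg])
    then show ?thesis using su unfolding sum.distrib sum_distrib_left[symmetric] IV_def[symmetric] by linarith
  qed
  have N: "1 \<in> {1..4*M}" "4*M \<in> {1..4*M}" "3*M \<in> {1..4*M}" "Suc (3*M) \<in> {1..4*M}" "4*M \<noteq> 0" "3*M \<noteq> 0" "3*M \<noteq> 4*M"
    using M by auto
  have t0: "trace_plus x eu 0 = us (x 0) - poly (UP 1) (x 0)"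
    using cell_traces(2)[OF N(1) ce(2)[OF N(1)], of eu] eq_cell(2)[OF N(1)] Uc[OF N(1)] by simp
  have tN: "trace_minus x eu (4*M) = us (x (4*M)) - poly (UP (4*M)) (x (4*M))"
    by (rule cell_traces(1)[OF N(2) ce(2)[OF N(2)]]) (simp add: eq_cell(2)[OF N(2)] Uc[OF N(2)])
  have tq1: "trace_minus x eq (3*M) = qs (x (3*M)) - poly (QP (3*M)) (x (3*M))"
    by (rule cell_traces(1)[OF N(3) ce(1)[OF N(3)]]) (simp add: eq_cell(1)[OF N(3)] Qc[OF N(3)])
  have tq2: "trace_plus x eq (3*M) = qs (x (3*M)) - poly (QP (Suc (3*M))) (x (3*M))"
    using cell_traces(2)[OF N(4) ce(1)[OF N(4)], of eq] eq_cell(1)[OF N(4)] Qc[OF N(4)] by simp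
  define j0 where "j0 = (jump x (4*M) eu 0)\<^sup>2"
  define jN where "jN = (jump x (4*M) eu (4*M))\<^sup>2"
  define jq where "jq = (jump x (4*M) eq (3*M))\<^sup>2"
  have j0: "j0 \<le> 18 * A\<^sup>2 * hh\<^sup>2 + 2 * V1\<^sup>2"
  proof -
    let ?a = "us (x 0) - poly (PU 1) (x 0)"
    have "jump x (4*M) eu 0 = ?a + V1" by (simp add: jump_def t0 V1_def)
    then have "j0 \<le> 2 * ?a\<^sup>2 + 2 * V1\<^sup>2" unfolding j0_def using square_sum_le by simp
    moreover have "?a\<^sup>2 \<le> (3 * A * hh)\<^sup>2" using power_mono[OF b0, of 2] by simp
    moreover have "(3 * A * hh)\<^sup>2 = 9 * A\<^sup>2 * hh\<^sup>2" by (simp add: power_mult_distrib)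
    ultimately show ?thesis by linarith
  qed
  \<comment> \<open>\<open>PU\<close> is exact at the right end of the domain, so only the discrete
    error contributes; at the left end it is not.\<close>
  have jN: "jN = VN\<^sup>2"
  proof -
    have "jump x (4*M) eu (4*M) = - VN" unfolding jump_def tN VN_def bN[symmetric] using N(5) by simp
    then show ?thesis unfolding jN_def by (simp only: power2_minus)
  qed
  have jq: "jq \<le> 18 * A\<^sup>2 * S\<^sup>2 * s\<^sup>2 + 2 * J\<^sup>2"
  proof -
    let ?a = "qs (x (3*M)) - poly (PQ (3*M)) (x (3*M))"
    have "jump x (4*M) eq (3*M) = - ?a + J" using N(6,7) by (simp add: jump_def tq1 tq2 J_def bq(1))
    then have "jq \<le> 2 * (- ?a)\<^sup>2 + 2 * J\<^sup>2" unfolding jq_def using square_sum_le[of "- ?a" J] by simp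
    moreover have "(- ?a)\<^sup>2 \<le> (3 * A * S * s)\<^sup>2" using power_mono[OF bq(2), of 2] unfolding power2_minus by simp
    moreover have "(3 * A * S * s)\<^sup>2 = 9 * A\<^sup>2 * S\<^sup>2 * s\<^sup>2" by (simp add: power_mult_distrib)
    ultimately show ?thesis by linarith
  qed
  define L where "L = (L2_norm01 eq)\<^sup>2"
  define L' where "L' = (L2_norm01 (\<lambda>y. sqrt (b y) * eu y))\<^sup>2"
  have N3: "3 * (4 * M div 4) = 3 * M" by simp
  have EN: "energy_norm \<epsilon> b x (4*M) (eq, eu) = sqrt (inverse (s\<^sup>2) * L + L' + s * (j0 + jN) + (1 / s) * jq)"
    using N(5) unfolding energy_norm_def N3
    by (simp add: L_def L'_def j0_def jN_def jq_def lam_bd_def lam_q_def s_def[symmetric] s(3) distrib_left add.assoc)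
  have p32: "\<epsilon> powr (- 3 / 2) = 1 / s ^ 3" using eps_powr[of 3] by simp
  have BN: "balanced_norm \<epsilon> b x (4*M) (eq, eu) = sqrt (1 / s ^ 3 * L + L' + (j0 + jN) + jq)"
    using N(5) unfolding balanced_norm_def N3 p32
    by (simp add: L_def L'_def j0_def jN_def jq_def add.assoc)
  define c1 where "c1 = bmax * A\<^sup>2"
  have c1: "c1 > 0" using bmax A by (simp add: c1_def)
  have CE: "CE = 2 * CQ + 2 * c1 * (Cf + 1) + 36 * A\<^sup>2 + 8 * CX" by (simp add: CE_def c1_def)
  have A2: "A\<^sup>2 \<ge> 0" by simp
  have SS: "S\<^sup>2 \<le> hh\<^sup>2" using S by (intro power_mono) auto
  have L1: "inverse (s\<^sup>2) * L \<le> 2 * CQ * (s * hh\<^sup>2) + 2 * (inverse (s\<^sup>2) * IR)"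
  proof -
    have "inverse (s\<^sup>2) * L \<le> inverse (s\<^sup>2) * (2 * (CQ * s ^ 3 * hh\<^sup>2) + 2 * IR)"
      using Eq_le by (intro mult_left_mono) (simp_all add: L_def)
    also have "\<dots> = 2 * CQ * (s * hh\<^sup>2) + 2 * (inverse (s\<^sup>2) * IR)"
      using s(1) by (simp add: field_simps power2_eq_square power3_eq_cube)
    finally show ?thesis .
  qed
  have L2: "L' \<le> 2 * c1 * Cf * (s * hh\<^sup>2) + 2 * c1 * S\<^sup>2 + 2 * IV"
    using Eu_le by (simp add: L'_def c1_def algebra_simps)
  have "inverse (s\<^sup>2) * L + L' + s * (j0 + jN) + (1 / s) * jq
      \<le> CE * (s * hh\<^sup>2 + s\<^sup>2 * (n * S)\<^sup>2 + S\<^sup>2)"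
  proof -
    define a where "a = s * hh\<^sup>2"
    define p where "p = s\<^sup>2 * (n * S)\<^sup>2"
    have pos: "a \<ge> 0" "p \<ge> 0" using s(1) by (simp_all add: a_def p_def)
    have G: "G = a + p" by (simp add: G_def a_def p_def)
    have 1: "s * (j0 + jN) \<le> 18 * A\<^sup>2 * a + 2 * (s * V1\<^sup>2) + s * VN\<^sup>2"
      using mult_left_mono[OF j0, of s] s(1) unfolding jN a_def by (simp add: algebra_simps)
    have 2: "(1 / s) * jq \<le> 18 * A\<^sup>2 * S\<^sup>2 + 2 * ((1 / s) * J\<^sup>2)"
    proof -
      have "(1 / s) * jq \<le> (1 / s) * (18 * A\<^sup>2 * S\<^sup>2 * s\<^sup>2 + 2 * J\<^sup>2)"
        using jq s(1) by (intro mult_left_mono) auto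
      also have "\<dots> = s * (18 * A\<^sup>2 * S\<^sup>2) + 2 * ((1 / s) * J\<^sup>2)"
        using s(1) by (simp add: field_simps power2_eq_square)
      also have "s * (18 * A\<^sup>2 * S\<^sup>2) \<le> 18 * A\<^sup>2 * S\<^sup>2"
        using s by (simp add: mult_left_le_one_le)
      finally show ?thesis by simp
    qed
    have 3: "0 \<le> s * VN\<^sup>2" using s(1) by simp
    have lin: "l + l' + jj + jr \<le> 2 * cq * a + 2 * c1 * cf * a + 2 * c1 * S\<^sup>2 + 18 * A\<^sup>2 * a + 18 * A\<^sup>2 * S\<^sup>2 + 2 * g"
      if "l \<le> 2 * cq * a + 2 * ir" "l' \<le> 2 * c1 * cf * a + 2 * c1 * S\<^sup>2 + 2 * iv"
        "jj \<le> 18 * A\<^sup>2 * a + 2 * v + w" "jr \<le> 18 * A\<^sup>2 * S\<^sup>2 + 2 * jt" "0 \<le> w" "ir + iv + v + w + jt \<le> g"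
      for l l' jj jr cq cf ir iv v w jt g :: real
      using that by linarith
    have "inverse (s\<^sup>2) * L + L' + s * (j0 + jN) + (1 / s) * jq
      \<le> 2 * CQ * a + 2 * c1 * Cf * a + 2 * c1 * S\<^sup>2 + 18 * A\<^sup>2 * a + 18 * A\<^sup>2 * S\<^sup>2 + 2 * (CX * (a + p))"
      by (rule lin[OF L1[folded a_def] L2[folded a_def] 1 2 3 en'[unfolded G]])
    also have "\<dots> \<le> CE * (a + p + S\<^sup>2)"
    proof -
      have "0 \<le> 2 * CQ * (p + S\<^sup>2) + 2 * c1 * Cf * (p + S\<^sup>2) + 2 * c1 * (a + p) + 36 * A\<^sup>2 * p + 18 * A\<^sup>2 * a + 18 * A\<^sup>2 * S\<^sup>2
         + 6 * CX * (a + p) + 8 * CX * S\<^sup>2"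
        using pos CE_pos c1 Cf by simp
      then show ?thesis unfolding CE by (simp add: algebra_simps)
    qed
    finally show ?thesis by (simp add: a_def p_def)
  qed
  then show "energy_norm \<epsilon> b x (4*M) (eq, eu) \<le> sqrt (CE * (s * hh\<^sup>2 + s\<^sup>2 * (n * S)\<^sup>2 + S\<^sup>2))"
    unfolding EN by (rule real_sqrt_le_mono)
  have "1 / s ^ 3 * L + L' + (j0 + jN) + jq \<le> CE * (hh\<^sup>2 + s * (n * S)\<^sup>2)"
  proof -
    define t where "t = 1 / s"
    have t: "t > 0" "t * s = 1" "1 \<le> t" "s \<le> t" using s by (auto simp: t_def field_simps power2_eq_square)
    define p where "p = s * (n * S)\<^sup>2"
    have pos: "0 \<le> hh\<^sup>2" "0 \<le> p" using s(1) by (simp_all add: p_def)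
    \<comment> \<open>Division by \<open>s\<close> leaves \<open>hh\<^sup>2\<close>: this uses up
      the spare factor of the energy bound.\<close>
    have tG: "t * G = hh\<^sup>2 + p" using s(1) by (simp add: G_def t_def p_def field_simps power2_eq_square)
    have 1: "1 / s ^ 3 * L \<le> 2 * CQ * hh\<^sup>2 + 2 * (t * (inverse (s\<^sup>2) * IR))"
    proof -
      have "1 / s ^ 3 * L = t * (inverse (s\<^sup>2) * L)" by (simp add: t_def power2_eq_square power3_eq_cube divide_inverse mult_ac)
      also have "\<dots> \<le> t * (2 * CQ * (s * hh\<^sup>2) + 2 * (inverse (s\<^sup>2) * IR))"
        using t by (intro mult_left_mono L1) auto
      also have "\<dots> = 2 * CQ * ((t * s) * hh\<^sup>2) + 2 * (t * (inverse (s\<^sup>2) * IR))" by (simp only: distrib_left mult_ac)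
      finally show ?thesis by (simp add: t(2))
    qed
    have 2: "L' \<le> 2 * c1 * (Cf + 1) * hh\<^sup>2 + 2 * (t * IV)"
    proof -
      have "2 * c1 * Cf * (s * hh\<^sup>2) \<le> 2 * c1 * Cf * hh\<^sup>2"
        using c1 Cf s by (intro mult_left_mono) (auto simp: mult_left_le_one_le)
      moreover have "2 * c1 * S\<^sup>2 \<le> 2 * c1 * hh\<^sup>2" using c1 SS by simp
      moreover have "IV \<le> t * IV" using IRV(2) t(3) mult_right_mono[of 1 t IV] by simp
      ultimately show ?thesis using L2 by (simp add: algebra_simps)
    qed
    have 3: "j0 + jN \<le> 18 * A\<^sup>2 * hh\<^sup>2 + 2 * (t * (s * V1\<^sup>2)) + t * (s * VN\<^sup>2)"
      using j0 jN t(2) by (simp add: mult.assoc[symmetric])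
    have 4: "jq \<le> 18 * A\<^sup>2 * hh\<^sup>2 + 2 * (t * ((1 / s) * J\<^sup>2))"
    proof -
      have "A\<^sup>2 * (S\<^sup>2 * s\<^sup>2) \<le> A\<^sup>2 * hh\<^sup>2"
        using SS s by (intro mult_left_mono order_trans[OF _ SS]) (auto simp: mult_left_le)
      moreover have "J\<^sup>2 \<le> t * ((1 / s) * J\<^sup>2)"
      proof -
        have "1 * 1 \<le> t * t" using t(3) by (intro mult_mono) auto
        then have "1 * J\<^sup>2 \<le> (t * t) * J\<^sup>2" by (intro mult_right_mono) auto
        then show ?thesis by (simp add: t_def)
      qed
      ultimately show ?thesis using jq by (simp add: mult.assoc)
    qed
    have 5: "0 \<le> t * (s * VN\<^sup>2)" using t(1) s(1) by simp
    have 6: "t * (inverse (s\<^sup>2) * IR) + t * IV + t * (s * V1\<^sup>2) + t * (s * VN\<^sup>2) + t * ((1 / s) * J\<^sup>2) \<le> CX * (hh\<^sup>2 + p)"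
      using mult_left_mono[OF en', of t] t(1) unfolding tG[symmetric] by (simp only: distrib_left mult.left_commute less_imp_le)
    have lin: "l + l' + jj + jr \<le> 2 * cq * a + 2 * c1 * cf * a + 18 * A\<^sup>2 * a + 18 * A\<^sup>2 * a + 2 * g"
      if "l \<le> 2 * cq * a + 2 * ir" "l' \<le> 2 * c1 * cf * a + 2 * iv"
        "jj \<le> 18 * A\<^sup>2 * a + 2 * v + w" "jr \<le> 18 * A\<^sup>2 * a + 2 * jt" "0 \<le> w" "ir + iv + v + w + jt \<le> g"
      for l l' jj jr cq cf ir iv v w jt g a :: real
      using that by linarith
    have "1 / s ^ 3 * L + L' + (j0 + jN) + jq
      \<le> 2 * CQ * hh\<^sup>2 + 2 * c1 * (Cf + 1) * hh\<^sup>2 + 18 * A\<^sup>2 * hh\<^sup>2 + 18 * A\<^sup>2 * hh\<^sup>2 + 2 * (CX * (hh\<^sup>2 + p))"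
      by (rule lin[OF 1 2 3 4 5 6])
    also have "\<dots> \<le> CE * (hh\<^sup>2 + p)"
    proof -
      have "0 \<le> 2 * CQ * p + 2 * c1 * (Cf + 1) * p + 36 * A\<^sup>2 * p + 6 * CX * (hh\<^sup>2 + p)"
        using pos CE_pos c1 Cf by simp
      then show ?thesis unfolding CE by (simp add: algebra_simps)
    qed
    finally show ?thesis by (simp add: p_def)
  qed
  then show "balanced_norm \<epsilon> b x (4*M) (eq, eu) \<le> sqrt (CE * (hh\<^sup>2 + s * (n * S)\<^sup>2))"
    unfolding BN by (rule real_sqrt_le_mono)
qed

lemma final_bounds:
  "energy_norm \<epsilon> b x (4*M) (eq, eu) \<le> sqrt CE * (sqrt s * hh + s * (n * S) + S)"
  "balanced_norm \<epsilon> b x (4*M) (eq, eu) \<le> sqrt CE * (s * hh + sqrt s * (n * S) + hh)"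
proof -
  have pos: "0 \<le> hh" "0 \<le> n * S" "0 \<le> S" "0 \<le> s" "0 \<le> sqrt s" using S n s(1) by simp_all
  have sq: "(sqrt s)\<^sup>2 = s" using s(1) by simp
  have "s * hh\<^sup>2 + s\<^sup>2 * (n * S)\<^sup>2 + S\<^sup>2 \<le> (sqrt s * hh + s * (n * S) + S)\<^sup>2"
  proof -
    have g: "a\<^sup>2 + c\<^sup>2 + d\<^sup>2 \<le> (a + c + d)\<^sup>2" if "0 \<le> a" "0 \<le> c" "0 \<le> d" for a c d :: real
    proof -
      have "0 \<le> 2 * (a * c + a * d + c * d)" using that by simp
      then show ?thesis by (simp add: power2_eq_square algebra_simps)
    qed
    show ?thesis using g[of "sqrt s * hh" "s * (n * S)" S] pos unfolding power_mult_distrib sq by simp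
  qed
  then have "sqrt (CE * (s * hh\<^sup>2 + s\<^sup>2 * (n * S)\<^sup>2 + S\<^sup>2)) \<le> sqrt (CE * (sqrt s * hh + s * (n * S) + S)\<^sup>2)"
    using CE_pos(3) by simp
  also have "\<dots> = sqrt CE * (sqrt s * hh + s * (n * S) + S)"
    using pos by (simp add: real_sqrt_mult)
  finally show "energy_norm \<epsilon> b x (4*M) (eq, eu) \<le> sqrt CE * (sqrt s * hh + s * (n * S) + S)"
    using error_bounds(1) by linarith
  have "hh\<^sup>2 + s * (n * S)\<^sup>2 \<le> (sqrt s * (n * S) + hh)\<^sup>2"
  proof -
    have "0 \<le> 2 * (sqrt s * (n * S) * hh)" using pos by simp
    moreover have "(sqrt s * (n * S) + hh)\<^sup>2 = (sqrt s)\<^sup>2 * (n * S)\<^sup>2 + 2 * (sqrt s * (n * S) * hh) + hh\<^sup>2"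
      by (simp add: power2_sum power_mult_distrib)
    ultimately show ?thesis unfolding sq by linarith
  qed
  then have "sqrt (CE * (hh\<^sup>2 + s * (n * S)\<^sup>2)) \<le> sqrt (CE * (sqrt s * (n * S) + hh)\<^sup>2)"
    using CE_pos(3) by simp
  also have "\<dots> = sqrt CE * (sqrt s * (n * S) + hh)"
    using pos by (simp add: real_sqrt_mult)
  also have "\<dots> \<le> sqrt CE * (s * hh + sqrt s * (n * S) + hh)"
    using pos CE_pos(3) by (intro mult_left_mono) auto
  finally show "balanced_norm \<epsilon> b x (4*M) (eq, eu) \<le> sqrt CE * (s * hh + sqrt s * (n * S) + hh)"
    using error_bounds(2) by linarith
qed

end

section \<open>Constants fixed before the parameters, and the conclusion\<close>

lemma C_class_on_continuous:
  assumes "C_class_on S m g" "m \<ge> 1"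
  shows "continuous_on S g"
proof -
  have "\<forall>y\<in>S. nderiv_on S 0 g differentiable (at y within S)"
    using assms unfolding C_class_on_def times_differentiable_on_def by (metis less_eq_Suc_le One_nat_def)
  then show ?thesis
    by (auto simp: continuous_on_eq_continuous_within intro: differentiable_imp_continuous_within)
qed

lemma quasi_optimal_mono:
  assumes "K \<le> K'" "quasi_optimal a c k K g p"
  shows "quasi_optimal a c k K' g p"
  unfolding quasi_optimal_def
proof (intro allI impI ballI)
  fix p0 B y assume h: "degree p0 \<le> k" "\<forall>y\<in>{a..c}. \<bar>g y - poly p0 y\<bar> \<le> B" and y: "y \<in> {a..c}"
  have "0 \<le> B" using h(2) y abs_ge_zero order_trans by blast
  then have "K * B \<le> K' * B" using assms(1) by (intro mult_right_mono)
  moreover have "\<bar>g y - poly p y\<bar> \<le> K * B" using assms(2) h y unfolding quasi_optimal_def by blast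
  ultimately show "\<bar>g y - poly p y\<bar> \<le> K' * B" by linarith
qed

text \<open>One stability constant for the three kinds of projections is fixed before
  \<open>\<epsilon>\<close> and \<open>N\<close> appear, so that it cannot depend on them.\<close>

lemma projection_constant:
  fixes b :: "real \<Rightarrow> real"
  assumes k: "k \<ge> 1" and b: "continuous_on {0..1} b" and bmin: "0 < bmin"
    and bb: "\<And>y. y \<in> {0..1} \<Longrightarrow> bmin \<le> b y \<and> b y \<le> bmax"
  shows "\<exists>KP. shishkin_projection_axioms k b bmin bmax KP"
proof -
  have mm: "bmin \<le> bmax" using bb[of 0] by simp
  obtain K1 where K1: "K1 \<ge> 1"
    "\<And>(a::real) c w g. a < c \<Longrightarrow> continuous_on {a..c} w \<Longrightarrow> (\<And>x. x \<in> {a..c} \<Longrightarrow> bmin \<le> w x \<and> w x \<le> bmax) \<Longrightarrow>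
      continuous_on {a..c} g \<Longrightarrow> \<exists>p. is_L2_projection w a c k K1 g p"
    by (fact L2_projection[OF bmin mm])
  obtain K2 where K2: "K2 \<ge> 1"
    "\<And>(a::real) c w g. a < c \<Longrightarrow> continuous_on {a..c} w \<Longrightarrow> (\<And>x. x \<in> {a..c} \<Longrightarrow> 1 \<le> w x \<and> w x \<le> 1) \<Longrightarrow>
      continuous_on {a..c} g \<Longrightarrow> \<exists>p. is_L2_projection w a c k K2 g p"
    by (fact L2_projection[OF zero_less_one order_refl])
  obtain K3 where K3: "K3 \<ge> 1"
    "\<And>(a::real) c e g. a < c \<Longrightarrow> e = a \<or> e = c \<Longrightarrow> continuous_on {a..c} g \<Longrightarrow>
      \<exists>p. is_radau_projection e a c (Suc (k - 1)) K3 g p"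
    by (fact gauss_radau[of "k - 1"])
  \<comment> \<open>Here \<open>k \<ge> 1\<close> is used: the Radau projection spends one of its
    conditions on the end point.\<close>
  have Sk: "Suc (k - 1) = k" using k by simp
  define KP where "KP = max K1 (max K2 K3)"
  have KP: "K1 \<le> KP" "K2 \<le> KP" "K3 \<le> KP" "1 \<le> KP" using K1(1) by (auto simp: KP_def)
  have "shishkin_projection_axioms k b bmin bmax KP"
  proof (rule shishkin_projection_axioms.intro[OF b bmin bb KP(4)])
    fix a c :: real and g :: "real \<Rightarrow> real"
    assume h: "a < c" "{a..c} \<subseteq> {0..1}" "continuous_on {a..c} g"
    have "continuous_on {a..c} b" "\<And>y. y \<in> {a..c} \<Longrightarrow> bmin \<le> b y \<and> b y \<le> bmax"
      using b bb h(2) continuous_on_subset by blast+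
    from K1(2)[OF h(1) this h(3)] show "\<exists>p. is_L2_projection b a c k KP g p"
      unfolding is_L2_projection_def using quasi_optimal_mono[OF KP(1)] by blast
  next
    fix a c :: real and g :: "real \<Rightarrow> real"
    assume h: "a < c" "continuous_on {a..c} g"
    have one: "(1::real) \<le> 1 \<and> (1::real) \<le> 1" by simp
    from K2(2)[of a c "\<lambda>_. 1", OF h(1) continuous_on_const one h(2)]
    show "\<exists>p. is_L2_projection (\<lambda>_. 1) a c k KP g p"
      unfolding is_L2_projection_def using quasi_optimal_mono[OF KP(2)] by blast
  next
    fix a c e :: real and g :: "real \<Rightarrow> real"
    assume h: "a < c" "e = a \<or> e = c" "continuous_on {a..c} g"
    from K3(2)[OF h] show "\<exists>p. is_radau_projection e a c k KP g p"
      unfolding is_radau_projection_def Sk using quasi_optimal_mono[OF KP(3)] by blast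
  qed
  then show ?thesis ..
qed

theorem theorem1:
  fixes k :: nat and \<beta> \<sigma> C0 C1 :: real and b f :: "real \<Rightarrow> real"
  assumes "k \<ge> 1" and "\<beta> > 0" and "\<sigma> \<ge> real k + 1"
    and "C_class_on {0..1} k b" and "C_class_on {0..1} k f"
    and "\<forall>x\<in>{0..1}. b x \<ge> \<beta>\<^sup>2"
    and "C0 > 0" and "C1 > 0"
  shows "\<exists>C>0. \<forall>(\<epsilon>::real) (N::nat).
    0 < \<epsilon> \<and> \<epsilon> < 1 \<and> N \<ge> 4 \<and> 4 dvd N \<and> \<epsilon> \<le> C0 / real N \<and> transition \<sigma> \<beta> \<epsilon> N \<le> 1 / 4 \<longrightarrow>
    (\<forall>(u::real \<Rightarrow> real) (u0::real \<Rightarrow> real) (u1::real \<Rightarrow> real) (u2::real \<Rightarrow> real)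
        (Q::real \<Rightarrow> real) (U::real \<Rightarrow> real).
      is_bvp_solution \<epsilon> b f u \<and>
      (\<forall>x\<in>{0..1}. u x = u0 x + u1 x + u2 x) \<and>
      times_differentiable_on {0..1} (k + 2) u0 \<and>
      times_differentiable_on {0..1} (k + 2) u1 \<and>
      times_differentiable_on {0..1} (k + 2) u2 \<and>
      (\<forall>j\<le>k + 2. \<forall>x\<in>{0..1}.
         \<bar>nderiv_on {0..1} j u0 x\<bar> \<le> C1 \<and>
         \<bar>nderiv_on {0..1} j u1 x\<bar> \<le> C1 * \<epsilon> powr (- (real j / 2)) * exp (- \<beta> * x / sqrt \<epsilon>) \<and>
         \<bar>nderiv_on {0..1} j u2 x\<bar> \<le> C1 * \<epsilon> powr (- (real j / 2)) * exp (- \<beta> * (1 - x) / sqrt \<epsilon>)) \<and>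
      is_LDG_solution k \<epsilon> b f (shishkin \<sigma> \<beta> \<epsilon> N) N Q U \<longrightarrow>
      (let mesh = shishkin \<sigma> \<beta> \<epsilon> N;
           e = ((\<lambda>x. \<epsilon> * deriv u x - Q x), (\<lambda>x. u x - U x));
           h = ln (real N) / real N
       in
         energy_norm \<epsilon> b mesh N e
           \<le> C * (\<epsilon> powr (1 / 4) * h ^ (k + 1) + \<epsilon> powr (1 / 2) * (1 / real N) ^ k + (1 / real N) ^ (k + 1)) \<and>
         balanced_norm \<epsilon> b mesh N e
           \<le> C * (\<epsilon> powr (1 / 2) * h ^ (k + 1) + \<epsilon> powr (1 / 4) * (1 / real N) ^ k + h ^ (k + 1))))"
proof -
  have bc: "continuous_on {0..1} b" and fc: "continuous_on {0..1} f"
    using C_class_on_continuous assms(1,4,5) by blast+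
  have "compact (b ` {0..1})" by (intro compact_continuous_image bc) auto
  then have "bounded (b ` {0..1})" by (rule compact_imp_bounded)
  then obtain bmax where bmax: "\<forall>y\<in>{0..1}. \<bar>b y\<bar> \<le> bmax"
    by (auto simp: bounded_iff)
  have bb: "\<beta>\<^sup>2 \<le> b y \<and> b y \<le> bmax" if "y \<in> {0..1}" for y
    using assms(6) bmax[rule_format, OF that] that by force
  have bmin: "0 < \<beta>\<^sup>2" using assms(2) by simp
  obtain KP where KP: "shishkin_projection_axioms k b (\<beta>\<^sup>2) bmax KP"
    using projection_constant[OF assms(1) bc bmin bb] by blast
  obtain \<kappa> where \<kappa>: "\<kappa> > 0"
    "\<And>(p::real poly) a c x. degree p \<le> k \<Longrightarrow> a < c \<Longrightarrow> x \<in> {a..c} \<Longrightarrow>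
       (poly p x)\<^sup>2 \<le> \<kappa> / (c - a) * integral {a..c} (\<lambda>x. (poly p x)\<^sup>2)"
    "\<And>(p::real poly) a c x. degree p \<le> k \<Longrightarrow> a < c \<Longrightarrow> x \<in> {a..c} \<Longrightarrow>
       (poly (pderiv p) x)\<^sup>2 \<le> \<kappa> / (c - a) ^ 3 * integral {a..c} (\<lambda>x. (poly p x)\<^sup>2)"
    by (fact inverse_inequality)
  \<comment> \<open>\<open>CE\<close> is taken outside its locale with explicit arguments;
    \<open>\<epsilon>\<close>, \<open>N\<close> and the functions of the decomposition are not among
    them. The absolute value and the summand 1 make \<open>C\<close> positive without inspecting
    \<open>CE\<close>.\<close>
  define C where "C = \<bar>sqrt (shishkin_ldg.CE k \<beta> \<sigma> C1 (\<beta>\<^sup>2) bmax KP \<kappa>)\<bar> + 1"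
  show ?thesis
  proof (intro exI[of _ C] conjI allI impI)
    show "C > 0" by (simp add: C_def)
    fix \<epsilon> :: real and N :: nat and u u0 u1 u2 Q U :: "real \<Rightarrow> real"
    assume E: "0 < \<epsilon> \<and> \<epsilon> < 1 \<and> N \<ge> 4 \<and> 4 dvd N \<and> \<epsilon> \<le> C0 / real N \<and> transition \<sigma> \<beta> \<epsilon> N \<le> 1 / 4"
    assume H: "is_bvp_solution \<epsilon> b f u \<and>
      (\<forall>x\<in>{0..1}. u x = u0 x + u1 x + u2 x) \<and>
      times_differentiable_on {0..1} (k + 2) u0 \<and>
      times_differentiable_on {0..1} (k + 2) u1 \<and>
      times_differentiable_on {0..1} (k + 2) u2 \<and>
      (\<forall>j\<le>k + 2. \<forall>x\<in>{0..1}.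
         \<bar>nderiv_on {0..1} j u0 x\<bar> \<le> C1 \<and>
         \<bar>nderiv_on {0..1} j u1 x\<bar> \<le> C1 * \<epsilon> powr (- (real j / 2)) * exp (- \<beta> * x / sqrt \<epsilon>) \<and>
         \<bar>nderiv_on {0..1} j u2 x\<bar> \<le> C1 * \<epsilon> powr (- (real j / 2)) * exp (- \<beta> * (1 - x) / sqrt \<epsilon>)) \<and>
      is_LDG_solution k \<epsilon> b f (shishkin \<sigma> \<beta> \<epsilon> N) N Q U"
    from E obtain M where M: "N = 4 * M" by (auto elim: dvdE)
    have M1: "M \<ge> 1" using E M by simp
    have tr: "transition \<sigma> \<beta> \<epsilon> (4 * M) \<le> 1 / 4" using E M by simp
    note H' = H[unfolded M]
    have D: "layer_decomposition k M \<beta> \<sigma> C1 \<epsilon> u0 u1 u2"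
      by (rule layer_decomposition.intro) (use E H' M1 tr assms in blast)+
    have P: "shishkin_projection k M \<beta> \<sigma> C1 \<epsilon> u0 u1 u2 b (\<beta>\<^sup>2) bmax KP"
      by (rule shishkin_projection.intro[OF D KP])
    have A: "shishkin_ldg_axioms k M \<beta> \<sigma> \<epsilon> u0 u1 u2 b f u Q U \<kappa>"
      by (rule shishkin_ldg_axioms.intro) (use H' fc \<kappa> in blast)+
    interpret L: shishkin_ldg k M \<beta> \<sigma> C1 \<epsilon> u0 u1 u2 b "\<beta>\<^sup>2" bmax KP f u Q U \<kappa>
      by (rule shishkin_ldg.intro[OF P A])
    have e: "L.eq = (\<lambda>x. \<epsilon> * deriv u x - Q x)" "L.eu = (\<lambda>x. u x - U x)"
      by (auto simp: L.eq_def L.eu_def)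
    have se: "\<epsilon> powr (1 / 2) = L.s" "\<epsilon> powr (1 / 4) = sqrt L.s"
    proof -
      show 1: "\<epsilon> powr (1 / 2) = L.s" using E powr_half_sqrt[of \<epsilon>] by (simp add: L.s_def)
      have "\<epsilon> powr (1 / 4) = (\<epsilon> powr (1 / 2)) powr (1 / 2)" by (simp add: powr_powr)
      also have "\<dots> = sqrt L.s" unfolding 1 using powr_half_sqrt[of L.s] L.s(1) by simp
      finally show "\<epsilon> powr (1 / 4) = sqrt L.s" .
    qed
    have n: "real N = L.n" by (simp add: L.n_def M)
    \<comment> \<open>The inverse inequality has cost one power of \<open>N\<close>, so
      \<open>n * S\<close> is the term \<open>(1 / N) ^ k\<close> of the claim.\<close>
    have S: "(1 / real N) ^ (k + 1) = L.S" "(1 / real N) ^ k = L.n * L.S"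
      using L.n by (simp_all add: n L.S_def)
    have h: "(ln (real N) / real N) ^ (k + 1) = L.hh" by (simp only: n L.hh_def L.h_def)
    have x: "shishkin \<sigma> \<beta> \<epsilon> N = L.x" by (simp add: L.x_def M)
    have C: "sqrt L.CE \<le> C" by (simp add: C_def)
    have pos: "0 \<le> sqrt L.s * L.hh + L.s * (L.n * L.S) + L.S" "0 \<le> L.s * L.hh + sqrt L.s * (L.n * L.S) + L.hh"
      using L.s(1) L.S L.n by simp_all
    show "let mesh = shishkin \<sigma> \<beta> \<epsilon> N;
           e = ((\<lambda>x. \<epsilon> * deriv u x - Q x), (\<lambda>x. u x - U x));
           h = ln (real N) / real N
       in
         energy_norm \<epsilon> b mesh N e
           \<le> C * (\<epsilon> powr (1 / 4) * h ^ (k + 1) + \<epsilon> powr (1 / 2) * (1 / real N) ^ k + (1 / real N) ^ (k + 1)) \<and>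
         balanced_norm \<epsilon> b mesh N e
           \<le> C * (\<epsilon> powr (1 / 2) * h ^ (k + 1) + \<epsilon> powr (1 / 4) * (1 / real N) ^ k + h ^ (k + 1))"
      unfolding Let_def h S se x e[symmetric] unfolding M
      using order_trans[OF L.final_bounds(1) mult_right_mono[OF C pos(1)]]
        order_trans[OF L.final_bounds(2) mult_right_mono[OF C pos(2)]] by (rule conjI)
  qed
qed

end
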